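(* For each $w\in\mathbb C$, $\sigma\in\mathbb R$ and real $y$ with $-\pi/4<y<\pi/4$, the function $t\mapsto e^{yt}\xi_{\mathbb Q}(w,\sigma+it)$ ($t\in\mathbb R$) belongs to the Schwartz space $\mathcal S(\mathbb R)$. Furthermore, for any compact subset $\Omega$ of $\{(w,\sigma,y):w\in\mathbb C,\sigma\in\mathbb R,-\pi/4<y<\pi/4\}$, the Schwartz constants $\sup_t|t^n\frac{d^m}{dt^m}(e^{yt}\xi_{\mathbb Q}(w,\sigma+it))|$ can be bounded uniformly over $(w,\sigma,y)\in\Omega$. In particular there is a finite constant $A_1=A_1(\Omega)$ with $\sup_{(w,\sigma,y)\in\Omega,\,t\in\mathbb R}|e^{yt}\xi_{\mathbb Q}(w,\sigma+it)|\le A_1$.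
   Context: $\theta(t)=\sum_{n\in\mathbb Z}e^{-\pi n^2t}$ for $t>0$. $Z_{\mathbb Q}(w,s)=\int_0^\infty\theta(t^2)^s\theta(1/t^2)^{w-s}\frac{dt}{t}$ for $\Re(w)<\Re(s)<0$, continued meromorphically to $\mathbb C^2$; $\xi_{\mathbb Q}(w,s)=\frac{s(s-w)}{2w}Z_{\mathbb Q}(w,s)$ extends to an entire function on $\mathbb C^2$, denoted $\xi_{\mathbb Q}$. $\mathcal S(\mathbb R)$ is the space of smooth $f$ with $\sup_x|x^n f^{(m)}(x)|<\infty$ for all $m,n\ge0$. *)

theory Defs
  imports "HOL-Analysis.Analysis"
begin

definition theta :: "real \<Rightarrow> real" where
  "theta t = (\<Sum>\<^sub>\<infinity>n::int. exp (- pi * (of_int n)\<^sup>2 * t))"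

text \<open>
  The integral is meant only for \<open>Re w < Re s < 0\<close>, where it converges absolutely.
  Both bases are positive reals, so \<open>powr\<close> uses their real logarithms.
\<close>
definition Z_Q :: "complex \<Rightarrow> complex \<Rightarrow> complex" where
  "Z_Q w s = (LINT t:{0<..}|lborel.
     complex_of_real (theta (t\<^sup>2)) powr s * complex_of_real (theta (1 / t\<^sup>2)) powr (w - s)
       / complex_of_real t)"

text \<open>
  Holomorphy on all of \<open>\<complex>\<^sup>2\<close>: the Frechet derivative exists at every point
  and is complex linear.
\<close>
definition entire2 :: "(complex \<times> complex \<Rightarrow> complex) \<Rightarrow> bool" where
  "entire2 F \<longleftrightarrow>
     (\<forall>p. \<exists>a b. (F has_derivative (\<lambda>(h, k). a * h + b * k)) (at p))"

text \<open>
  By the identity theorem an entire function on \<open>\<complex>\<^sup>2\<close> is determined by its values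
  on the nonempty open region of convergence of the integral (on which \<open>w \<noteq> 0\<close>), so the
  entire extension can be described without first continuing \<open>Z_Q\<close>.
\<close>
definition xi_Q :: "complex \<Rightarrow> complex \<Rightarrow> complex" where
  "xi_Q w s = (THE F. entire2 F \<and>
      (\<forall>w s. Re w < Re s \<and> Re s < 0 \<longrightarrow> F (w, s) = s * (s - w) / (2 * w) * Z_Q w s)) (w, s)"

definition iter_deriv :: "nat \<Rightarrow> (real \<Rightarrow> complex) \<Rightarrow> real \<Rightarrow> complex" where
  "iter_deriv m f = ((\<lambda>g t. vector_derivative g (at t)) ^^ m) f"

definition smooth :: "(real \<Rightarrow> complex) \<Rightarrow> bool" where
  "smooth f \<longleftrightarrow> (\<forall>m t. iter_deriv m f differentiable (at t))"

text \<open>Extended-real valued, so that an infinite supremum is really \<open>\<infinity>\<close>.\<close>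
definition schwartz_const :: "nat \<Rightarrow> nat \<Rightarrow> (real \<Rightarrow> complex) \<Rightarrow> ereal" where
  "schwartz_const n m f = (SUP t. ereal (norm (complex_of_real (t ^ n) * iter_deriv m f t)))"

definition schwartz_space :: "(real \<Rightarrow> complex) set" where
  "schwartz_space = {f. smooth f \<and> (\<forall>m n. schwartz_const n m f < \<infinity>)}"

definition twisted_xi :: "complex \<Rightarrow> real \<Rightarrow> real \<Rightarrow> real \<Rightarrow> complex" where
  "twisted_xi w \<sigma> y t = complex_of_real (exp (y * t)) * xi_Q w (Complex \<sigma> t)"

definition param_domain :: "(complex \<times> real \<times> real) set" where
  "param_domain = {(w, \<sigma>, y). - pi / 4 < y \<and> y < pi / 4}"

end

theory Submission
  imports Defs "HOL-Complex_Analysis.Complex_Analysis" "HOL-Real_Asymp.Real_Asymp"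
begin

text \<open>
  Substitute \<open>t = e\<^sup>x\<close> and put \<open>\<Lambda>(u) = log \<theta>(e\<^sup>2\<^sup>u)\<close>. By the product formula
  \<open>\<Sum> q\<^bsup>j\<^sup>2\<^esup> = \<Prod> (1 - q\<^bsup>2k\<^esup>) (1 + q\<^bsup>2k-1\<^esup>)\<^sup>2\<close> theta has no zeros, so \<open>\<Lambda>\<close> is holomorphic on the strip
  \<open>|Im u| < \<pi>/4\<close>; it decays superexponentially to the right, and the functional equation of theta
  reads \<open>\<Lambda>(-u) = u + \<Lambda>(u)\<close>. Folding the integral at \<open>x = 0\<close> and removing the polar terms gives
  \<open>\<xi>(w,s) = 1/2 + s(s-w)/2 \<integral>\<^sub>0\<^sup>\<infinity> (e\<^bsup>w\<Lambda>(x)\<^esup> - 1)/w (e\<^bsup>(w-s)x\<^esup> + e\<^bsup>sx\<^esup>) dx\<close>, which is entire in \<open>(w,s)\<close>.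
  Rotating the two half lines to \<open>Im u = \<phi>\<close> and \<open>Im u = -\<phi>\<close> multiplies everything, including the
  boundary terms, by \<open>e\<^bsup>-i\<phi>s\<^esup>\<close>, whence \<open>\<xi>(w,\<sigma>+it) = O((1+|t|)\<^sup>2 e\<^bsup>\<phi>t\<^esup>)\<close> for every \<open>|\<phi>| < \<pi>/4\<close>, locally
  uniformly in \<open>(w,\<sigma>)\<close>. Cauchy's estimates turn this into bounds for all derivatives.
\<close>

section \<open>The product formula for theta\<close>

text \<open>Off the real axis the integrand makes sense only through a holomorphic logarithm of
  theta, so a zero-free product is needed and not merely a convergent series; the constant pi/4 is
  the half-width of the strip where that product converges. Both classical identities for theta are
  limits of finite algebraic identities, and in each case the passage to the limit is dominated
  convergence over the integers.

  The prefactor s(s-w)/(2w) is matched to the polar terms: the half lines contribute 1/(s-w) - 1/s,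
  and the product is exactly 1/2, which removes the poles and the division by w at once. The half
  lines turn in opposite directions because the second one is the reflection of the negative half
  line: x + i \<phi> and -(x - i \<phi>) together make up the whole line Im u = \<phi>. One angle
  gives decay for only one sign of t, so both \<phi> and -\<phi> are used; choosing \<phi> strictly
  beyond |y| leaves an exponential margin that absorbs the quadratic factor and, after Cauchy's
  estimates, every power of t.\<close>

text \<open>Via \<open>infsetsum\<close> the sum is an integral against counting measure, so the
  measure-theoretic theorem applies. Domination is only eventual, hence the shift of the sequence by
  \<open>N\<close>.\<close>

lemma infsum_dominated_convergence:
  fixes f :: "nat \<Rightarrow> 'a \<Rightarrow> 'b::{banach,second_countable_topology}"
  assumes lim: "\<And>k. (\<lambda>n. f n k) \<longlonglongrightarrow> F k"
    and dom: "\<forall>\<^sub>F n in sequentially. \<forall>k. norm (f n k) \<le> g k"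
    and g: "g summable_on UNIV"
  shows "(\<lambda>n. infsum (f n) UNIV) \<longlonglongrightarrow> infsum F UNIV"
proof -
  obtain N where N: "\<And>n k. n \<ge> N \<Longrightarrow> norm (f n k) \<le> g k"
    using dom by (auto simp: eventually_sequentially)
  have Fg: "norm (F k) \<le> g k" for k
    by (rule Lim_norm_ubound[OF _ lim]) (use N in \<open>auto simp: eventually_sequentially\<close>)
  have g0: "g k \<ge> 0" for k
    using order.trans[OF norm_ge_zero N[of N k]] by simp
  have g': "Infinite_Set_Sum.abs_summable_on g UNIV"
    using g g0 by (subst abs_summable_equivalent[symmetric]) simp
  have f': "Infinite_Set_Sum.abs_summable_on (f n) UNIV" if "n \<ge> N" for n
    by (rule abs_summable_on_comparison_test'[OF g']) (use N that in auto)
  have F': "Infinite_Set_Sum.abs_summable_on F UNIV"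
    by (rule abs_summable_on_comparison_test'[OF g']) (use Fg in auto)
  have "(\<lambda>n. infsetsum (f (n + N)) UNIV) \<longlonglongrightarrow> infsetsum F UNIV"
    unfolding infsetsum_def
    by (rule integral_dominated_convergence[where w = g])
       (use g' N LIMSEQ_ignore_initial_segment[OF lim] in \<open>auto simp: abs_summable_on_def\<close>)
  moreover have "infsetsum (f (n + N)) UNIV = infsum (f (n + N)) UNIV" for n
    by (rule infsetsum_infsum[OF f']) simp
  moreover have "infsetsum F UNIV = infsum F UNIV"
    by (rule infsetsum_infsum[OF F'])
  ultimately have "(\<lambda>n. infsum (f (n + N)) UNIV) \<longlonglongrightarrow> infsum F UNIV"
    by simp
  then show ?thesis
    by (rule LIMSEQ_offset)
qed

lemma power_square_summable_on_int:
  fixes r :: real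
  assumes "0 \<le> r" "r < 1"
  shows "(\<lambda>j::int. r ^ nat (j\<^sup>2)) summable_on UNIV"
proof -
  have s: "(\<lambda>n::nat. r ^ (n\<^sup>2)) summable_on UNIV"
  proof (subst summable_on_UNIV_nonneg_real_iff)
    show "summable (\<lambda>n::nat. r ^ (n\<^sup>2))"
      by (rule summable_comparison_test'[where g = "\<lambda>n. r ^ n" and N = 0])
         (use assms in \<open>auto intro!: summable_geometric power_decreasing simp: power2_eq_square\<close>)
  qed (use assms in auto)
  have 1: "(\<lambda>j::int. r ^ nat (j\<^sup>2)) summable_on range int"
    by (subst summable_on_reindex) (use s in \<open>auto simp: o_def nat_power_eq\<close>)
  have 2: "(\<lambda>j::int. r ^ nat (j\<^sup>2)) summable_on range (\<lambda>n. - int n)"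
    by (subst summable_on_reindex) (use s in \<open>auto simp: o_def nat_power_eq inj_on_def\<close>)
  have "range int \<union> range (\<lambda>n. - int n) = UNIV"
  proof -
    have "x \<in> range int \<union> range (\<lambda>n. - int n)" for x
      by (cases x rule: int_cases2) auto
    then show ?thesis by blast
  qed
  then show ?thesis
    using summable_on_union[OF 1 2] by simp
qed

section \<open>Gaussian binomials and the q-binomial theorem\<close>

text \<open>The q-Pochhammer symbol (Q;Q)_n.\<close>

definition qpoch :: "complex \<Rightarrow> nat \<Rightarrow> complex" where
  "qpoch Q n = (\<Prod>k<n. 1 - Q ^ Suc k)"

lemma qpoch_Suc: "qpoch Q (Suc n) = qpoch Q n * (1 - Q ^ Suc n)"
  by (simp add: qpoch_def)

lemma qpoch_0 [simp]: "qpoch Q 0 = 1"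
  by (simp add: qpoch_def)

lemma one_minus_power_nonzero:
  fixes Q :: complex
  assumes "norm Q < 1" "n > 0"
  shows "1 - Q ^ n \<noteq> 0"
proof
  assume "1 - Q ^ n = 0"
  then have "norm (Q ^ n) = 1" by simp
  then show False
    using assms power_less_one_iff[of "norm Q" n] by (simp add: norm_power)
qed

lemma qpoch_nonzero: "norm Q < 1 \<Longrightarrow> qpoch Q n \<noteq> 0"
  using one_minus_power_nonzero[of Q "Suc _"] by (auto simp: qpoch_def)

text \<open>The Gaussian binomial coefficient. The value 0 beyond \<open>N\<close> lets the Pascal
  rule hold for every \<open>j\<close>, including the edge \<open>j = N\<close>.\<close>

definition qbinom :: "complex \<Rightarrow> nat \<Rightarrow> nat \<Rightarrow> complex" where
  "qbinom Q N j = (if j \<le> N then qpoch Q N / (qpoch Q j * qpoch Q (N - j)) else 0)"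

text \<open>Over the common denominator the q-Pascal rule is 1 - Q^(N+1) = (1 - Q^(d+1)) + Q^(d+1)
  (1 - Q^(j+1)) with N = j + d + 1.\<close>

lemma qbinom_Suc_Suc:
  assumes "norm Q < 1"
  shows "qbinom Q (Suc N) (Suc j) = qbinom Q N (Suc j) + Q ^ (N - j) * qbinom Q N j"
proof -
  note nz = qpoch_nonzero[OF assms] one_minus_power_nonzero[OF assms]
  consider "j > N" | "j = N" | "j < N" by linarith
  then show ?thesis
  proof cases
    case 3
    then obtain d where d: "N = Suc (j + d)"
      using less_imp_Suc_add by blast
    have e: "N - j = Suc d" "N - Suc j = d" "Suc N - Suc j = Suc d" using d by auto
    have nz': "1 - Q ^ Suc j \<noteq> 0" "1 - Q ^ Suc d \<noteq> 0" using nz(2) by blast+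
    have "qbinom Q N (Suc j) = qpoch Q N * (1 - Q ^ Suc d) / (qpoch Q (Suc j) * qpoch Q (Suc d))"
      using 3 e nz nz' by (simp add: qbinom_def qpoch_Suc)
    moreover have "qbinom Q N j = qpoch Q N * (1 - Q ^ Suc j) / (qpoch Q (Suc j) * qpoch Q (Suc d))"
      using 3 e nz nz' by (simp add: qbinom_def qpoch_Suc)
    moreover have "qbinom Q (Suc N) (Suc j) = qpoch Q N * (1 - Q ^ Suc N) / (qpoch Q (Suc j) * qpoch Q (Suc d))"
      using 3 e by (simp add: qbinom_def qpoch_Suc)
    moreover have "1 - Q ^ Suc N = (1 - Q ^ Suc d) + Q ^ Suc d * (1 - Q ^ Suc j)"
      by (simp add: d algebra_simps power_add)
    then have "qpoch Q N * (1 - Q ^ Suc N) = qpoch Q N * (1 - Q ^ Suc d) + Q ^ (N - j) * (qpoch Q N * (1 - Q ^ Suc j))"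
      by (simp only: e(1) distrib_left mult_ac)
    ultimately show ?thesis
      by (simp only: add_divide_distrib times_divide_eq_right)
  next
    case 2
    then show ?thesis
      using nz(1) by (simp add: qbinom_def)
  qed (simp add: qbinom_def)
qed

lemma qbinom_0 [simp]: "norm Q < 1 \<Longrightarrow> qbinom Q N 0 = 1"
  using qpoch_nonzero[of Q N] by (simp add: qbinom_def)

lemma q_binomial_theorem:
  fixes Q z :: complex
  assumes Q: "norm Q < 1"
  shows "(\<Prod>k<N. 1 + z * Q ^ k) = (\<Sum>j\<le>N. qbinom Q N j * Q ^ (j * (j - 1) div 2) * z ^ j)"
proof (induction N)
  case 0
  then show ?case using Q by simp
next
  case (Suc N)
  define a where "a N j = qbinom Q N j * Q ^ (j * (j - 1) div 2) * z ^ j" for N j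
  \<comment> \<open>Consecutive triangular exponents differ by \<open>j\<close>, which cancels the
    \<open>- j\<close> in the exponent of the Pascal rule. What remains is the factor
    \<open>z * Q ^ N\<close>, independent of \<open>j\<close>, as the induction requires.\<close>
  have e: "Suc j * j div 2 + (N - j) = j * (j - 1) div 2 + N" if "j \<le> N" for j
  proof -
    have "Suc j * j = j * (j - 1) + 2 * j" by (cases j) auto
    then show ?thesis using that by simp
  qed
  have step: "a (Suc N) (Suc j) = a N (Suc j) + z * Q ^ N * a N j" if "j \<le> N" for j
  proof -
    have "a (Suc N) (Suc j) = a N (Suc j) + qbinom Q N j * (Q ^ (Suc j * j div 2) * Q ^ (N - j)) * z ^ Suc j"
      by (simp add: a_def qbinom_Suc_Suc[OF Q] algebra_simps)
    also have "Q ^ (Suc j * j div 2) * Q ^ (N - j) = Q ^ (j * (j - 1) div 2) * Q ^ N"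
      using e[OF that] by (metis power_add)
    finally show ?thesis by (simp add: a_def algebra_simps)
  qed
  have top: "a N (Suc N) = 0" by (simp add: a_def qbinom_def)
  have "(\<Sum>j\<le>Suc N. a (Suc N) j) = a (Suc N) 0 + (\<Sum>j\<le>N. a (Suc N) (Suc j))"
    by (rule sum.atMost_Suc_shift)
  also have "\<dots> = a N 0 + (\<Sum>j\<le>N. a N (Suc j)) + z * Q ^ N * (\<Sum>j\<le>N. a N j)"
    using Q by (simp add: step sum.distrib sum_distrib_left a_def[of _ 0])
  also have "a N 0 + (\<Sum>j\<le>N. a N (Suc j)) = (\<Sum>j\<le>N. a N j)"
    by (subst sum.atMost_Suc_shift[symmetric]) (simp add: top)
  finally show ?case
    using Suc by (simp add: a_def algebra_simps)
qed

text \<open>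
  The case \<open>z = q\<^sup>1\<^sup>-\<^sup>2\<^sup>n\<close>, \<open>Q = q\<^sup>2\<close>, \<open>N = 2n\<close> of the q-binomial theorem.
\<close>
lemma finite_theta_product:
  fixes q :: complex
  assumes q: "norm q < 1" "q \<noteq> 0"
  shows "(\<Prod>k<n. (1 + q ^ (2 * k + 1))\<^sup>2) = (\<Sum>j\<le>2*n. qbinom (q\<^sup>2) (2*n) j * q ^ nat ((int j - int n)\<^sup>2))"
proof -
  define z where "z = q powi (1 - 2 * int n)"
  have Q: "norm (q\<^sup>2) < 1" using q by (simp add: norm_power power_less_one_iff)
  have pw: "q powi (2 * int k) = (q\<^sup>2) ^ k" for k
    by (simp add: power_int_mult power_int_def nat_mult_distrib power_mult)
  \<comment> \<open>The factors are 1 + q^e with e running through the odd numbers from 1 - 2n to 2n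
    - 1. The positive half is already of the desired form. In the negative half 1 + q^(-e) = q^(-e)
    (1 + q^e), and the extracted powers multiply to q^(-n^2), since the first n odd numbers add up
    to n^2.\<close>
  have hi: "1 + z * (q\<^sup>2) ^ (n + k) = 1 + q ^ (2 * k + 1)" for k
  proof -
    have "z * (q\<^sup>2) ^ (n + k) = q powi (1 - 2 * int n + 2 * int (n + k))"
      unfolding z_def pw[symmetric] using q by (subst power_int_add) auto
    also have "1 - 2 * int n + 2 * int (n + k) = int (2 * k + 1)" by simp
    finally show ?thesis by (simp only: power_int_of_nat)
  qed
  have lo: "1 + z * (q\<^sup>2) ^ (n - Suc k) = q powi (- int (2 * k + 1)) * (1 + q ^ (2 * k + 1))" if "k < n" for k
  proof -
    have "z * (q\<^sup>2) ^ (n - Suc k) = q powi (1 - 2 * int n + 2 * int (n - Suc k))"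
      unfolding z_def pw[symmetric] using q by (subst power_int_add) auto
    also have "1 - 2 * int n + 2 * int (n - Suc k) = - int (2 * k + 1)" using that by (simp add: of_nat_diff)
    finally show ?thesis
      using q by (simp add: power_int_minus field_simps del: of_nat_add of_nat_mult of_nat_Suc)
  qed
  have powprod: "(\<Prod>k<n. q powi (- int (2 * k + 1))) = q powi (- int (n\<^sup>2))"
  proof (induction n)
    case (Suc n)
    have "q powi (- int (n\<^sup>2)) * q powi (- int (2 * n + 1)) = q powi (- int (n\<^sup>2) + - int (2 * n + 1))"
      using q by (subst power_int_add) auto
    also have "- int (n\<^sup>2) + - int (2 * n + 1) = - int ((Suc n)\<^sup>2)"
      by (simp add: power2_eq_square algebra_simps)
    finally show ?case using Suc by simp
  qed simp
  have "(\<Prod>k<2*n. 1 + z * (q\<^sup>2) ^ k) = (\<Prod>k<n. 1 + z * (q\<^sup>2) ^ k) * (\<Prod>k<n. 1 + z * (q\<^sup>2) ^ (n + k))"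
    using prod.nat_group[of "\<lambda>k. 1 + z * (q\<^sup>2) ^ k" n 2]
    by (simp add: mult_2 prod.atLeastLessThan_concat numeral_2_eq_2 lessThan_atLeast0
        prod.shift_bounds_nat_ivl[of _ 0 n n, simplified] add.commute)
  also have "(\<Prod>k<n. 1 + z * (q\<^sup>2) ^ k) = (\<Prod>k<n. 1 + z * (q\<^sup>2) ^ (n - Suc k))"
    by (rule prod.nat_diff_reindex[symmetric])
  also have "\<dots> = q powi (- int (n\<^sup>2)) * (\<Prod>k<n. 1 + q ^ (2 * k + 1))"
    unfolding powprod[symmetric] prod.distrib[symmetric] by (rule prod.cong) (use lo in auto)
  finally have L: "(\<Prod>k<2*n. 1 + z * (q\<^sup>2) ^ k) = q powi (- int (n\<^sup>2)) * (\<Prod>k<n. (1 + q ^ (2 * k + 1))\<^sup>2)"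
    by (simp only: hi) (simp add: prod.distrib power2_eq_square)
  \<comment> \<open>Completing the square: j(j-1) + (1-2n)j = (j-n)^2 - n^2. The power q^(-n^2) is
    the one extracted from the product, so it cancels.\<close>
  have R: "(q\<^sup>2) ^ (j * (j - 1) div 2) * z ^ j = q powi (- int (n\<^sup>2)) * q ^ nat ((int j - int n)\<^sup>2)" for j
  proof -
    have ev: "2 * (j * (j - 1) div 2) = j * (j - 1)" by (cases j) auto
    have "(q\<^sup>2) ^ (j * (j - 1) div 2) = q powi int (j * (j - 1))"
      by (simp only: power_mult[symmetric] ev power_int_of_nat)
    moreover have "z ^ j = q powi ((1 - 2 * int n) * int j)"
      by (simp add: z_def power_int_mult)
    moreover have "int (j * (j - 1)) + (1 - 2 * int n) * int j = - int (n\<^sup>2) + (int j - int n)\<^sup>2"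
      by (cases j) (auto simp: power2_eq_square algebra_simps)
    moreover have "q ^ nat ((int j - int n)\<^sup>2) = q powi ((int j - int n)\<^sup>2)"
      by (simp add: power_int_def)
    ultimately show ?thesis
      using q by (simp only: power_int_add[symmetric] simp_thms)
  qed
  have "q powi (- int (n\<^sup>2)) * (\<Prod>k<n. (1 + q ^ (2 * k + 1))\<^sup>2)
      = (\<Sum>j\<le>2*n. qbinom (q\<^sup>2) (2*n) j * (q\<^sup>2) ^ (j * (j - 1) div 2) * z ^ j)"
    using q_binomial_theorem[OF Q, where z = z and N = "2 * n"] unfolding L by simp
  also have "\<dots> = q powi (- int (n\<^sup>2)) * (\<Sum>j\<le>2*n. qbinom (q\<^sup>2) (2*n) j * q ^ nat ((int j - int n)\<^sup>2))"
    by (simp only: mult.assoc R sum_distrib_left) (simp add: algebra_simps)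
  finally show ?thesis using q by simp
qed

section \<open>A holomorphic logarithm of the infinite product\<close>

text \<open>The logarithmic series is dominated termwise by the geometric series.\<close>

lemma norm_Ln_1_plus_le:
  fixes z :: complex
  assumes z: "norm z < 1"
  shows "norm (Ln (1 + z)) \<le> norm z / (1 - norm z)"
proof -
  define a where "a n = - ((- z) ^ n) / of_nat n" for n
  have "a sums Ln (1 + z)"
    unfolding a_def using Ln_series'[OF z] by simp
  then have "(\<lambda>n. a (Suc n)) sums Ln (1 + z)"
    by (subst sums_Suc_iff) (simp add: a_def)
  then have eq: "Ln (1 + z) = (\<Sum>n. a (Suc n))"
    by (simp add: sums_iff)
  have "norm (a (Suc n)) \<le> norm z * norm z ^ n" for n
  proof -
    have "norm (a (Suc n)) = norm z ^ Suc n / real (Suc n)"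
      by (simp add: a_def norm_divide norm_power norm_mult del: of_nat_Suc)
    also have "\<dots> \<le> norm z ^ Suc n / 1"
      by (rule divide_left_mono) auto
    finally show ?thesis by simp
  qed
  moreover have "summable (\<lambda>n. norm z * norm z ^ n)"
    using z by (intro summable_mult summable_geometric) auto
  ultimately have "norm (\<Sum>n. a (Suc n)) \<le> (\<Sum>n. norm z * norm z ^ n)"
    by (rule norm_suminf_le)
  also have "\<dots> = norm z / (1 - norm z)"
    using z by (simp add: suminf_mult summable_geometric suminf_geometric)
  finally show ?thesis by (simp add: eq)
qed

definition log_theta_term :: "complex \<Rightarrow> nat \<Rightarrow> complex" where
  "log_theta_term q k = Ln (1 - (q\<^sup>2) ^ Suc k) + 2 * Ln (1 + q ^ (2 * k + 1))"

text \<open>A sum of principal logarithms of the factors, which need not be the principal logarithm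
  of theta. Each factor 1 + z has |z| < 1 and so stays in the right half plane; hence no branch cut
  is met even where theta itself winds around 0.\<close>

definition log_theta :: "complex \<Rightarrow> complex" where
  "log_theta q = (\<Sum>k. log_theta_term q k)"

text \<open>One majorant serves both kinds of factors, \<open>c = -1\<close> and
  \<open>c = 1\<close>. Bounding by \<open>r\<close> instead of \<open>norm q\<close> makes it
  uniform on discs, as the Weierstrass test needs.\<close>

lemma norm_Ln_1_plus_power_le:
  fixes q c :: complex
  assumes "norm q \<le> r" "r < 1" "Suc k \<le> m" "norm c = 1"
  shows "norm (Ln (1 + c * q ^ m)) \<le> r / (1 - r) * r ^ k"
proof -
  have "0 \<le> r" using assms(1) norm_ge_zero order.trans by blast
  have n: "norm (c * q ^ m) \<le> r ^ Suc k"
    using order.trans[OF power_mono[of "norm q" r m] power_decreasing[of "Suc k" m r]] assms \<open>0 \<le> r\<close>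
    by (simp add: norm_mult norm_power del: power_Suc)
  have "r ^ Suc k \<le> r" using \<open>0 \<le> r\<close> assms(2) by (simp add: mult_left_le power_le_one)
  then have "norm (c * q ^ m) < 1" and le: "norm (c * q ^ m) \<le> r" using n assms(2) by linarith+
  then have "norm (Ln (1 + c * q ^ m)) \<le> norm (c * q ^ m) / (1 - norm (c * q ^ m))"
    by (intro norm_Ln_1_plus_le)
  also have "\<dots> \<le> r ^ Suc k / (1 - r)"
    by (rule frac_le) (use n le assms(2) \<open>0 \<le> r\<close> in auto)
  finally show ?thesis by simp
qed

lemma norm_log_theta_term_le:
  assumes "norm q \<le> r" "r < 1"
  shows "norm (log_theta_term q k) \<le> 3 * (r / (1 - r)) * r ^ k"
proof -
  define B where "B = r / (1 - r) * r ^ k"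
  have "norm (Ln (1 + (-1) * q ^ (2 * Suc k))) \<le> B" "norm (Ln (1 + 1 * q ^ (2 * k + 1))) \<le> B"
    unfolding B_def by (rule norm_Ln_1_plus_power_le[OF assms]; simp)+
  moreover have "norm (log_theta_term q k) \<le> norm (Ln (1 + (-1) * q ^ (2 * Suc k))) + norm (2 * Ln (1 + 1 * q ^ (2 * k + 1)))"
    unfolding log_theta_term_def power_mult[symmetric]
    by (rule order.trans[OF norm_triangle_ineq]) simp
  ultimately have "norm (log_theta_term q k) \<le> 3 * B" by (simp add: norm_mult)
  then show ?thesis by (simp add: B_def mult.assoc)
qed

lemma summable_log_theta_term:
  assumes "norm q < 1"
  shows "summable (log_theta_term q)"
  by (rule summable_comparison_test'[where g = "\<lambda>k. 3 * (norm q / (1 - norm q)) * norm q ^ k" and N = 0])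
     (use norm_log_theta_term_le[OF order.refl assms] assms in \<open>auto intro!: summable_mult summable_geometric\<close>)

text \<open>The factor \<open>norm q\<close> in front is what matters: with q = exp(-pi e^(2u)) it
  becomes superexponential decay of the logarithm of theta.\<close>

lemma norm_log_theta_le:
  assumes "norm q < 1"
  shows "norm (log_theta q) \<le> 3 * norm q / (1 - norm q)\<^sup>2"
proof -
  have s: "summable (\<lambda>k. norm q ^ k)" using assms by (intro summable_geometric) auto
  have "norm (log_theta q) \<le> (\<Sum>k. 3 * (norm q / (1 - norm q)) * norm q ^ k)"
    unfolding log_theta_def
    by (rule norm_suminf_le[OF norm_log_theta_term_le[OF order.refl assms] summable_mult[OF s]])
  also have "\<dots> = 3 * (norm q / (1 - norm q)) * (1 / (1 - norm q))"
    using assms by (subst suminf_mult[OF s]) (simp add: suminf_geometric)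
  finally show ?thesis by (simp add: power2_eq_square)
qed

lemma one_plus_not_nonpos_Reals:
  fixes z :: complex
  assumes "norm z < 1"
  shows "1 + z \<notin> \<real>\<^sub>\<le>\<^sub>0"
proof
  assume "1 + z \<in> \<real>\<^sub>\<le>\<^sub>0"
  then have "Re (1 + z) \<le> 0" by (simp add: complex_nonpos_Reals_iff)
  then show False using abs_Re_le_cmod[of z] assms by simp
qed

lemma holomorphic_on_log_theta: "log_theta holomorphic_on ball 0 1"
proof (rule holomorphic_uniform_sequence[where f = "\<lambda>n q. \<Sum>k<n. log_theta_term q k"])
  show "(\<lambda>q. \<Sum>k<n. log_theta_term q k) holomorphic_on ball 0 1" for n
  proof -
    have "1 + (-1) * (q\<^sup>2) ^ Suc k \<notin> \<real>\<^sub>\<le>\<^sub>0" "1 + q ^ (2 * k + 1) \<notin> \<real>\<^sub>\<le>\<^sub>0" if "norm q < 1" for q :: complex and k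
    proof -
      have "norm q ^ m < 1" if "m > 0" for m
        using power_strict_decreasing[of 0 m "norm q"] \<open>norm q < 1\<close> that
        by (cases "q = 0") (auto simp: power_0_left)
      then show "1 + (-1) * (q\<^sup>2) ^ Suc k \<notin> \<real>\<^sub>\<le>\<^sub>0" "1 + q ^ (2 * k + 1) \<notin> \<real>\<^sub>\<le>\<^sub>0"
        by (intro one_plus_not_nonpos_Reals; simp add: norm_mult norm_power power_mult[symmetric] del: power_Suc mult_Suc_right)+
    qed
    then show ?thesis
      unfolding log_theta_term_def by (auto intro!: holomorphic_intros)
  qed
  fix x :: complex assume x: "x \<in> ball 0 1"
  \<comment> \<open>Half the distance to the unit circle: on the whole disc |q| is at most (1 +
    |x|)/2, so a single geometric series dominates.\<close>
  define d where "d = (1 - norm x) / 2"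
  have d: "d > 0" using x by (simp add: d_def)
  have r: "norm y \<le> norm x + d" if "y \<in> cball x d" for y
    using that norm_triangle_ineq2[of y x] by (simp add: dist_norm norm_minus_commute)
  have r1: "norm x + d < 1" "norm x + d \<ge> 0" using x by (auto simp: d_def field_simps)
  have "uniform_limit (cball x d) (\<lambda>n q. \<Sum>k<n. log_theta_term q k) (\<lambda>q. \<Sum>k. log_theta_term q k) sequentially"
    by (rule Weierstrass_m_test[OF norm_log_theta_term_le[OF r r1(1)]])
       (use r1 in \<open>auto intro!: summable_mult summable_geometric\<close>)
  then have "uniform_limit (cball x d) (\<lambda>n q. \<Sum>k<n. log_theta_term q k) log_theta sequentially"
    by (simp add: log_theta_def[abs_def])
  moreover have "cball x d \<subseteq> ball 0 1"
  proof
    fix y assume "y \<in> cball x d"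
    then have "norm y < 1" using r r1 order.strict_trans1 by blast
    then show "y \<in> ball 0 1" by simp
  qed
  ultimately show "\<exists>d>0. cball x d \<subseteq> ball 0 1 \<and> uniform_limit (cball x d) (\<lambda>n q. \<Sum>k<n. log_theta_term q k) log_theta sequentially"
    using d by blast
qed simp

text \<open>All factors are positive for 0 < r < 1, so every principal logarithm is real. This
  excludes ambiguities by multiples of 2 pi i when the logarithm of theta is identified on the real
  axis.\<close>

lemma log_theta_of_real:
  assumes "0 < r" "r < 1"
  shows "log_theta (of_real r) \<in> \<real>"
proof -
  have "log_theta_term (of_real r) k \<in> \<real>" for k
  proof -
    have "(r\<^sup>2) ^ Suc k < 1"
      using assms power_Suc_less_one[of r "2 * k + 1"] by (subst power_mult[symmetric]) simp
    then have "Ln (complex_of_real (1 - (r\<^sup>2) ^ Suc k)) \<in> \<real>"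
      "Ln (complex_of_real (1 + r ^ (2 * k + 1))) \<in> \<real>"
      using assms by (subst Ln_of_real; auto intro!: add_pos_pos)+
    then show ?thesis by (simp add: log_theta_term_def)
  qed
  then have "Im (log_theta_term (of_real r) k) = 0" for k by (simp add: complex_is_Real_iff)
  moreover have "Im (log_theta (of_real r)) = (\<Sum>k. Im (log_theta_term (of_real r) k))"
    unfolding log_theta_def using assms by (intro bounded_linear.suminf[OF bounded_linear_Im] summable_log_theta_term) auto
  ultimately show ?thesis by (simp add: complex_is_Real_iff)
qed

text \<open>The limit is the exponential of a convergent sum of logarithms, hence nonzero. That is
  needed because Gaussian binomials carry Pochhammer symbols in the denominator.\<close>

lemma qpoch_tendsto_nonzero:
  assumes Q: "norm Q < 1"
  obtains L where "qpoch Q \<longlonglongrightarrow> L" "L \<noteq> 0"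
proof
  define l where "l k = Ln (1 + (-1) * Q ^ Suc k)" for k
  have "norm (l k) \<le> norm Q / (1 - norm Q) * norm Q ^ k" if "k \<ge> 0" for k
    unfolding l_def by (rule norm_Ln_1_plus_power_le[OF order.refl Q]) auto
  from _ this have "summable l"
    by (rule summable_comparison_test'[where g = "\<lambda>k. norm Q / (1 - norm Q) * norm Q ^ k" and N = 0])
       (use Q in \<open>auto intro!: summable_mult summable_geometric\<close>)+
  then have "(\<lambda>n. exp (\<Sum>k<n. l k)) \<longlonglongrightarrow> exp (suminf l)"
    by (intro tendsto_exp summable_LIMSEQ)
  moreover have "exp (\<Sum>k<n. l k) = qpoch Q n" for n
    using one_minus_power_nonzero[OF Q, of "Suc _"] by (auto simp: exp_sum qpoch_def l_def intro!: prod.cong)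
  ultimately show "qpoch Q \<longlonglongrightarrow> exp (suminf l)" by simp
qed simp

text \<open>
  The limit of \<open>finite_theta_product\<close>: the case \<open>z = 1\<close> of the Jacobi triple product.
\<close>
theorem infsum_power_square:
  fixes q :: complex
  assumes q: "norm q < 1" "q \<noteq> 0"
  shows "(\<Sum>\<^sub>\<infinity>j::int. q ^ nat (j\<^sup>2)) = exp (log_theta q)"
proof -
  define Q where "Q = q\<^sup>2"
  have Q: "norm Q < 1" using q by (simp add: Q_def norm_power power_less_one_iff)
  obtain L where L: "qpoch Q \<longlonglongrightarrow> L" "L \<noteq> 0" by (rule qpoch_tendsto_nonzero[OF Q])
  have Li: "(\<lambda>n. inverse (qpoch Q n)) \<longlonglongrightarrow> inverse L" by (intro tendsto_inverse L)
  obtain B where B: "\<And>n. norm (qpoch Q n) \<le> B"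
    using convergent_imp_Bseq[OF convergentI[OF L(1)]] by (auto simp: Bseq_def)
  obtain B' where B': "\<And>n. norm (inverse (qpoch Q n)) \<le> B'"
    using convergent_imp_Bseq[OF convergentI[OF Li]] by (auto simp: Bseq_def)
  have B0: "B \<ge> 0" "B' \<ge> 0" using B[of 0] B'[of 0] by auto
  \<comment> \<open>The coefficient of q^(j^2) in the n-th approximant, extended by 0 to all
    integers \<open>j\<close> so that limits are taken termwise over a fixed index set. The extra
    factor \<open>qpoch Q n\<close> supplies the factors 1 - q^(2k) that
    \<open>finite_theta_product\<close> does not contain. As a quotient of Pochhammer symbols the
    coefficient is bounded uniformly in \<open>n\<close> and \<open>j\<close> and tends to L L / (L
    L) = 1.\<close>
  define d where "d n j = (if \<bar>j\<bar> \<le> int n then qpoch Q n * qbinom Q (2 * n) (nat (j + int n)) else 0)" for n j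
  have d_eq: "d n j = qpoch Q n * qpoch Q (2 * n) * (inverse (qpoch Q (nat (int n + j))) * inverse (qpoch Q (nat (int n - j))))"
    if "\<bar>j\<bar> \<le> int n" for n j
  proof -
    have "2 * n - nat (int n + j) = nat (int n - j)" "nat (int n + j) \<le> 2 * n" using that by auto
    then show ?thesis using that by (simp add: d_def qbinom_def divide_inverse add.commute[of j])
  qed
  have d_bound: "norm (d n j) \<le> B * B * (B' * B')" for n j
  proof (cases "\<bar>j\<bar> \<le> int n")
    case True
    then show ?thesis
      unfolding d_eq[OF True] norm_mult by (intro mult_mono B B' mult_nonneg_nonneg B0) auto
  next
    case False
    then show ?thesis using B0 by (simp add: d_def)
  qed
  have d_lim: "(\<lambda>n. d n j) \<longlonglongrightarrow> 1" for j
  proof -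
    have f: "filterlim (\<lambda>n. nat (int n + i)) sequentially sequentially" for i
      unfolding filterlim_at_top
    proof
      fix Z show "\<forall>\<^sub>F n in sequentially. Z \<le> nat (int n + i)"
        using eventually_ge_at_top[of "Z + nat \<bar>i\<bar>"] by eventually_elim auto
    qed
    have f2: "filterlim (\<lambda>n::nat. 2 * n) sequentially sequentially"
      by (rule filterlim_subseq) (auto simp: strict_mono_def)
    have "(\<lambda>n. qpoch Q n * qpoch Q (2 * n) * (inverse (qpoch Q (nat (int n + j))) * inverse (qpoch Q (nat (int n - j)))))
        \<longlonglongrightarrow> L * L * (inverse L * inverse L)"
      using filterlim_compose[OF Li f[of "-j"]]
      by (intro tendsto_mult L filterlim_compose[OF L(1) f2] filterlim_compose[OF Li f]) auto
    moreover have "\<forall>\<^sub>F n in sequentially. qpoch Q n * qpoch Q (2 * n) * (inverse (qpoch Q (nat (int n + j))) * inverse (qpoch Q (nat (int n - j)))) = d n j"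
      using eventually_ge_at_top[of "nat \<bar>j\<bar>"] by eventually_elim (subst d_eq, auto)
    ultimately have "(\<lambda>n. d n j) \<longlonglongrightarrow> L * L * (inverse L * inverse L)"
      by (rule Lim_transform_eventually)
    moreover have "L * L * (inverse L * inverse L) = 1" using L(2) by (simp add: field_simps)
    ultimately show ?thesis by metis
  qed
  have sumeq: "infsum (\<lambda>j. d n j * q ^ nat (j\<^sup>2)) UNIV = exp (\<Sum>k<n. log_theta_term q k)" for n
  proof -
    have nz: "1 + q ^ (2 * k + 1) \<noteq> 0" for k
      using one_minus_power_nonzero[of "-q" "2 * k + 1"] q by simp
    have "infsum (\<lambda>j. d n j * q ^ nat (j\<^sup>2)) UNIV = infsum (\<lambda>j. d n j * q ^ nat (j\<^sup>2)) {- int n..int n}"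
      by (rule infsum_cong_neutral) (auto simp: d_def)
    also have "\<dots> = (\<Sum>j\<in>{- int n..int n}. d n j * q ^ nat (j\<^sup>2))" by simp
    also have "\<dots> = (\<Sum>j\<le>2*n. qpoch Q n * (qbinom Q (2*n) j * q ^ nat ((int j - int n)\<^sup>2)))"
      by (rule sum.reindex_bij_witness[where i = "\<lambda>j. int j - int n" and j = "\<lambda>j. nat (j + int n)"])
         (auto simp: d_def nat_le_iff)
    also have "\<dots> = qpoch Q n * (\<Prod>k<n. (1 + q ^ (2 * k + 1))\<^sup>2)"
      unfolding finite_theta_product[OF q] Q_def[symmetric] by (simp add: sum_distrib_left)
    also have "\<dots> = (\<Prod>k<n. (1 - Q ^ Suc k) * (1 + q ^ (2 * k + 1))\<^sup>2)"
      by (simp add: qpoch_def prod.distrib)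
    also have "\<dots> = (\<Prod>k<n. exp (log_theta_term q k))"
      using nz one_minus_power_nonzero[OF Q, of "Suc _"]
      by (intro prod.cong) (auto simp: log_theta_term_def exp_add Q_def exp_double)
    finally show ?thesis by (simp add: exp_sum)
  qed
  have "(\<lambda>n. infsum (\<lambda>j. d n j * q ^ nat (j\<^sup>2)) UNIV) \<longlonglongrightarrow> infsum (\<lambda>j. q ^ nat (j\<^sup>2)) UNIV"
  proof (rule infsum_dominated_convergence)
    show "(\<lambda>n. d n k * q ^ nat (k\<^sup>2)) \<longlonglongrightarrow> q ^ nat (k\<^sup>2)" for k
      using tendsto_mult[OF d_lim tendsto_const] by simp
    show "\<forall>\<^sub>F n in sequentially. \<forall>k. norm (d n k * q ^ nat (k\<^sup>2)) \<le> B * B * (B' * B') * norm q ^ nat (k\<^sup>2)"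
      by (intro always_eventually allI) (simp only: norm_mult norm_power mult_right_mono[OF d_bound] zero_le_power norm_ge_zero)
    show "(\<lambda>k::int. B * B * (B' * B') * norm q ^ nat (k\<^sup>2)) summable_on UNIV"
      by (intro summable_on_cmult_right power_square_summable_on_int) (use q in auto)
  qed
  moreover have "(\<lambda>n. exp (\<Sum>k<n. log_theta_term q k)) \<longlonglongrightarrow> exp (log_theta q)"
    unfolding log_theta_def using q by (intro tendsto_exp summable_LIMSEQ summable_log_theta_term)
  ultimately show ?thesis
    unfolding sumeq by (rule LIMSEQ_unique)
qed

section \<open>The functional equation of theta\<close>

text \<open>Since \<open>l\<close> is odd, the symmetric range -p..p is a complete residue system
  modulo \<open>l\<close>. Factoring out the term \<open>c\<close> for k = -p leaves a geometric sum
  in an l-th root of unity.\<close>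

lemma sum_cis_roots_of_unity:
  fixes p :: nat and d :: int
  defines "l \<equiv> 2 * p + 1"
  shows "(\<Sum>k\<in>{- int p..int p}. cis (2 * pi * of_int k * of_int d / real l)) = (if int l dvd d then of_nat l else 0)"
proof -
  have l: "l > 0" by (simp add: l_def)
  define z where "z = cis (2 * pi * of_int d / real l)"
  define c where "c = cis (- (2 * pi * real p * of_int d / real l))"
  have "(\<Sum>k\<in>{- int p..int p}. cis (2 * pi * of_int k * of_int d / real l)) = (\<Sum>i<l. c * z ^ i)"
  proof (rule sum.reindex_bij_witness[where i = "\<lambda>i. int i - int p" and j = "\<lambda>k. nat (k + int p)"])
    fix k assume k: "k \<in> {- int p..int p}"
    then obtain i where i: "k = int i - int p"
      by (metis atLeastAtMost_iff add.commute diff_add_cancel nonneg_int_cases neg_le_iff_le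
          add.inverse_inverse diff_minus_eq_add le_iff_diff_le_0 minus_le_iff diff_ge_0_iff_ge)
    have "z ^ i = cis (real i * (2 * pi * of_int d / real l))"
      by (simp add: z_def Complex.DeMoivre)
    then show "c * z ^ nat (k + int p) = cis (2 * pi * of_int k * of_int d / real l)"
      by (simp add: i c_def cis_mult) (simp add: field_simps l)
  qed (auto simp: l_def)
  also have "\<dots> = (if int l dvd d then of_nat l else 0)"
  proof (cases "int l dvd d")
    case True
    then obtain e where e: "d = int l * e" by blast
    have "2 * pi * of_int d / real l = 2 * pi * of_int e"
      using l by (simp add: e)
    then have "z = 1" by (simp add: z_def cis_multiple_2pi)
    moreover have "2 * pi * real p * of_int d / real l = 2 * pi * of_int (int p * e)"
      using l by (simp add: e)
    then have "c = 1" unfolding c_def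
      by (metis cis_multiple_2pi cis_cnj complex_cnj_one Ints_of_int)
    ultimately show ?thesis using True by simp
  next
    case False
    have "z \<noteq> 1"
    proof
      assume "z = 1"
      then have "cos (2 * pi * of_int d / real l) = 1" by (simp add: z_def complex_eq_iff)
      then obtain n :: int where "2 * pi * of_int d / real l = of_int n * 2 * pi"
        by (auto simp: cos_one_2pi_int)
      then have "real_of_int d = of_int n * real l" using l by (simp add: field_simps)
      then have "d = n * int l" by (metis of_int_eq_iff of_int_mult of_int_of_nat_eq)
      then show False using False by simp
    qed
    moreover have "z ^ l = 1"
    proof -
      have "z ^ l = cis (2 * pi * of_int d)" using l by (simp add: z_def Complex.DeMoivre)
      then show ?thesis by (simp add: cis_multiple_2pi)
    qed
    ultimately have "(\<Sum>i<l. z ^ i) = 0" by (simp add: geometric_sum)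
    then show ?thesis using False by (simp add: sum_distrib_left[symmetric])
  qed
  finally show ?thesis .
qed

text \<open>Binomial coefficients of row \<open>2m\<close>, indexed by the distance from the middle.\<close>
definition mid_binom :: "nat \<Rightarrow> int \<Rightarrow> real" where
  "mid_binom m i = (if \<bar>i\<bar> \<le> int m then real ((2 * m) choose nat (int m + i)) else 0)"

text \<open>
  Averaging \<open>(\<omega> + \<omega>\<^sup>-\<^sup>1)\<^sup>2\<^sup>m\<close> over \<open>\<omega> = exp (\<pi> i k / l)\<close>: this turns into the functional
  equation of theta when \<open>l\<close> and \<open>m\<close> tend to infinity with \<open>l\<^sup>2 / m\<close> fixed (Polya's proof).
\<close>
lemma sum_cos_power_eq:
  fixes p m :: nat
  defines "l \<equiv> 2 * p + 1"
  shows "(\<Sum>k\<in>{- int p..int p}. cos (pi * of_int k / real l) ^ (2 * m)) =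
    real l / 4 ^ m * (\<Sum>\<nu>\<in>{- int m..int m}. mid_binom m (int l * \<nu>))"
proof -
  have l: "l > 0" by (simp add: l_def)
  \<comment> \<open>Only the even frequencies 2(j-m) occur because the exponent is 2m; at y = pi k /
    l they become l-th roots of unity, so orthogonality applies and selects the j congruent to m
    modulo l.\<close>
  have e: "complex_of_real ((2 * cos y) ^ (2 * m)) =
      (\<Sum>j\<le>2*m. of_nat ((2 * m) choose j) * cis (2 * y * of_int (int j - int m)))" for y
  proof -
    have "complex_of_real (2 * cos y) = cis y + cis (- y)"
      by (simp add: complex_eq_iff)
    then have "complex_of_real ((2 * cos y) ^ (2 * m)) = (cis y + cis (- y)) ^ (2 * m)"
      by (metis of_real_power)
    also have "\<dots> = (\<Sum>j\<le>2*m. of_nat ((2 * m) choose j) * cis y ^ j * cis (- y) ^ (2 * m - j))"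
      by (rule binomial_ring)
    also have "\<dots> = (\<Sum>j\<le>2*m. of_nat ((2 * m) choose j) * cis (2 * y * of_int (int j - int m)))"
    proof (rule sum.cong)
      fix j assume "j \<in> {..2 * m}"
      then have "cis y ^ j * cis (- y) ^ (2 * m - j) = cis (2 * y * of_int (int j - int m))"
        by (simp add: Complex.DeMoivre cis_mult of_nat_diff algebra_simps)
      then show "of_nat ((2 * m) choose j) * cis y ^ j * cis (- y) ^ (2 * m - j)
          = of_nat ((2 * m) choose j) * cis (2 * y * of_int (int j - int m))"
        by (simp add: mult.assoc)
    qed simp
    finally show ?thesis .
  qed
  have "complex_of_real (\<Sum>k\<in>{- int p..int p}. (2 * cos (pi * of_int k / real l)) ^ (2 * m)) =
      (\<Sum>k\<in>{- int p..int p}. \<Sum>j\<le>2*m. of_nat ((2 * m) choose j) * cis (2 * pi * of_int k * of_int (int j - int m) / real l))"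
    by (simp only: of_real_sum e) (simp add: algebra_simps)
  also have "\<dots> = (\<Sum>j\<le>2*m. of_nat ((2 * m) choose j) *
      (\<Sum>k\<in>{- int p..int p}. cis (2 * pi * of_int k * of_int (int j - int m) / real l)))"
    by (subst sum.swap) (simp add: sum_distrib_left)
  also have "\<dots> = (\<Sum>j\<le>2*m. of_nat ((2 * m) choose j) * (if int l dvd int j - int m then of_nat l else 0))"
    unfolding l_def sum_cis_roots_of_unity ..
  also have "\<dots> = (\<Sum>j\<in>{j\<in>{..2*m}. int l dvd int j - int m}. of_nat l * of_nat ((2 * m) choose j))"
    by (subst sum.inter_filter) (auto intro!: sum.cong)
  also have "\<dots> = (\<Sum>\<nu>\<in>{\<nu>\<in>{- int m..int m}. \<bar>int l * \<nu>\<bar> \<le> int m}. of_nat l * of_real (mid_binom m (int l * \<nu>)))"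
  proof (rule sum.reindex_bij_witness[where i = "\<lambda>\<nu>. nat (int m + int l * \<nu>)" and j = "\<lambda>j. (int j - int m) div int l"])
    fix j assume "j \<in> {j\<in>{..2*m}. int l dvd int j - int m}"
    then obtain \<nu> where \<nu>: "int j - int m = int l * \<nu>" and j: "j \<le> 2 * m" by auto
    have d: "(int j - int m) div int l = \<nu>" using l by (simp add: \<nu>)
    have j': "int j = int m + int l * \<nu>" using \<nu> by simp
    show "nat (int m + int l * ((int j - int m) div int l)) = j"
      unfolding d using j' by linarith
    have a: "\<bar>int l * \<nu>\<bar> \<le> int m" using j j' by linarith
    have "\<bar>\<nu>\<bar> \<le> \<bar>int l * \<nu>\<bar>" using l by (simp add: abs_mult mult_le_cancel_right1)
    then show "(int j - int m) div int l \<in> {\<nu>\<in>{- int m..int m}. \<bar>int l * \<nu>\<bar> \<le> int m}"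
      unfolding d using a by auto
    have "nat (int m + int l * \<nu>) = j" using j' by linarith
    then show "of_nat l * of_real (mid_binom m (int l * ((int j - int m) div int l))) = (of_nat l * of_nat ((2 * m) choose j) :: complex)"
      unfolding d using a by (simp add: mid_binom_def)
  next
    fix \<nu> assume "\<nu> \<in> {\<nu>\<in>{- int m..int m}. \<bar>int l * \<nu>\<bar> \<le> int m}"
    then have a: "\<bar>int l * \<nu>\<bar> \<le> int m" by simp
    then have n: "int (nat (int m + int l * \<nu>)) = int m + int l * \<nu>" by simp
    show "(int (nat (int m + int l * \<nu>)) - int m) div int l = \<nu>"
      unfolding n using l by simp
    have "nat (int m + int l * \<nu>) \<le> 2 * m" using a by linarith
    then show "nat (int m + int l * \<nu>) \<in> {j\<in>{..2*m}. int l dvd int j - int m}"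
      using n by simp
  qed
  \<comment> \<open>The range of \<nu> is enlarged to one not involving \<open>l\<close>; the new
    terms vanish by the default value of \<open>mid_binom\<close>.\<close>
  also have "\<dots> = (\<Sum>\<nu>\<in>{- int m..int m}. of_nat l * of_real (mid_binom m (int l * \<nu>)))"
    by (rule sum.mono_neutral_left) (auto simp: mid_binom_def)
  also have "\<dots> = complex_of_real (real l * (\<Sum>\<nu>\<in>{- int m..int m}. mid_binom m (int l * \<nu>)))"
    by (simp add: sum_distrib_left)
  finally have "(\<Sum>k\<in>{- int p..int p}. (2 * cos (pi * of_int k / real l)) ^ (2 * m)) =
      real l * (\<Sum>\<nu>\<in>{- int m..int m}. mid_binom m (int l * \<nu>))"
    by (simp only: of_real_eq_iff)
  moreover have "(2 * cos y) ^ (2 * m) = 4 ^ m * cos y ^ (2 * m)" for y :: real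
    by (simp add: power_mult_distrib power_mult)
  ultimately have "4 ^ m * (\<Sum>k\<in>{- int p..int p}. cos (pi * of_int k / real l) ^ (2 * m)) =
      real l * (\<Sum>\<nu>\<in>{- int m..int m}. mid_binom m (int l * \<nu>))"
    by (simp only: sum_distrib_left)
  moreover have "y = b / c * z" if "c * y = b * z" "c \<noteq> 0" for b c y z :: real
    using that by (simp add: field_simps)
  ultimately show ?thesis by simp
qed

section \<open>Gaussian asymptotics of the binomial row\<close>

text \<open>The ratio is m! m! / ((m+i)! (m-i)!), with its factors paired as (m-i+1+r)/(m+1+r). In
  this form it has exactly \<open>i\<close> factors, each close to 1 - i/m, so termwise bounds yield
  exponents of size i^2/m.\<close>

lemma mid_binom_ratio:
  assumes "i \<le> m"
  shows "mid_binom m (int i) / mid_binom m 0 = (\<Prod>r<i. 1 - real i / real (m + Suc r))"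
proof -
  have "(\<Prod>r<i. 1 - real i / real (m + Suc r)) = (\<Prod>r<i. real (m - i + Suc r) / real (m + Suc r))"
    using assms by (intro prod.cong) (auto simp: field_simps of_nat_diff)
  also have "\<dots> = (fact m / fact (m - i)) / (fact (m + i) / fact m)"
  proof -
    have f: "(\<Prod>r<i. real (a + Suc r)) = fact (a + i) / fact a" for a
    proof (induction i)
      case (Suc i)
      have "fact (a + Suc i) = real (a + Suc i) * (fact (a + i) :: real)" by simp
      then show ?case using Suc by (simp del: of_nat_Suc of_nat_add fact_Suc)
    qed simp
    show ?thesis unfolding prod_dividef f using assms by simp
  qed
  finally have R: "(\<Prod>r<i. 1 - real i / real (m + Suc r)) = fact m * fact m / (fact (m + i) * fact (m - i))"
    by simp
  have "mid_binom m (int i) = fact (2 * m) / (fact (m + i) * fact (m - i))"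
  proof -
    have "nat (int m + int i) = m + i" "2 * m - (m + i) = m - i" using assms by auto
    then show ?thesis using assms by (simp add: mid_binom_def binomial_fact)
  qed
  moreover have "mid_binom m 0 = fact (2 * m) / (fact m * fact m)"
    using binomial_fact[of m "2 * m", where 'a = real] by (simp add: mid_binom_def)
  ultimately show ?thesis unfolding R by simp
qed

lemma mid_binom_minus: "mid_binom m (- i) = mid_binom m i"
proof (cases "\<bar>i\<bar> \<le> int m")
  case True
  then have "nat (int m + i) \<le> 2 * m" "2 * m - nat (int m + i) = nat (int m - i)" by linarith+
  then show ?thesis
    using True binomial_symmetric[of "nat (int m + i)" "2 * m"] by (simp add: mid_binom_def)
qed (simp add: mid_binom_def)

lemma mid_binom_nonneg: "mid_binom m i \<ge> 0"
  by (simp add: mid_binom_def)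

lemma mid_binom_0_pos: "mid_binom m 0 > 0"
  by (simp add: mid_binom_def)

text \<open>Each denominator m+1+r is at most m+i, so each of the \<open>i\<close> factors is at
  most 1 - i/(m+i), and 1 - x <= exp(-x).\<close>

lemma mid_binom_ratio_upper:
  assumes "i \<le> m" "m > 0"
  shows "mid_binom m (int i) / mid_binom m 0 \<le> exp (- (real i)\<^sup>2 / (real m + real i))"
proof -
  have "mid_binom m (int i) / mid_binom m 0 \<le> (\<Prod>r<i. exp (- real i / (real m + real i)))"
    unfolding mid_binom_ratio[OF assms(1)]
  proof (rule prod_mono)
    fix r assume r: "r \<in> {..<i}"
    have "real i / real (m + Suc r) \<le> 1" using assms by simp
    moreover have "1 - real i / real (m + Suc r) \<le> 1 - real i / (real m + real i)"
      using r assms by (intro diff_left_mono divide_left_mono) auto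
    moreover have "1 - real i / (real m + real i) \<le> exp (- real i / (real m + real i))"
      using exp_ge_add_one_self[of "- real i / (real m + real i)"] by simp
    ultimately show "0 \<le> 1 - real i / real (m + Suc r) \<and> 1 - real i / real (m + Suc r) \<le> exp (- real i / (real m + real i))"
      by linarith
  qed
  also have "\<dots> = exp (- (real i)\<^sup>2 / (real m + real i))"
    by (simp add: exp_of_nat_mult[symmetric] power2_eq_square)
  finally show ?thesis .
qed

text \<open>The smallest factor is the one with r = 0, namely 1 - x with x = i/(m+1). Then 1/(1-x) =
  1 + x/(1-x) <= exp(x/(1-x)) bounds all factors from below.\<close>

lemma mid_binom_ratio_lower:
  assumes "i \<le> m"
  shows "exp (- (real i)\<^sup>2 / (real m + 1 - real i)) \<le> mid_binom m (int i) / mid_binom m 0"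
proof -
  define x where "x = real i / (real m + 1)"
  have x: "0 \<le> x" "x < 1" using assms by (auto simp: x_def)
  have "exp (- (x / (1 - x))) \<le> 1 - x"
  proof -
    have "1 / (1 - x) \<le> exp (x / (1 - x))"
      using exp_ge_add_one_self[of "x / (1 - x)"] x by (simp add: field_simps)
    then show ?thesis using x by (simp add: exp_minus field_simps)
  qed
  moreover have "x / (1 - x) = real i / (real m + 1 - real i)"
  proof -
    have "1 - x = (real m + 1 - real i) / (real m + 1)" by (simp add: x_def field_simps)
    then show ?thesis by (simp add: x_def)
  qed
  ultimately have "exp (- (real i / (real m + 1 - real i))) \<le> 1 - x"
    by simp
  then have b: "exp (- real i / (real m + 1 - real i)) \<le> 1 - real i / (real m + 1)"
    by (simp add: x_def)
  have "exp (- (real i)\<^sup>2 / (real m + 1 - real i)) = (\<Prod>r<i. exp (- real i / (real m + 1 - real i)))"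
    by (simp add: exp_of_nat_mult[symmetric] power2_eq_square)
  also have "\<dots> \<le> mid_binom m (int i) / mid_binom m 0"
    unfolding mid_binom_ratio[OF assms]
  proof (rule prod_mono)
    fix r assume r: "r \<in> {..<i}"
    have "1 - real i / (real m + 1) \<le> 1 - real i / real (m + Suc r)"
      by (intro diff_left_mono divide_left_mono) auto
    then show "0 \<le> exp (- real i / (real m + 1 - real i)) \<and> exp (- real i / (real m + 1 - real i)) \<le> 1 - real i / real (m + Suc r)"
      using b by auto
  qed
  finally show ?thesis .
qed

text \<open>The right-hand side is the reciprocal of a partial Wallis product, so this encodes the
  asymptotics 4^n / sqrt(pi n) of the central binomial coefficient without Stirling's
  formula.\<close>

lemma mid_binom_0_wallis: "(mid_binom n 0 / 4 ^ n)\<^sup>2 * (2 * real n + 1) = 1 / (\<Prod>k=1..n. (4*real k^2) / (4*real k^2 - 1))"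
proof (induction n)
  case 0
  then show ?case by (simp add: mid_binom_def)
next
  case (Suc n)
  have b: "mid_binom n 0 = fact (2 * n) / (fact n * fact n)" for n
    using binomial_fact[of n "2 * n", where 'a = real] by (simp add: mid_binom_def)
  have f: "fact (2 * Suc n) = real (2 * n + 2) * (real (2 * n + 1) * fact (2 * n))"
    by simp
  have f': "fact (Suc n) = real (n + 1) * fact n" by simp
  have "mid_binom (Suc n) 0 = mid_binom n 0 * ((2 * real n + 2) * (2 * real n + 1) / ((real n + 1) * (real n + 1)))"
    unfolding b f f' by (simp add: divide_simps del: fact_Suc) (simp add: algebra_simps)
  also have "(2 * real n + 2) * (2 * real n + 1) / ((real n + 1) * (real n + 1)) = 2 * (2 * real n + 1) / (real n + 1)"
    by (simp add: divide_simps) (simp add: algebra_simps)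
  finally have r: "mid_binom (Suc n) 0 / 4 ^ Suc n = (mid_binom n 0 / 4 ^ n) * ((2 * real n + 1) / (2 * (real n + 1)))"
    by (simp add: divide_simps) (simp add: algebra_simps)
  have "(mid_binom (Suc n) 0 / 4 ^ Suc n)\<^sup>2 * (2 * real (Suc n) + 1)
      = ((mid_binom n 0 / 4 ^ n)\<^sup>2 * (2 * real n + 1)) * ((2 * real n + 1) * (2 * real n + 3) / (2 * (real n + 1))\<^sup>2)"
  proof -
    have "(c * (a / b))\<^sup>2 * d = (c\<^sup>2 * a) * (a * d / b\<^sup>2)" for a b c d :: real
      by (simp add: power2_eq_square)
    moreover have "2 * real (Suc n) + 1 = 2 * real n + 3" by simp
    ultimately show ?thesis unfolding r by metis
  qed
  also have "(2 * real n + 1) * (2 * real n + 3) / (2 * (real n + 1))\<^sup>2 = 1 / ((4*real (Suc n)^2) / (4*real (Suc n)^2 - 1))"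
    by (simp add: power2_eq_square divide_simps) (simp add: algebra_simps)
  finally show ?case by (simp add: Suc)
qed

text \<open>The function cos y exp(y^2/2) starts at 1 and decreases: its derivative has the sign of
  y cos y - sin y, which itself decreases from 0. The estimate dominates the cosine powers by a
  Gaussian.\<close>

lemma cos_le_exp:
  fixes x :: real
  assumes "\<bar>x\<bar> \<le> pi / 2"
  shows "cos x \<le> exp (- x\<^sup>2 / 2)"
proof -
  have g: "y * cos y - sin y \<le> 0" if "0 \<le> y" "y \<le> pi / 2" for y :: real
  proof -
    have "y * cos y - sin y \<le> 0 * cos 0 - sin 0"
    proof (rule DERIV_nonpos_imp_nonincreasing[OF that(1)])
      fix z assume z: "0 \<le> z" "z \<le> y"
      have "((\<lambda>y. y * cos y - sin y) has_real_derivative (- z * sin z)) (at z)"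
        by (auto intro!: derivative_eq_intros)
      moreover have "- z * sin z \<le> 0"
        using z that sin_ge_zero[of z] by simp
      ultimately show "\<exists>d. ((\<lambda>y. y * cos y - sin y) has_real_derivative d) (at z) \<and> d \<le> 0" by blast
    qed
    then show ?thesis by simp
  qed
  define y where "y = \<bar>x\<bar>"
  have "cos y * exp (y\<^sup>2 / 2) \<le> cos 0 * exp (0\<^sup>2 / 2)"
  proof (rule DERIV_nonpos_imp_nonincreasing[where f = "\<lambda>y. cos y * exp (y\<^sup>2 / 2)"])
    show "0 \<le> y" by (simp add: y_def)
    fix z assume z: "0 \<le> z" "z \<le> y"
    have "((\<lambda>y. cos y * exp (y\<^sup>2 / 2)) has_real_derivative (exp (z\<^sup>2 / 2) * (z * cos z - sin z))) (at z)"
      by (auto intro!: derivative_eq_intros simp: algebra_simps)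
    moreover have "exp (z\<^sup>2 / 2) * (z * cos z - sin z) \<le> 0"
      using g[of z] z assms by (intro mult_nonneg_nonpos) (auto simp: y_def)
    ultimately show "\<exists>d. ((\<lambda>y. cos y * exp (y\<^sup>2 / 2)) has_real_derivative d) (at z) \<and> d \<le> 0" by blast
  qed
  then have "cos y \<le> exp (- (y\<^sup>2 / 2))" by (simp add: exp_minus field_simps)
  then show ?thesis by (simp add: y_def)
qed

lemma theta_eq: "theta t = (\<Sum>\<^sub>\<infinity>n::int. exp (- pi * t) ^ nat (n\<^sup>2))"
proof -
  have "exp (- pi * (of_int n)\<^sup>2 * t) = exp (- pi * t) ^ nat (n\<^sup>2)" for n :: int
    by (simp add: exp_of_nat_mult[symmetric] algebra_simps)
  then show ?thesis by (simp add: theta_def)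
qed

text \<open>With m/l^2 tending to 1/(pi t), the term cos(pi k/l)^(2m) tends to exp(-pi k^2/t), the
  normalized binomial at distance l \<nu> from the middle tends to exp(-pi t \<nu>^2), and the
  prefactor l binom(2m,m)/4^m, asymptotic to l/sqrt(pi m), tends to sqrt t.\<close>

theorem theta_inversion:
  assumes t: "t > 0"
  shows "theta (1 / t) = sqrt t * theta t"
proof -
  define l where "l p = 2 * p + (1::nat)" for p
  \<comment> \<open>Rounding up gives \<open>x p\<close> the lower bound 1/(pi t), which makes the
    Gaussian majorant of the cosine terms independent of \<open>p\<close>.\<close>
  define m where "m p = nat \<lceil>(real (l p))\<^sup>2 / (pi * t)\<rceil>" for p
  define x where "x p = real (m p) / (real (l p))\<^sup>2" for p
  have l: "real (l p) \<ge> 1" for p by (simp add: l_def)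
  have m: "(real (l p))\<^sup>2 / (pi * t) \<le> real (m p)" "real (m p) \<le> (real (l p))\<^sup>2 / (pi * t) + 1" for p
  proof -
    have "(real (l p))\<^sup>2 / (pi * t) \<ge> 0" using t by simp
    then show "(real (l p))\<^sup>2 / (pi * t) \<le> real (m p)" "real (m p) \<le> (real (l p))\<^sup>2 / (pi * t) + 1"
      unfolding m_def by linarith+
  qed
  have x_lower: "1 / (pi * t) \<le> x p" for p
    using m(1)[of p] l[of p] by (simp add: x_def field_simps)
  have x_upper: "x p \<le> 1 / (pi * t) + 1 / (real (l p))\<^sup>2" for p
  proof -
    have "x p \<le> ((real (l p))\<^sup>2 / (pi * t) + 1) / (real (l p))\<^sup>2"
      unfolding x_def by (intro divide_right_mono m) auto
    then show ?thesis using l[of p] by (simp add: add_divide_distrib)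
  qed
  have linv: "(\<lambda>p. 1 / (real (l p))) \<longlonglongrightarrow> 0" "(\<lambda>p. 1 / (real (l p))\<^sup>2) \<longlonglongrightarrow> 0"
    unfolding l_def by real_asymp+
  have x_lim: "x \<longlonglongrightarrow> 1 / (pi * t)"
  proof (rule tendsto_sandwich[where f = "\<lambda>_. 1 / (pi * t)" and h = "\<lambda>p. 1 / (pi * t) + 1 / (real (l p))\<^sup>2"])
    show "(\<lambda>p. 1 / (pi * t) + 1 / (real (l p))\<^sup>2) \<longlonglongrightarrow> 1 / (pi * t)"
      using tendsto_add[OF tendsto_const linv(2)] by simp
  qed (use x_lower x_upper in auto)
  have x_pos: "x p > 0" for p using x_lower[of p] t by (meson less_le_trans mult_pos_pos pi_gt_zero zero_less_divide_1_iff)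
  have m_eq: "real (m p) = x p * (real (l p))\<^sup>2" for p using l[of p] by (simp add: x_def)
  have m_pos: "m p > 0" for p using m_eq[of p] x_pos[of p] l[of p] by (metis gr0I less_numeral_extra(3) mult_pos_pos of_nat_0 zero_less_one zero_less_power less_le_trans)
  have m_top: "filterlim m at_top sequentially"
  proof -
    have "filterlim (\<lambda>p. (real (l p))\<^sup>2 / (pi * t)) at_top sequentially"
      unfolding l_def using t by real_asymp
    then have "filterlim (\<lambda>p. real (m p)) at_top sequentially"
      by (rule filterlim_at_top_mono) (use m in auto)
    then show ?thesis by (simp add: filterlim_sequentially_iff_filterlim_real)
  qed
  define A where "A p k = (if \<bar>k\<bar> \<le> int p then cos (pi * of_int k / real (l p)) ^ (2 * m p) else 0)" for p k
  define R where "R p \<nu> = mid_binom (m p) (int (l p) * \<nu>) / mid_binom (m p) 0" for p \<nu>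
  define c where "c p = real (l p) * mid_binom (m p) 0 / 4 ^ m p" for p
  have eq: "infsum (A p) UNIV = c p * infsum (R p) UNIV" for p
  proof -
    have "infsum (A p) UNIV = infsum (A p) {- int p..int p}"
      by (rule infsum_cong_neutral) (auto simp: A_def)
    also have "\<dots> = (\<Sum>k\<in>{- int p..int p}. cos (pi * of_int k / real (2 * p + 1)) ^ (2 * m p))"
      by (simp only: infsum_finite finite_atLeastAtMost_int) (intro sum.cong; auto simp: A_def l_def)
    also have "\<dots> = real (2 * p + 1) / 4 ^ m p * (\<Sum>\<nu>\<in>{- int (m p)..int (m p)}. mid_binom (m p) (int (2 * p + 1) * \<nu>))"
      by (rule sum_cos_power_eq)
    also have "\<dots> = c p * (\<Sum>\<nu>\<in>{- int (m p)..int (m p)}. R p \<nu>)"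
      using mid_binom_0_pos[of "m p"] by (simp add: c_def R_def l_def sum_divide_distrib[symmetric])
    also have "(\<Sum>\<nu>\<in>{- int (m p)..int (m p)}. R p \<nu>) = infsum (R p) {- int (m p)..int (m p)}"
      by simp
    also have "\<dots> = infsum (R p) UNIV"
    proof (rule infsum_cong_neutral)
      fix \<nu> assume "\<nu> \<in> UNIV - {- int (m p)..int (m p)}"
      then have "int (m p) < \<bar>\<nu>\<bar>" by auto
      also have "\<bar>\<nu>\<bar> \<le> \<bar>int (l p) * \<nu>\<bar>" by (simp add: abs_mult mult_le_cancel_right1 l_def)
      finally show "R p \<nu> = 0" by (simp add: R_def mid_binom_def)
    qed auto
    finally show ?thesis .
  qed
  \<comment> \<open>Because |k| <= p and l = 2p+1, all angles stay strictly between -pi/2 and pi/2,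
    where the cosine is positive and has a logarithm.\<close>
  have A_angle: "\<bar>pi * of_int k / real (l p)\<bar> < pi / 2" if "\<bar>k\<bar> \<le> int p" for p k
  proof -
    have "2 * \<bar>real_of_int k\<bar> < real (l p)" using that by (simp add: l_def)
    then show ?thesis using l[of p] by (simp add: abs_mult field_simps)
  qed
  have A_bound: "norm (A p k) \<le> exp (- pi * (1 / t)) ^ nat (k\<^sup>2)" for p k
  proof (cases "\<bar>k\<bar> \<le> int p")
    case True
    define y where "y = pi * of_int k / real (l p)"
    have y: "\<bar>y\<bar> < pi / 2" using A_angle[OF True] by (simp add: y_def)
    then have c0: "cos y \<ge> 0" by (intro cos_ge_zero) auto
    have "norm (A p k) = cos y ^ (2 * m p)" using True c0 by (simp add: A_def y_def)
    also have "\<dots> \<le> exp (- y\<^sup>2 / 2) ^ (2 * m p)"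
      using c0 cos_le_exp[of y] y by (intro power_mono) auto
    also have "\<dots> = exp (- (real (m p) * y\<^sup>2))" by (simp add: exp_of_nat_mult[symmetric])
    also have "real (m p) * y\<^sup>2 = x p * (pi * of_int k)\<^sup>2"
      by (simp add: x_def y_def power_divide)
    also have "exp (- (x p * (pi * of_int k)\<^sup>2)) \<le> exp (- (1 / (pi * t) * (pi * of_int k)\<^sup>2))"
      using mult_right_mono[OF x_lower, of "(pi * of_int k)\<^sup>2" p] by simp
    also have "\<dots> = exp (- pi * (1 / t)) ^ nat (k\<^sup>2)"
      using t by (simp add: exp_of_nat_mult[symmetric] power2_eq_square field_simps)
    finally show ?thesis .
  qed (simp add: A_def)
  have A_lim: "(\<lambda>p. A p k) \<longlonglongrightarrow> exp (- pi * (1 / t)) ^ nat (k\<^sup>2)" for k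
  proof (cases "k = 0")
    case True
    then show ?thesis by (simp add: A_def)
  next
    case False
    define y where "y p = pi * of_int k / real (l p)" for p
    have y_lim: "filterlim y (at 0) sequentially"
      unfolding filterlim_at
    proof
      have "(\<lambda>p. (pi * of_int k) * (1 / real (l p))) \<longlonglongrightarrow> (pi * of_int k) * 0"
        by (intro tendsto_mult tendsto_const linv)
      then show "y \<longlonglongrightarrow> 0" by (simp add: y_def[abs_def])
      have "y p \<noteq> 0" for p using False l[of p] by (simp add: y_def)
      then show "\<forall>\<^sub>F p in sequentially. y p \<in> UNIV \<and> y p \<noteq> 0" by simp
    qed
    \<comment> \<open>From 2m ln(cos y) = 2 (m y^2) (ln(cos y)/y^2) and m y^2 = x (pi k)^2, the
      limit of the power reduces to this second-order expansion. Division by y^2 is the reason for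
      treating k = 0 separately.\<close>
    have "((\<lambda>y::real. ln (cos y) / y\<^sup>2) \<longlongrightarrow> - 1 / 2) (at 0)" by real_asymp
    then have "(\<lambda>p. ln (cos (y p)) / (y p)\<^sup>2) \<longlonglongrightarrow> - 1 / 2"
      by (rule filterlim_compose[OF _ y_lim])
    then have "(\<lambda>p. exp (2 * (x p * (pi * of_int k)\<^sup>2) * (ln (cos (y p)) / (y p)\<^sup>2))) \<longlonglongrightarrow>
        exp (2 * (1 / (pi * t) * (pi * of_int k)\<^sup>2) * (- 1 / 2))"
      by (intro tendsto_exp tendsto_mult tendsto_const x_lim)
    also have "exp (2 * (1 / (pi * t) * (pi * of_int k)\<^sup>2) * (- 1 / 2)) = exp (- pi * (1 / t)) ^ nat (k\<^sup>2)"
      using t by (simp add: exp_of_nat_mult[symmetric] power2_eq_square field_simps)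
    finally show ?thesis
    proof (rule Lim_transform_eventually)
      show "\<forall>\<^sub>F p in sequentially. exp (2 * (x p * (pi * of_int k)\<^sup>2) * (ln (cos (y p)) / (y p)\<^sup>2)) = A p k"
        using eventually_ge_at_top[of "nat \<bar>k\<bar>"]
      proof eventually_elim
        case (elim p)
        then have k: "\<bar>k\<bar> \<le> int p" by auto
        have c: "cos (y p) > 0" using A_angle[OF k] unfolding y_def by (intro cos_gt_zero_pi) linarith+
        have y0: "y p \<noteq> 0" using False l[of p] by (simp add: y_def)
        have "x p * (pi * of_int k)\<^sup>2 = real (m p) * (y p)\<^sup>2"
          by (simp add: x_def y_def power_divide)
        then have "2 * (x p * (pi * of_int k)\<^sup>2) * (ln (cos (y p)) / (y p)\<^sup>2) = real (2 * m p) * ln (cos (y p))"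
          using y0 by simp
        then show ?case
          using k c by (simp only: exp_of_nat_mult exp_ln) (simp add: A_def y_def)
      qed
    qed
  qed
  have R_abs: "R p \<nu> = mid_binom (m p) (int (l p * nat \<bar>\<nu>\<bar>)) / mid_binom (m p) 0" for p \<nu>
    using mid_binom_minus[of "m p" "int (l p) * \<nu>"] by (cases "\<nu> \<ge> 0") (auto simp: R_def)
  \<comment> \<open>A lower bound for all 1/\<open>x p\<close>, since \<open>x p\<close> is at most
    1/(pi t) + 1. The further factor 1/2 in the majorant comes from m + l |\<nu>| <= 2m; outside
    that range the binomial term is 0.\<close>
  define \<delta> where "\<delta> = 1 / (1 / (pi * t) + 1)"
  have \<delta>: "\<delta> > 0" using t by (auto simp: \<delta>_def intro!: divide_pos_pos add_pos_pos)
  have R_bound: "norm (R p \<nu>) \<le> exp (- \<delta> / 2) ^ nat (\<nu>\<^sup>2)" for p \<nu>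
  proof -
    define n where "n = nat \<bar>\<nu>\<bar>"
    have n: "real (nat (\<nu>\<^sup>2)) = (real n)\<^sup>2" by (simp add: n_def)
    have nn: "norm (R p \<nu>) = R p \<nu>" using mid_binom_nonneg mid_binom_0_pos[of "m p"] by (simp add: R_def)
    show ?thesis
    proof (cases "l p * n \<le> m p")
      case True
      have "R p \<nu> \<le> exp (- (real (l p * n))\<^sup>2 / (real (m p) + real (l p * n)))"
        unfolding R_abs n_def[symmetric] by (rule mid_binom_ratio_upper[OF True m_pos])
      also have "\<dots> \<le> exp (- (real (l p * n))\<^sup>2 / (2 * real (m p)))"
      proof -
        have "real (l p * n) \<le> real (m p)" using True of_nat_mono by blast
        then have "(real (l p * n))\<^sup>2 / (2 * real (m p)) \<le> (real (l p * n))\<^sup>2 / (real (m p) + real (l p * n))"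
          using m_pos[of p] by (intro divide_left_mono mult_pos_pos) (auto intro!: add_pos_nonneg)
        then show ?thesis by simp
      qed
      also have "(real (l p * n))\<^sup>2 / (2 * real (m p)) = (real n)\<^sup>2 / (2 * x p)"
        using l[of p] by (simp add: m_eq power_mult_distrib)
      then have "exp (- (real (l p * n))\<^sup>2 / (2 * real (m p))) = exp (- ((real n)\<^sup>2 / (2 * x p)))"
        by simp
      also have "\<dots> \<le> exp (- ((real n)\<^sup>2 * (\<delta> / 2)))"
      proof -
        have "(real (l p))\<^sup>2 \<ge> 1" using l[of p] by simp
        then have "1 / (real (l p))\<^sup>2 \<le> 1" using l[of p] by simp
        then have "x p \<le> 1 / (pi * t) + 1" using x_upper[of p] by linarith
        then have "\<delta> \<le> 1 / x p" using x_pos[of p] unfolding \<delta>_def by (intro divide_left_mono mult_pos_pos) auto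
        then have "(real n)\<^sup>2 * (\<delta> / 2) \<le> (real n)\<^sup>2 * (1 / x p / 2)"
          by (intro mult_left_mono) auto
        then show ?thesis by simp
      qed
      also have "\<dots> = exp (- \<delta> / 2) ^ nat (\<nu>\<^sup>2)"
        by (simp add: exp_of_nat_mult[symmetric] n)
      finally show ?thesis unfolding nn .
    next
      case False
      then have "R p \<nu> = 0" unfolding R_abs n_def[symmetric] by (simp add: mid_binom_def flip: of_nat_mult)
      then show ?thesis by simp
    qed
  qed
  have R_lim: "(\<lambda>p. R p \<nu>) \<longlonglongrightarrow> exp (- pi * t) ^ nat (\<nu>\<^sup>2)" for \<nu>
  proof -
    define n where "n = nat \<bar>\<nu>\<bar>"
    have n: "real (nat (\<nu>\<^sup>2)) = (real n)\<^sup>2" by (simp add: n_def)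
    have lim: "exp (- ((real n)\<^sup>2 / (1 / (pi * t)))) = exp (- pi * t) ^ nat (\<nu>\<^sup>2)"
      by (simp add: exp_of_nat_mult[symmetric] n)
    have ev: "\<forall>\<^sub>F p in sequentially. l p * n \<le> m p"
    proof -
      have "filterlim (\<lambda>p. real (l p)) at_top sequentially" unfolding l_def by real_asymp
      then have "\<forall>\<^sub>F p in sequentially. real n * (pi * t) \<le> real (l p)"
        by (simp add: filterlim_at_top)
      then show ?thesis
      proof eventually_elim
        case (elim p)
        have "real (l p * n) \<le> (real (l p))\<^sup>2 / (pi * t)"
          using mult_left_mono[OF elim, of "real (l p)"] t by (simp add: field_simps power2_eq_square)
        then show ?case using m(1)[of p] of_nat_le_iff by (metis order.trans)
      qed
    qed
    show ?thesis
    \<comment> \<open>The two outer functions are the lower and upper binomial bounds at i = l n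
      with numerator and denominator of the exponent divided by l^2; both tend to the same Gaussian
      value.\<close>
    proof (rule tendsto_sandwich)
      show "(\<lambda>p. exp (- ((real n)\<^sup>2 / (x p + 1 / (real (l p))\<^sup>2 - real n * (1 / real (l p)))))) \<longlonglongrightarrow> exp (- pi * t) ^ nat (\<nu>\<^sup>2)"
      proof -
        have "(\<lambda>p. x p + 1 / (real (l p))\<^sup>2 - real n * (1 / real (l p))) \<longlonglongrightarrow> 1 / (pi * t) + 0 - real n * 0"
          by (intro tendsto_intros x_lim linv)
        then have "(\<lambda>p. x p + 1 / (real (l p))\<^sup>2 - real n * (1 / real (l p))) \<longlonglongrightarrow> 1 / (pi * t)" by simp
        then show ?thesis unfolding lim[symmetric]
          by (intro tendsto_exp tendsto_minus tendsto_divide tendsto_const) (use t in auto)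
      qed
      show "(\<lambda>p. exp (- ((real n)\<^sup>2 / (x p + real n * (1 / real (l p)))))) \<longlonglongrightarrow> exp (- pi * t) ^ nat (\<nu>\<^sup>2)"
      proof -
        have "(\<lambda>p. x p + real n * (1 / real (l p))) \<longlonglongrightarrow> 1 / (pi * t) + real n * 0"
          by (intro tendsto_intros x_lim linv)
        then have "(\<lambda>p. x p + real n * (1 / real (l p))) \<longlonglongrightarrow> 1 / (pi * t)" by simp
        then show ?thesis unfolding lim[symmetric]
          by (intro tendsto_exp tendsto_minus tendsto_divide tendsto_const) (use t in auto)
      qed
      show "\<forall>\<^sub>F p in sequentially. exp (- ((real n)\<^sup>2 / (x p + 1 / (real (l p))\<^sup>2 - real n * (1 / real (l p))))) \<le> R p \<nu>"
        using ev
      proof eventually_elim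
        case (elim p)
        define L where "L = real (l p)"
        have L: "L > 0" using l[of p] by (simp add: L_def)
        have "real (m p) + 1 - real (l p * n) = L\<^sup>2 * (x p + 1 / L\<^sup>2 - real n * (1 / L))"
          using L by (simp add: m_eq L_def[symmetric] field_simps power2_eq_square)
        then have "(real (l p * n))\<^sup>2 / (real (m p) + 1 - real (l p * n)) = (real n)\<^sup>2 / (x p + 1 / L\<^sup>2 - real n * (1 / L))"
          using L by (simp add: power_mult_distrib L_def[symmetric])
        then show ?case
          using mid_binom_ratio_lower[OF elim] unfolding R_abs n_def[symmetric] L_def by simp
      qed
      show "\<forall>\<^sub>F p in sequentially. R p \<nu> \<le> exp (- ((real n)\<^sup>2 / (x p + real n * (1 / real (l p)))))"
        using ev
      proof eventually_elim
        case (elim p)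
        define L where "L = real (l p)"
        have L: "L > 0" using l[of p] by (simp add: L_def)
        have "real (m p) + real (l p * n) = L\<^sup>2 * (x p + real n * (1 / L))"
          using L by (simp add: m_eq L_def[symmetric] field_simps power2_eq_square)
        then have "(real (l p * n))\<^sup>2 / (real (m p) + real (l p * n)) = (real n)\<^sup>2 / (x p + real n * (1 / L))"
          using L by (simp add: power_mult_distrib L_def[symmetric])
        then show ?case
          using mid_binom_ratio_upper[OF elim m_pos] unfolding R_abs n_def[symmetric] L_def by simp
      qed
    qed
  qed
  have c_lim: "c \<longlonglongrightarrow> sqrt t"
  proof -
    define W where "W n = (\<Prod>k=1..n. (4*real k^2) / (4*real k^2 - 1))" for n
    have W: "(\<lambda>p. W (m p)) \<longlonglongrightarrow> pi / 2"
      unfolding W_def by (rule filterlim_compose[OF wallis m_top])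
    \<comment> \<open>Squaring brings in the Wallis product: c^2 = 1/(W (2x + 1/l^2)), whose limit
      is (2/pi)(pi t/2) = t.\<close>
    have "c = (\<lambda>p. sqrt (1 / W (m p) / (2 * x p + 1 / (real (l p))\<^sup>2)))"
    proof
      fix p
      define L where "L = real (l p)"
      have L: "L > 0" using l[of p] by (simp add: L_def)
      have "2 * real (m p) + 1 = L\<^sup>2 * (2 * x p + 1 / L\<^sup>2)"
        using L by (simp add: m_eq L_def[symmetric] field_simps)
      then have "(mid_binom (m p) 0 / 4 ^ m p)\<^sup>2 * (L\<^sup>2 * (2 * x p + 1 / L\<^sup>2)) = 1 / W (m p)"
        using mid_binom_0_wallis[of "m p"] by (simp add: W_def)
      moreover have "2 * x p + 1 / L\<^sup>2 > 0" using x_pos[of p] by (intro add_pos_nonneg) auto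
      ultimately have "(c p)\<^sup>2 = 1 / W (m p) / (2 * x p + 1 / L\<^sup>2)"
      proof -
        have "(a * b)\<^sup>2 = e / d" if "b\<^sup>2 * (a\<^sup>2 * d) = e" "d > 0" for a b d e :: real
          using that by (auto simp: power_mult_distrib)
        moreover have "c p = L * (mid_binom (m p) 0 / 4 ^ m p)" by (simp add: c_def L_def)
        ultimately show ?thesis
          using \<open>(mid_binom (m p) 0 / 4 ^ m p)\<^sup>2 * (L\<^sup>2 * (2 * x p + 1 / L\<^sup>2)) = 1 / W (m p)\<close> \<open>2 * x p + 1 / L\<^sup>2 > 0\<close>
          by metis
      qed
      moreover have "c p \<ge> 0" using mid_binom_nonneg by (simp add: c_def)
      ultimately show "c p = sqrt (1 / W (m p) / (2 * x p + 1 / (real (l p))\<^sup>2))"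
        unfolding L_def by (metis real_sqrt_unique)
    qed
    moreover have "(\<lambda>p. sqrt (1 / W (m p) / (2 * x p + 1 / (real (l p))\<^sup>2))) \<longlonglongrightarrow> sqrt (1 / (pi / 2) / (2 * (1 / (pi * t)) + 0))"
      using t by (intro tendsto_intros W x_lim linv) auto
    moreover have "1 / (pi / 2) / (2 * (1 / (pi * t)) + 0) = t" using t by (simp add: field_simps)
    ultimately show ?thesis by (simp only:)
  qed
  have "(\<lambda>p. infsum (A p) UNIV) \<longlonglongrightarrow> theta (1 / t)"
    unfolding theta_eq
  proof (rule infsum_dominated_convergence[OF A_lim])
    show "(\<lambda>k::int. exp (- pi * (1 / t)) ^ nat (k\<^sup>2)) summable_on UNIV"
      using t by (intro power_square_summable_on_int) auto
  qed (use A_bound in auto)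
  moreover have "(\<lambda>p. c p * infsum (R p) UNIV) \<longlonglongrightarrow> sqrt t * theta t"
    unfolding theta_eq
  proof (intro tendsto_mult c_lim infsum_dominated_convergence[OF R_lim])
    show "(\<lambda>k::int. exp (- \<delta> / 2) ^ nat (k\<^sup>2)) summable_on UNIV"
      using \<delta> by (intro power_square_summable_on_int) auto
  qed (use R_bound in auto)
  ultimately show ?thesis
    unfolding eq by (rule LIMSEQ_unique)
qed

section \<open>The logarithm of theta on a strip\<close>

definition strip :: "complex set" where
  "strip = {u. \<bar>Im u\<bar> < pi / 4}"

lemma open_strip: "open strip"
  unfolding strip_def by (intro open_Collect_less continuous_intros)

lemma convex_strip: "convex strip"
proof -
  have "strip = {u. Im u < pi / 4} \<inter> {u. Im u > - (pi / 4)}"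
    by (auto simp: strip_def)
  then show ?thesis by (metis convex_Int convex_halfspace_Im_lt convex_halfspace_Im_gt)
qed

lemma minus_in_strip [simp]: "- u \<in> strip \<longleftrightarrow> u \<in> strip"
  by (simp add: strip_def)

lemma zero_in_strip [simp]: "0 \<in> strip"
  by (simp add: strip_def)

lemma of_real_in_strip [simp]: "of_real x \<in> strip"
  by (simp add: strip_def)

definition nome :: "complex \<Rightarrow> complex" where
  "nome u = exp (- of_real pi * exp (2 * u))"

lemma norm_nome: "norm (nome u) = exp (- pi * (exp (2 * Re u) * cos (2 * Im u)))"
  by (simp add: nome_def Re_exp)

text \<open>The source of pi/4: the modulus is below 1 exactly when cos(2 Im u) > 0, and the
  component of that set containing the real axis is |Im u| < pi/4.\<close>

lemma norm_nome_less_1: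
  assumes "u \<in> strip"
  shows "norm (nome u) < 1"
proof -
  have "cos (2 * Im u) > 0"
    using assms by (intro cos_gt_zero_pi) (auto simp: strip_def abs_less_iff)
  then show ?thesis by (simp add: norm_nome)
qed

definition Lam :: "complex \<Rightarrow> complex" where
  "Lam u = log_theta (nome u)"

lemma holomorphic_Lam: "Lam holomorphic_on strip"
proof -
  have "(log_theta \<circ> nome) holomorphic_on strip"
  proof (rule holomorphic_on_compose_gen[OF _ holomorphic_on_log_theta])
    show "nome holomorphic_on strip"
      unfolding nome_def[abs_def] by (intro holomorphic_intros)
  qed (use norm_nome_less_1 in auto)
  then show ?thesis by (simp add: Lam_def[abs_def] o_def)
qed

lemma nome_of_real: "nome (of_real x) = of_real (exp (- pi * exp (2 * x)))"
  by (simp add: nome_def flip: exp_of_real)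

lemma Lam_of_real: "Lam (of_real x) \<in> \<real>"
  unfolding Lam_def nome_of_real by (rule log_theta_of_real) auto

lemma of_real_theta: "of_real (theta (exp (2 * x))) = exp (Lam (of_real x))"
proof -
  define r where "r = exp (- pi * exp (2 * x))"
  have r: "0 < r" "r < 1" by (auto simp: r_def)
  have "(\<lambda>n::int. r ^ nat (n\<^sup>2)) summable_on UNIV"
    using r by (intro power_square_summable_on_int) auto
  then have "((\<lambda>n::int. r ^ nat (n\<^sup>2)) has_sum theta (exp (2 * x))) UNIV"
    by (simp add: theta_eq r_def has_sum_infsum)
  then have "((\<lambda>n::int. of_real (r ^ nat (n\<^sup>2))) has_sum complex_of_real (theta (exp (2 * x)))) UNIV"
    by (rule has_sum_of_real)
  then have "(\<Sum>\<^sub>\<infinity>n::int. complex_of_real r ^ nat (n\<^sup>2)) = of_real (theta (exp (2 * x)))"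
    by (intro infsumI) simp
  then show ?thesis
    using infsum_power_square[of "of_real r"] r by (simp add: Lam_def nome_of_real r_def)
qed

text \<open>On the real axis this is the real logarithm of \<open>theta_inversion\<close> at e^(2x).
  Both sides are holomorphic on the connected strip, so the identity theorem extends it.\<close>

lemma Lam_minus:
  assumes "u \<in> strip"
  shows "Lam (- u) = u + Lam u"
proof -
  have real: "Lam (- of_real x) = of_real x + Lam (of_real x)" for x
  proof -
    obtain a b where ab: "Lam (of_real (- x)) = of_real a" "Lam (of_real x) = of_real b"
      using Lam_of_real by (meson Reals_cases)
    have a: "theta (exp (2 * - x)) = exp a" and b: "theta (exp (2 * x)) = exp b"
      using of_real_theta[of "-x"] of_real_theta[of x] unfolding ab
      by (metis exp_of_real of_real_eq_iff)+
    have "exp (2 * - x) = 1 / exp (2 * x)" by (simp add: exp_minus field_simps)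
    then have "exp a = sqrt (exp (2 * x)) * exp b"
      using theta_inversion[of "exp (2 * x)"] a b by simp
    also have "sqrt (exp (2 * x)) = exp x"
      by (rule real_sqrt_unique) (auto simp: exp_double)
    also have "exp x * exp b = exp (x + b)" by (simp add: exp_add)
    finally have "a = x + b" by simp
    then show ?thesis using ab by simp
  qed
  define f where "f u = Lam (- u) - (u + Lam u)" for u
  have "f u = 0"
  proof (rule analytic_continuation[where f = f and S = strip and U = \<real> and \<xi> = 0])
    have "(Lam \<circ> uminus) holomorphic_on strip"
      by (rule holomorphic_on_compose_gen[OF _ holomorphic_Lam]) (auto intro!: holomorphic_intros)
    then show "f holomorphic_on strip"
      unfolding f_def o_def by (intro holomorphic_intros holomorphic_Lam)
    show "(0::complex) islimpt \<real>"
    proof (subst islimpt_sequential, intro exI conjI allI)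
      show "complex_of_real (1 / real (Suc n)) \<in> \<real> - {0}" for n by (simp del: of_nat_Suc)
      have "(\<lambda>n. complex_of_real (1 / real (Suc n))) \<longlonglongrightarrow> of_real 0"
        by (intro tendsto_of_real LIMSEQ_Suc lim_1_over_n)
      then show "(\<lambda>n. complex_of_real (1 / real (Suc n))) \<longlonglongrightarrow> 0" by simp
    qed
  qed (use assms real in \<open>auto simp: f_def open_strip convex_connected convex_strip elim!: Reals_cases\<close>)
  then show ?thesis by (simp add: f_def)
qed

lemma Lam_decay:
  assumes "0 \<le> \<phi>" "\<phi> < pi / 4"
  shows "\<exists>C\<ge>0. \<forall>u. 0 \<le> Re u \<and> \<bar>Im u\<bar> \<le> \<phi> \<longrightarrow> norm (Lam u) \<le> C * exp (- k * Re u)"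
proof -
  define a where "a = pi * cos (2 * \<phi>)"
  have a: "a > 0" unfolding a_def using assms by (intro mult_pos_pos cos_gt_zero_pi) auto
  define r where "r = exp (- a)"
  have r: "r < 1" using a by (simp add: r_def)
  define C where "C = 3 * exp (k\<^sup>2 / (8 * a)) / (1 - r)\<^sup>2"
  have "norm (Lam u) \<le> C * exp (- k * Re u)" if u: "0 \<le> Re u" "\<bar>Im u\<bar> \<le> \<phi>" for u
  proof -
    have strip: "u \<in> strip" using u assms by (simp add: strip_def)
    have "cos (2 * \<phi>) \<le> cos \<bar>2 * Im u\<bar>"
      using u assms by (intro cos_monotone_0_pi_le) auto
    then have c: "a \<le> pi * cos (2 * Im u)" by (simp add: a_def)
    have n1: "norm (nome u) \<le> exp (- a * exp (2 * Re u))"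
      using mult_right_mono[OF c, of "exp (2 * Re u)"] by (simp add: norm_nome algebra_simps)
    have "exp (2 * Re u) \<ge> 1" using u by simp
    then have "norm (nome u) \<le> r"
      using order.trans[OF n1, of r] a by (simp add: r_def)
    have "norm (Lam u) \<le> 3 * norm (nome u) / (1 - norm (nome u))\<^sup>2"
      unfolding Lam_def by (rule norm_log_theta_le[OF norm_nome_less_1[OF strip]])
    also have "\<dots> \<le> 3 * exp (k\<^sup>2 / (8 * a) - k * Re u) / (1 - r)\<^sup>2"
    proof (rule frac_le)
      \<comment> \<open>The quadratic bound e^(2x) >= 2x^2 already beats every exponential rate
        \<open>k\<close>. Completing the square, 2a x^2 - kx + k^2/(8a) = 2a (x - k/(4a))^2 >= 0,
        gives the constant k^2/(8a) in \<open>C\<close>.\<close>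
      have "exp (2 * Re u) \<ge> 1 + 2 * Re u + (2 * Re u)\<^sup>2 / 2"
        using u by (intro exp_lower_Taylor_quadratic) auto
      then have "exp (2 * Re u) \<ge> 2 * (Re u)\<^sup>2" using u by (simp add: power2_eq_square)
      then have "a * exp (2 * Re u) \<ge> a * (2 * (Re u)\<^sup>2)" using a by simp
      moreover have "a * (2 * (Re u)\<^sup>2) - k * Re u + k\<^sup>2 / (8 * a) = 2 * a * (Re u - k / (4 * a))\<^sup>2"
        using a by (simp add: power2_eq_square field_simps)
      moreover have "\<dots> \<ge> 0" using a by simp
      ultimately have "- a * exp (2 * Re u) \<le> k\<^sup>2 / (8 * a) - k * Re u" by simp
      then have "exp (- a * exp (2 * Re u)) \<le> exp (k\<^sup>2 / (8 * a) - k * Re u)" by simp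
      then show "3 * norm (nome u) \<le> 3 * exp (k\<^sup>2 / (8 * a) - k * Re u)"
        using n1 by linarith
      show "(1 - r)\<^sup>2 \<le> (1 - norm (nome u))\<^sup>2"
        using \<open>norm (nome u) \<le> r\<close> r by (intro power_mono) auto
    qed (use r in auto)
    also have "\<dots> = C * exp (- k * Re u)"
      by (simp add: C_def exp_diff exp_minus field_simps)
    finally show ?thesis .
  qed
  moreover have "C \<ge> 0" by (simp add: C_def)
  ultimately show ?thesis by blast
qed

text \<open>\<open>(exp (w a) - 1) / w\<close>, continued analytically to \<open>w = 0\<close>.\<close>
definition eps :: "complex \<Rightarrow> complex \<Rightarrow> complex" where
  "eps w a = (if w = 0 then a else (exp (w * a) - 1) / w)"

lemma eps_0 [simp]: "eps w 0 = 0"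
  by (simp add: eps_def)

lemma mult_eps: "w * eps w a = exp (w * a) - 1"
  by (simp add: eps_def)

text \<open>With a = u and b = \<open>Lam u\<close> this transfers the functional equation
  \<open>Lam (- u) = u + Lam u\<close> to \<open>eps\<close>; the first summand on the right then
  accounts for the polar terms.\<close>

lemma eps_add: "eps w (a + b) = eps w a + exp (w * a) * eps w b"
  by (simp add: eps_def exp_add distrib_left field_simps)

lemma norm_exp_minus_1_le:
  fixes z :: complex
  shows "norm (exp z - 1) \<le> norm z * exp (norm z)"
proof -
  have "norm (exp z - 1) \<le> exp \<bar>Re z\<bar> * norm z"
    using Taylor_exp[of z 0] by simp
  also have "\<dots> \<le> exp (norm z) * norm z"
    by (intro mult_right_mono) (auto simp: abs_Re_le_cmod)
  finally show ?thesis by (simp add: mult.commute)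
qed

lemma norm_exp_minus_linear_le:
  fixes z :: complex
  shows "norm (exp z - 1 - z) \<le> (norm z)\<^sup>2 * exp (norm z)"
proof -
  have "norm (exp z - 1 - z) \<le> exp \<bar>Re z\<bar> * (norm z)\<^sup>2"
    using Taylor_exp[of z 1] by (simp add: algebra_simps numeral_2_eq_2)
  also have "\<dots> \<le> exp (norm z) * (norm z)\<^sup>2"
    by (intro mult_right_mono) (auto simp: abs_Re_le_cmod)
  finally show ?thesis by (simp add: mult.commute)
qed

text \<open>No factor 1/w remains, so the bound is uniform in \<open>w\<close> near 0.\<close>

lemma norm_eps_le: "norm (eps w a) \<le> norm a * exp (norm w * norm a)"
proof (cases "w = 0")
  case False
  have "norm (exp (w * a) - 1) \<le> norm w * norm a * exp (norm w * norm a)"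
    using norm_exp_minus_1_le[of "w * a"] by (simp add: norm_mult)
  then show ?thesis using False by (simp add: eps_def norm_divide divide_simps mult_ac)
qed (simp add: eps_def)

text \<open>Thus \<open>eps w\<close> is the primitive of exp(w a) vanishing at 0, a description
  that is uniform in \<open>w\<close> and is used for the integral formula and for the
  rotation.\<close>

lemma has_field_derivative_eps: "(eps w has_field_derivative exp (w * a)) (at a)"
proof (cases "w = 0")
  case True
  then have "eps w = (\<lambda>a. a)" by (auto simp: eps_def)
  then show ?thesis using True by simp
next
  case False
  then have "eps w = (\<lambda>a. (exp (w * a) - 1) / w)" by (auto simp: eps_def)
  then show ?thesis using False by (auto intro!: derivative_eq_intros)
qed

lemma holomorphic_eps: "eps w holomorphic_on S"
  by (rule holomorphic_on_subset[OF _ subset_UNIV])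
     (auto simp: holomorphic_on_open intro: has_field_derivative_eps)

section \<open>Half-line integrals and rotation of the path\<close>

lemma set_integral_bounded_by_exp:
  fixes f :: "real \<Rightarrow> complex"
  assumes cont: "continuous_on {0..} f" and bound: "\<And>x. 0 \<le> x \<Longrightarrow> norm (f x) \<le> C * exp (- x)"
  shows "set_integrable lborel {0..} f" "norm (LINT x:{0..}|lborel. f x) \<le> C"
proof -
  have hk: "((\<lambda>x::real. exp (- x)) has_integral 1) {0..}"
    using has_integral_exp_minus_to_infinity[of 1 0] by simp
  then have "(\<lambda>x::real. exp (- x)) absolutely_integrable_on {0..}"
    by (intro nonnegative_absolutely_integrable_1) (auto simp: has_integral_integrable)
  then have e: "set_integrable lborel {0..} (\<lambda>x::real. exp (- x))"
    unfolding set_integrable_def by (subst (asm) integrable_completion) auto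
  have ev: "(LINT x:{0..}|lborel. exp (- x)) = (1::real)"
    using set_borel_integral_eq_integral(2)[OF e] integral_unique[OF hk] by simp
  show int: "set_integrable lborel {0..} f"
  proof (rule set_integrable_bound[OF set_integrable_mult_right[OF e, of C]])
    show "set_borel_measurable lborel {0..} f"
      unfolding set_borel_measurable_def
      using borel_measurable_continuous_on_indicator[OF _ cont] by simp
    show "AE x in lborel. x \<in> {0..} \<longrightarrow> norm (f x) \<le> norm (C * exp (- x))"
    proof (intro always_eventually allI impI)
      fix x :: real assume "x \<in> {0..}"
      then have "norm (f x) \<le> C * exp (- x)" using bound by simp
      also have "\<dots> \<le> norm (C * exp (- x))" by simp
      finally show "norm (f x) \<le> norm (C * exp (- x))" .
    qed
  qed
  have "norm (LINT x:{0..}|lborel. f x) \<le> (LINT x:{0..}|lborel. norm (f x))"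
    unfolding set_lebesgue_integral_def by (rule order.trans[OF integral_norm_bound]) simp
  also have "\<dots> \<le> (LINT x:{0..}|lborel. C * exp (- x))"
    by (rule set_integral_mono[OF set_integrable_norm[OF int] set_integrable_mult_right[OF e]]) (use bound in auto)
  also have "\<dots> = C" by (simp add: ev)
  finally show "norm (LINT x:{0..}|lborel. f x) \<le> C" .
qed

lemma set_integral_FTC_atLeast:
  fixes f F :: "real \<Rightarrow> complex"
  assumes deriv: "\<And>x. 0 \<le> x \<Longrightarrow> (F has_vector_derivative f x) (at x)"
    and cont: "continuous_on {0..} f" and int: "set_integrable lborel {0..} f"
    and lim: "(F \<longlongrightarrow> L) at_top"
  shows "(LINT x:{0..}|lborel. f x) = L - F 0"
proof -
  have "((\<lambda>b. LINT x:{0..b}|lborel. f x) \<longlongrightarrow> (LINT x:{0..}|lborel. f x)) at_top"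
    by (rule tendsto_set_lebesgue_integral_at_top[OF _ int]) simp
  moreover have "\<forall>\<^sub>F b in at_top. F b - F 0 = (LINT x:{0..b}|lborel. f x)"
    using eventually_ge_at_top[of 0]
  proof eventually_elim
    case (elim b)
    show ?case
      unfolding set_lebesgue_integral_def
      by (rule integral_FTC_atLeastAtMost[symmetric, OF elim])
         (use deriv cont in \<open>auto intro: has_vector_derivative_at_within continuous_on_subset\<close>)
  qed
  then have "((\<lambda>b. LINT x:{0..b}|lborel. f x) \<longlongrightarrow> L - F 0) at_top"
    by (rule Lim_transform_eventually[rotated]) (intro tendsto_intros lim)
  ultimately show ?thesis
    by (rule tendsto_unique[rotated]) simp
qed

text \<open>A primitive replaces the contour argument: H(x + i \<phi>) - H(x) has derivative f(x + i
  \<phi>) - f(x) in x and vanishes at infinity, so the fundamental theorem yields the difference of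
  the two integrals as a boundary term at 0.\<close>

lemma rotate_half_line:
  assumes H: "\<And>u. u \<in> strip \<Longrightarrow> (H has_field_derivative f u) (at u)"
    and hol: "f holomorphic_on strip" and \<phi>: "\<bar>\<phi>\<bar> < pi / 4"
    and bound: "\<And>u. 0 \<le> Re u \<Longrightarrow> \<bar>Im u\<bar> \<le> \<bar>\<phi>\<bar> \<Longrightarrow> norm (f u) \<le> C * exp (- Re u)"
  shows "(LINT x:{0..}|lborel. f (of_real x)) =
    H (\<i> * \<phi>) - H 0 + (LINT x:{0..}|lborel. f (of_real x + \<i> * \<phi>))"
proof -
  have in_strip: "of_real x + \<i> * of_real \<phi> \<in> strip" for x
    using \<phi> by (simp add: strip_def)
  have cont: "continuous_on {0..} (\<lambda>x. f (of_real x + \<i> * \<phi>))" "continuous_on {0..} (\<lambda>x. f (of_real x))"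
    by (rule continuous_on_compose2[OF holomorphic_on_imp_continuous_on[OF hol]];
        auto intro!: continuous_intros simp: in_strip)+
  have int1: "set_integrable lborel {0..} (\<lambda>x. f (of_real x + \<i> * \<phi>))"
    by (rule set_integral_bounded_by_exp(1)[OF cont(1), of C]) (use bound[of "of_real _ + \<i> * of_real \<phi>"] in simp)
  have int2: "set_integrable lborel {0..} (\<lambda>x. f (of_real x))"
    by (rule set_integral_bounded_by_exp(1)[OF cont(2), of C]) (use bound[of "of_real _"] in simp)
  define F where "F x = H (of_real x + \<i> * \<phi>) - H (of_real x)" for x :: real
  have "(LINT x:{0..}|lborel. f (of_real x + \<i> * \<phi>) - f (of_real x)) = 0 - F 0"
  proof (rule set_integral_FTC_atLeast)
    show "(F has_vector_derivative f (of_real x + \<i> * \<phi>) - f (of_real x)) (at x)" for x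
    proof -
      have "((\<lambda>x. of_real x + \<i> * \<phi>) has_vector_derivative 1) (at x)" "((\<lambda>x. complex_of_real x) has_vector_derivative 1) (at x)"
        by (auto intro!: derivative_eq_intros)
      from field_vector_diff_chain_at[OF this(1) H[OF in_strip]] field_vector_diff_chain_at[OF this(2) H[OF of_real_in_strip]]
      show ?thesis
        unfolding F_def by (auto intro!: derivative_eq_intros simp: o_def)
    qed
    show "continuous_on {0..} (\<lambda>x. f (of_real x + \<i> * \<phi>) - f (of_real x))"
      by (intro continuous_intros cont)
    show "set_integrable lborel {0..} (\<lambda>x. f (of_real x + \<i> * \<phi>) - f (of_real x))"
      by (intro set_integral_diff int1 int2)
    \<comment> \<open>The increment of \<open>H\<close> along the vertical segment is at most its
      length |\<phi>| times the bound for \<open>f\<close> there.\<close>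
    show "(F \<longlongrightarrow> 0) at_top"
    proof (rule Lim_null_comparison)
      show "\<forall>\<^sub>F x in at_top. norm (F x) \<le> C * exp (- x) * \<bar>\<phi>\<bar>"
        using eventually_ge_at_top[of 0]
      proof eventually_elim
        case (elim x)
        have seg: "Re u = x \<and> \<bar>Im u\<bar> \<le> \<bar>\<phi>\<bar>" if u: "u \<in> closed_segment (of_real x) (of_real x + \<i> * of_real \<phi>)" for u
        proof -
          obtain t where t: "0 \<le> t" "t \<le> 1" "u = (1 - t) *\<^sub>R of_real x + t *\<^sub>R (of_real x + \<i> * of_real \<phi>)"
            using u by (auto simp: closed_segment_def)
          then have "Re u = x" "Im u = t * \<phi>" by (auto simp: algebra_simps)
          then show ?thesis using t mult_right_mono[of t 1 "\<bar>\<phi>\<bar>"] by (auto simp: abs_mult)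
        qed
        have "norm (H (of_real x + \<i> * of_real \<phi>) - H (of_real x)) \<le> C * exp (- x) * norm (of_real x + \<i> * of_real \<phi> - complex_of_real x)"
        proof (rule field_differentiable_bound[where f' = f])
          fix u assume u: "u \<in> closed_segment (complex_of_real x) (of_real x + \<i> * of_real \<phi>)"
          then have "u \<in> strip" using seg \<phi> by (force simp: strip_def)
          then show "(H has_field_derivative f u) (at u within closed_segment (complex_of_real x) (of_real x + \<i> * of_real \<phi>))"
            using H has_field_derivative_at_within by blast
          show "norm (f u) \<le> C * exp (- x)" using bound[of u] seg[OF u] elim by auto
        qed auto
        then show ?case by (simp add: F_def norm_mult)
      qed
      have "((\<lambda>x::real. exp (- x)) \<longlongrightarrow> 0) at_top" by real_asymp
      then have "((\<lambda>x. C * exp (- x) * \<bar>\<phi>\<bar>) \<longlongrightarrow> C * 0 * \<bar>\<phi>\<bar>) at_top"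
        by (intro tendsto_mult tendsto_const)
      then show "((\<lambda>x. C * exp (- x) * \<bar>\<phi>\<bar>) \<longlongrightarrow> 0) at_top" by simp
    qed
  qed
  then show ?thesis
    using set_integral_diff(2)[OF int1 int2] by (simp add: F_def algebra_simps)
qed

section \<open>Entire functions of two variables\<close>

lemma entire2_const: "entire2 (\<lambda>p. c)"
  unfolding entire2_def by (intro allI exI[of _ 0]) (simp add: case_prod_unfold)

lemma entire2_fst: "entire2 fst"
  unfolding entire2_def
proof
  fix p :: "complex \<times> complex"
  have "(fst has_derivative (\<lambda>(h, k). 1 * h + 0 * k)) (at p)"
    by (simp add: case_prod_unfold has_derivative_fst)
  then show "\<exists>a b. (fst has_derivative (\<lambda>(h, k). a * h + b * k)) (at p)" by blast
qed

lemma entire2_snd: "entire2 snd"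
  unfolding entire2_def
proof
  fix p :: "complex \<times> complex"
  have "(snd has_derivative (\<lambda>(h, k). 0 * h + 1 * k)) (at p)"
    by (simp add: case_prod_unfold has_derivative_snd)
  then show "\<exists>a b. (snd has_derivative (\<lambda>(h, k). a * h + b * k)) (at p)" by blast
qed

lemma entire2_add:
  assumes "entire2 F" "entire2 G"
  shows "entire2 (\<lambda>p. F p + G p)"
  unfolding entire2_def
proof
  fix p
  obtain a b c d where d: "(F has_derivative (\<lambda>(h, k). a * h + b * k)) (at p)"
    "(G has_derivative (\<lambda>(h, k). c * h + d * k)) (at p)"
    using assms unfolding entire2_def by meson
  have "((\<lambda>p. F p + G p) has_derivative (\<lambda>(h, k). (a + c) * h + (b + d) * k)) (at p)"
    using has_derivative_add[OF d] by (simp add: case_prod_unfold algebra_simps)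
  then show "\<exists>a b. ((\<lambda>p. F p + G p) has_derivative (\<lambda>(h, k). a * h + b * k)) (at p)" by blast
qed

lemma entire2_mult:
  assumes "entire2 F" "entire2 G"
  shows "entire2 (\<lambda>p. F p * G p)"
  unfolding entire2_def
proof
  fix p
  obtain a b c d where d: "(F has_derivative (\<lambda>(h, k). a * h + b * k)) (at p)"
    "(G has_derivative (\<lambda>(h, k). c * h + d * k)) (at p)"
    using assms unfolding entire2_def by meson
  have "((\<lambda>p. F p * G p) has_derivative (\<lambda>(h, k). (F p * c + a * G p) * h + (F p * d + b * G p) * k)) (at p)"
    using has_derivative_mult[OF d] by (simp add: case_prod_unfold algebra_simps)
  then show "\<exists>a b. ((\<lambda>p. F p * G p) has_derivative (\<lambda>(h, k). a * h + b * k)) (at p)" by blast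
qed

lemma entire2_holomorphic:
  assumes "entire2 F"
  shows "(\<lambda>s. F (w, s)) holomorphic_on UNIV" "(\<lambda>w. F (w, s)) holomorphic_on UNIV"
proof -
  have "\<exists>b. ((\<lambda>s. F (w, s)) has_field_derivative b) (at s)" for w s
  proof -
    obtain a b where d: "(F has_derivative (\<lambda>(h, k). a * h + b * k)) (at (w, s))"
      using assms unfolding entire2_def by blast
    have "((\<lambda>s. (w, s)) has_derivative (\<lambda>k. (0, k))) (at s)" by (auto intro!: derivative_eq_intros)
    from has_derivative_compose[OF this d] show ?thesis
      by (auto simp: has_field_derivative_def intro!: exI[of _ b])
  qed
  then show "(\<lambda>s. F (w, s)) holomorphic_on UNIV" by (simp add: holomorphic_on_open)
  have "\<exists>b. ((\<lambda>w. F (w, s)) has_field_derivative b) (at w)" for w s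
  proof -
    obtain a b where d: "(F has_derivative (\<lambda>(h, k). a * h + b * k)) (at (w, s))"
      using assms unfolding entire2_def by blast
    have "((\<lambda>w. (w, s)) has_derivative (\<lambda>h. (h, 0))) (at w)" by (auto intro!: derivative_eq_intros)
    from has_derivative_compose[OF this d] show ?thesis
      by (auto simp: has_field_derivative_def intro!: exI[of _ a])
  qed
  then show "(\<lambda>w. F (w, s)) holomorphic_on UNIV" by (simp add: holomorphic_on_open)
qed

text \<open>Two one-variable continuations: in s for fixed w with Re w < 0, where the strip Re w <
  Re s < 0 is nonempty, and then in w for fixed s from the half plane just gained.\<close>

lemma entire2_unique:
  assumes F: "entire2 F" and G: "entire2 G"
    and eq: "\<And>w s. Re w < Re s \<Longrightarrow> Re s < 0 \<Longrightarrow> F (w, s) = G (w, s)"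
  shows "F = G"
proof -
  have 1: "F (w, s) = G (w, s)" if "Re w < 0" for w s
  proof (rule analytic_continuation_open[where f = "\<lambda>s. F (w, s)" and g = "\<lambda>s. G (w, s)" and s' = UNIV])
    show "open {s. Re w < Re s \<and> Re s < 0}"
      by (intro open_Collect_conj open_Collect_less continuous_intros)
    have "of_real (Re w / 2) \<in> {s. Re w < Re s \<and> Re s < 0}" using that by simp
    then show "{s. Re w < Re s \<and> Re s < 0} \<noteq> {}" by blast
  qed (use eq entire2_holomorphic[OF F] entire2_holomorphic[OF G] in auto)
  have "F (w, s) = G (w, s)" for w s
  proof (rule analytic_continuation_open[where f = "\<lambda>w. F (w, s)" and g = "\<lambda>w. G (w, s)" and s' = UNIV])
    show "open {w. Re w < 0}" by (intro open_Collect_less continuous_intros)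
    have "-1 \<in> {w. Re w < 0}" by simp
    then show "{w. Re w < 0} \<noteq> {}" by blast
  qed (use 1 entire2_holomorphic[OF F] entire2_holomorphic[OF G] in auto)
  then show ?thesis by (auto simp: fun_eq_iff)
qed

text \<open>
  Differentiation under the integral sign is immediate for exponentials, from
  \<open>|exp z - 1 - z| \<le> |z|\<^sup>2 exp |z|\<close>.
\<close>
lemma entire2_exp_integral:
  fixes g :: "'a \<Rightarrow> complex" and \<alpha> \<beta> :: "'a \<Rightarrow> real"
  assumes [measurable]: "g \<in> borel_measurable M" "\<alpha> \<in> borel_measurable M" "\<beta> \<in> borel_measurable M"
    and int: "\<And>R. integrable M (\<lambda>x. norm (g x) * exp (R * (\<bar>\<alpha> x\<bar> + \<bar>\<beta> x\<bar>)))"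
  shows "entire2 (\<lambda>(w, s). LINT x|M. g x * exp (w * of_real (\<alpha> x) + s * of_real (\<beta> x)))"
  unfolding entire2_def
proof
  fix p :: "complex \<times> complex"
  obtain w s where p: "p = (w, s)" by fastforce
  define N where "N = norm w + norm s"
  define \<gamma> where "\<gamma> x = \<bar>\<alpha> x\<bar> + \<bar>\<beta> x\<bar>" for x
  have g0: "\<gamma> x \<ge> 0" "\<bar>\<alpha> x\<bar> \<le> \<gamma> x" "\<bar>\<beta> x\<bar> \<le> \<gamma> x" for x by (auto simp: \<gamma>_def)
  have g1: "\<gamma> x \<le> exp (\<gamma> x)" for x using exp_ge_add_one_self[of "\<gamma> x"] by linarith
  note int = int[folded \<gamma>_def]
  have lin: "norm (h * of_real (\<alpha> x) + k * of_real (\<beta> x)) \<le> (norm h + norm k) * \<gamma> x" for h k :: complex and x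
  proof -
    have "norm (h * of_real (\<alpha> x) + k * of_real (\<beta> x)) \<le> norm h * \<bar>\<alpha> x\<bar> + norm k * \<bar>\<beta> x\<bar>"
      by (rule order.trans[OF norm_triangle_ineq]) (simp add: norm_mult)
    also have "\<dots> \<le> norm h * \<gamma> x + norm k * \<gamma> x"
      by (intro add_mono mult_left_mono g0) auto
    finally show ?thesis by (simp add: algebra_simps)
  qed
  have e: "norm (exp (w * of_real (\<alpha> x) + s * of_real (\<beta> x))) \<le> exp (N * \<gamma> x)"
    if "norm w + norm s \<le> N" for w s :: complex and x N
  proof -
    have "norm (exp (w * of_real (\<alpha> x) + s * of_real (\<beta> x))) \<le> exp (norm (w * of_real (\<alpha> x) + s * of_real (\<beta> x)))" by (rule norm_exp)
    also have "\<dots> \<le> exp (N * \<gamma> x)"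
      using order.trans[OF lin mult_right_mono[OF that g0(1)]] by simp
    finally show ?thesis .
  qed
  have I: "integrable M (\<lambda>x. g x * exp (w * of_real (\<alpha> x) + s * of_real (\<beta> x)))" for w s :: complex
  proof (rule Bochner_Integration.integrable_bound[OF int[of "norm w + norm s"]])
    show "AE x in M. norm (g x * exp (w * of_real (\<alpha> x) + s * of_real (\<beta> x))) \<le> norm (norm (g x) * exp ((norm w + norm s) * \<gamma> x))"
    proof (intro always_eventually allI)
      fix x
      have "norm (g x * exp (w * of_real (\<alpha> x) + s * of_real (\<beta> x))) \<le> norm (g x) * exp ((norm w + norm s) * \<gamma> x)"
        unfolding norm_mult by (intro mult_left_mono e) auto
      also have "\<dots> \<le> norm (norm (g x) * exp ((norm w + norm s) * \<gamma> x))" by simp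
      finally show "norm (g x * exp (w * of_real (\<alpha> x) + s * of_real (\<beta> x))) \<le> norm (norm (g x) * exp ((norm w + norm s) * \<gamma> x))" .
    qed
  qed simp
  have I': "integrable M (\<lambda>x. g x * of_real (c x) * exp (w * of_real (\<alpha> x) + s * of_real (\<beta> x)))"
    if [measurable]: "c \<in> borel_measurable M" and c: "\<And>x. \<bar>c x\<bar> \<le> \<gamma> x" for c
  proof (rule Bochner_Integration.integrable_bound[OF int[of "N + 1"]])
    show "AE x in M. norm (g x * of_real (c x) * exp (w * of_real (\<alpha> x) + s * of_real (\<beta> x))) \<le> norm (norm (g x) * exp ((N + 1) * \<gamma> x))"
    proof (intro always_eventually allI)
      fix x
      have "\<bar>c x\<bar> * norm (exp (w * of_real (\<alpha> x) + s * of_real (\<beta> x))) \<le> exp (\<gamma> x) * exp (N * \<gamma> x)"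
        by (intro mult_mono e order.trans[OF c g1]) (auto simp: N_def)
      also have "\<dots> = exp ((N + 1) * \<gamma> x)" by (simp add: exp_add[symmetric] algebra_simps)
      finally show "norm (g x * of_real (c x) * exp (w * of_real (\<alpha> x) + s * of_real (\<beta> x))) \<le> norm (norm (g x) * exp ((N + 1) * \<gamma> x))"
        by (simp add: norm_mult mult.assoc mult_left_mono)
    qed
  qed simp
  define a where "a = (LINT x|M. g x * of_real (\<alpha> x) * exp (w * of_real (\<alpha> x) + s * of_real (\<beta> x)))"
  define b where "b = (LINT x|M. g x * of_real (\<beta> x) * exp (w * of_real (\<alpha> x) + s * of_real (\<beta> x)))"
  define F where "F = (\<lambda>(w::complex, s::complex). LINT x|M. g x * exp (w * of_real (\<alpha> x) + s * of_real (\<beta> x)))"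
  \<comment> \<open>The exponent N + 4 collects e^(N \<gamma>) from the exponential at (w,s), e^(2
    \<gamma>) from exp |q| with |q| <= 2 \<gamma>, and e^(2 \<gamma>) from \<gamma>^2 <=
    (e^\<gamma>)^2. The factor 4 \<open>D\<close>^2 in the remainder comes from |q| <= 2
    \<open>D\<close> \<gamma>.\<close>
  define K where "K = (LINT x|M. norm (g x) * exp ((N + 4) * \<gamma> x))"
  have main: "norm (F (w + h, s + k) - F (w, s) - (a * h + b * k)) \<le> 4 * (norm (h, k))\<^sup>2 * K"
    if hk: "norm (h, k) \<le> 1" for h k
  proof -
    define D where "D = norm (h, k)"
    have hD: "norm h + norm k \<le> 2 * D"
      using norm_fst_le[of h k] norm_snd_le[of k h] by (simp add: D_def)
    have D0: "D \<ge> 0" "D \<le> 1" using hk by (auto simp: D_def)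
    define r where "r x = g x * exp ((w + h) * of_real (\<alpha> x) + (s + k) * of_real (\<beta> x)) - g x * exp (w * of_real (\<alpha> x) + s * of_real (\<beta> x))
      - (g x * of_real (\<alpha> x) * exp (w * of_real (\<alpha> x) + s * of_real (\<beta> x)) * h + g x * of_real (\<beta> x) * exp (w * of_real (\<alpha> x) + s * of_real (\<beta> x)) * k)" for x
    have "F (w + h, s + k) - F (w, s) - (a * h + b * k) = (LINT x|M. r x)"
      unfolding F_def a_def b_def r_def
      using I I'[OF _ g0(2)] I'[OF _ g0(3)] by simp
    also have "norm \<dots> \<le> (LINT x|M. 4 * D\<^sup>2 * (norm (g x) * exp ((N + 4) * \<gamma> x)))"
    proof (rule order.trans[OF integral_norm_bound integral_mono])
      show "integrable M (\<lambda>x. norm (r x))"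
        unfolding r_def by (rule integrable_norm) (use I I'[OF _ g0(2)] I'[OF _ g0(3)] in simp)
      show "integrable M (\<lambda>x. 4 * D\<^sup>2 * (norm (g x) * exp ((N + 4) * \<gamma> x)))"
        using int by simp
      fix x
      define z where "z = w * of_real (\<alpha> x) + s * of_real (\<beta> x)"
      define q where "q = h * of_real (\<alpha> x) + k * of_real (\<beta> x)"
      have q: "norm q \<le> 2 * D * \<gamma> x"
        unfolding q_def by (rule order.trans[OF lin mult_right_mono[OF hD g0(1)]])
      then have q2: "norm q \<le> 2 * \<gamma> x"
        using mult_right_mono[OF D0(2) g0(1), of x] by linarith
      have "r x = g x * (exp (z + q) - exp z - q * exp z)"
        by (simp add: r_def z_def q_def algebra_simps)
      also have "\<dots> = g x * exp z * (exp q - 1 - q)" by (simp add: exp_add algebra_simps)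
      finally have nr: "norm (r x) = norm (g x) * (norm (exp z) * norm (exp q - 1 - q))"
        by (simp add: norm_mult)
      have "norm (exp z) * norm (exp q - 1 - q) \<le> exp (N * \<gamma> x) * ((2 * D * \<gamma> x)\<^sup>2 * exp (2 * \<gamma> x))"
      proof (rule mult_mono)
        show "norm (exp z) \<le> exp (N * \<gamma> x)" unfolding z_def by (rule e) (simp add: N_def)
        show "norm (exp q - 1 - q) \<le> (2 * D * \<gamma> x)\<^sup>2 * exp (2 * \<gamma> x)"
          by (rule order.trans[OF norm_exp_minus_linear_le]) (use q q2 in \<open>auto intro!: mult_mono power_mono\<close>)
      qed auto
      also have "\<dots> \<le> exp (N * \<gamma> x) * (4 * D\<^sup>2 * (exp (\<gamma> x))\<^sup>2 * exp (2 * \<gamma> x))"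
        using g1 g0 by (auto simp: power_mult_distrib intro!: mult_left_mono mult_right_mono power_mono)
      also have "\<dots> = 4 * D\<^sup>2 * exp ((N + 4) * \<gamma> x)"
      proof -
        have e4: "(N + 4) * \<gamma> x = N * \<gamma> x + (2 * \<gamma> x + 2 * \<gamma> x)" by (simp add: algebra_simps)
        show ?thesis unfolding e4 exp_add by (simp add: exp_double)
      qed
      finally have "norm (r x) \<le> norm (g x) * (4 * D\<^sup>2 * exp ((N + 4) * \<gamma> x))"
        unfolding nr by (rule mult_left_mono) simp
      then show "norm (r x) \<le> 4 * D\<^sup>2 * (norm (g x) * exp ((N + 4) * \<gamma> x))"
        by (simp add: mult_ac)
    qed
    also have "\<dots> = 4 * D\<^sup>2 * K" by (simp add: K_def)
    finally show ?thesis by (simp add: D_def)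
  qed
  have "(F has_derivative (\<lambda>(h, k). a * h + b * k)) (at (w, s))"
  proof (rule has_derivativeI_sandwich[where e = 1 and H = "\<lambda>y. 4 * K * norm (y - (w, s))"])
    have "bounded_linear (\<lambda>p. a * fst p + b * snd p :: complex)"
      by (intro bounded_linear_add bounded_linear_compose[OF bounded_linear_mult_right] bounded_linear_fst bounded_linear_snd)
    then show "bounded_linear (\<lambda>(h, k). a * h + b * k)" by (simp add: case_prod_unfold)
    fix y assume y: "y \<noteq> (w, s)" "dist y (w, s) < 1"
    obtain w' s' where y': "y = (w', s')" by fastforce
    have "norm (F y - F (w, s) - (a * (w' - w) + b * (s' - s))) \<le> 4 * (norm (w' - w, s' - s))\<^sup>2 * K"
      using main[of "w' - w" "s' - s"] y by (simp add: y' dist_norm)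
    then show "norm (F y - F (w, s) - (case y - (w, s) of (h, k) \<Rightarrow> a * h + b * k)) / norm (y - (w, s)) \<le> 4 * K * norm (y - (w, s))"
      using y by (simp add: y' divide_le_eq power2_eq_square mult_ac)
  next
    have "((\<lambda>y. 4 * K * norm (y - (w, s))) \<longlongrightarrow> 4 * K * norm ((w, s) - (w, s))) (at (w, s))"
      by (intro tendsto_intros)
    then show "((\<lambda>y. 4 * K * norm (y - (w, s))) \<longlongrightarrow> 0) (at (w, s))" by simp
  qed auto
  then show "\<exists>a b. ((\<lambda>(w, s). LINT x|M. g x * exp (w * of_real (\<alpha> x) + s * of_real (\<beta> x))) has_derivative (\<lambda>(h, k). a * h + b * k)) (at p)"
    unfolding p F_def by blast
qed

section \<open>The entire function xi\<close>

lemma continuous_on_Lam_line: "continuous_on A (\<lambda>x. Lam (of_real x))"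
  by (rule continuous_on_compose2[OF holomorphic_on_imp_continuous_on[OF holomorphic_Lam]])
     (auto intro!: continuous_intros)

text \<open>These are the polar terms, taken with c = w - s and c = s; Re c < 0 for both is the
  region of convergence of \<open>Z_Q\<close>.\<close>

lemma set_integral_exp_half_line:
  fixes c :: complex
  assumes c: "Re c < 0"
  shows "set_integrable lborel {0..} (\<lambda>x::real. exp (c * of_real x))"
    and "(LINT x:{0..}|lborel. exp (c * of_real x)) = - 1 / c"
proof -
  define a where "a = - Re c"
  have a: "a > 0" using c by (simp add: a_def)
  have hk: "((\<lambda>x::real. exp (- a * x)) has_integral exp (- a * 0) / a) {0..}"
    using has_integral_exp_minus_to_infinity[OF a, of 0] by simp
  then have "(\<lambda>x::real. exp (- a * x)) absolutely_integrable_on {0..}"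
    by (intro nonnegative_absolutely_integrable_1) (auto simp: has_integral_integrable)
  then have e: "set_integrable lborel {0..} (\<lambda>x::real. exp (- a * x))"
    unfolding set_integrable_def by (subst (asm) integrable_completion) auto
  show int: "set_integrable lborel {0..} (\<lambda>x::real. exp (c * of_real x))"
    by (rule set_integrable_bound[OF e])
       (auto simp: set_borel_measurable_def a_def)
  have "(LINT x:{0..}|lborel. exp (c * of_real x)) = 0 - exp (c * of_real 0) / c"
  proof (rule set_integral_FTC_atLeast[where F = "\<lambda>x. exp (c * of_real x) / c" and L = 0, OF _ _ int])
    fix x :: real
    have "((\<lambda>z. exp (c * z) / c) has_field_derivative exp (c * of_real x)) (at (of_real x))"
      using c by (auto intro!: derivative_eq_intros)
    moreover have "((\<lambda>x. complex_of_real x) has_vector_derivative 1) (at x)"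
      by (auto intro!: derivative_eq_intros)
    ultimately show "((\<lambda>x. exp (c * of_real x) / c) has_vector_derivative exp (c * of_real x)) (at x)"
      using field_vector_diff_chain_at[of complex_of_real 1 x] by (force simp: o_def)
  next
    show "((\<lambda>x. exp (c * of_real x) / c) \<longlongrightarrow> 0) at_top"
    proof (rule tendsto_norm_zero_cancel)
      have "((\<lambda>x. exp (- (a * x))) \<longlongrightarrow> 0) at_top" using a by real_asymp
      then have "((\<lambda>x. exp (- (a * x)) / norm c) \<longlongrightarrow> 0 / norm c) at_top"
        using c by (intro tendsto_divide tendsto_const) auto
      then show "((\<lambda>x. norm (exp (c * of_real x) / c)) \<longlongrightarrow> 0) at_top"
        by (simp add: norm_divide a_def)
    qed
  qed (intro continuous_intros)
  then show "(LINT x:{0..}|lborel. exp (c * of_real x)) = - 1 / c" by simp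
qed

lemma integral_eq_half_lines:
  fixes F :: "real \<Rightarrow> complex"
  assumes i1: "set_integrable lborel {0..} F" and i2: "set_integrable lborel {0..} (\<lambda>x. F (- x))"
  shows "integrable lborel F" "(LINT x|lborel. F x) = (LINT x:{0..}|lborel. F x + F (- x))"
proof -
  have j2: "integrable lborel (\<lambda>x. indicator {..0} x *\<^sub>R F x)"
    and e2: "(LINT x:{0..}|lborel. F (- x)) = (LINT x|lborel. indicator {..0} x *\<^sub>R F x)"
  proof -
    have eq: "(\<lambda>x. indicator {0..} (0 + - 1 * x) *\<^sub>R F (- (0 + - 1 * x))) = (\<lambda>x. indicator {..0} x *\<^sub>R F x)"
      by (auto simp: fun_eq_iff indicator_def)
    show "integrable lborel (\<lambda>x. indicator {..0} x *\<^sub>R F x)"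
      using lborel_integrable_real_affine[OF i2[unfolded set_integrable_def], of "-1" 0] unfolding eq by simp
    show "(LINT x:{0..}|lborel. F (- x)) = (LINT x|lborel. indicator {..0} x *\<^sub>R F x)"
      unfolding set_lebesgue_integral_def
      by (subst lborel_integral_real_affine[where c = "-1" and t = 0]) (simp_all only: eq, simp)
  qed
  define G where "G x = indicator {0..} x *\<^sub>R F x + indicator {..0} x *\<^sub>R F x" for x :: real
  have G: "integrable lborel G"
    unfolding G_def using i1 j2 by (auto simp: set_integrable_def)
  \<comment> \<open>The point 0 is counted twice in \<open>G\<close>. Changing that one value
    recovers \<open>F\<close>, which gives measurability of \<open>F\<close> itself; for the
    integrals the point is a null set.\<close>
  have upd: "F = (\<lambda>x. if x = 0 then F 0 else G x)"
    by (auto simp: G_def fun_eq_iff indicator_def)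
  have ae: "AE x in lborel. F x = G x"
    using AE_lborel_singleton[of 0] by eventually_elim (simp add: G_def indicator_def)
  have [measurable]: "G \<in> borel_measurable lborel" using G by auto
  have meas: "F \<in> borel_measurable lborel"
    by (subst upd) measurable
  show "integrable lborel F"
    using integrable_cong_AE[OF meas _ ae] G by auto
  have "(LINT x|lborel. F x) = (LINT x|lborel. G x)"
    by (rule integral_cong_AE[OF meas _ ae]) simp
  also have "\<dots> = (LINT x:{0..}|lborel. F x) + (LINT x:{0..}|lborel. F (- x))"
    unfolding G_def e2 using i1 j2 by (simp add: set_integrable_def set_lebesgue_integral_def)
  also have "\<dots> = (LINT x:{0..}|lborel. F x + F (- x))"
    using set_integral_add(2)[OF i1 i2] by simp
  finally show "(LINT x|lborel. F x) = (LINT x:{0..}|lborel. F x + F (- x))" .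
qed

text \<open>The substitution rule wants integrability on both sides. On the left it is derived from
  the real change of variables applied to the norm, together with measurability from
  continuity.\<close>

lemma set_integral_exp_substitution:
  fixes f :: "real \<Rightarrow> complex"
  assumes cont: "continuous_on {0<..} f"
    and int: "integrable lborel (\<lambda>x. exp x *\<^sub>R f (exp x))"
  shows "(LINT t:{0<..}|lborel. f t) = (LINT x|lborel. exp x *\<^sub>R f (exp x))"
proof -
  have abs: "g absolutely_integrable_on {0<..}"
    if "(\<lambda>x. exp x * g (exp x)) absolutely_integrable_on UNIV" for g :: "real \<Rightarrow> real"
  proof -
    have "g absolutely_integrable_on (exp ` UNIV)"
      by (subst absolutely_integrable_change_of_variables_1'[where h = exp])
         (use that in \<open>auto intro: DERIV_exp simp: inj_on_def\<close>)
    moreover have "x \<in> range exp" if "x > 0" for x :: real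
      using exp_ln[OF that] by (metis rangeI)
    then have "range exp = {0::real<..}" by auto
    ultimately show ?thesis by simp
  qed
  have "integrable lborel (\<lambda>x. exp x * norm (f (exp x)))"
    using integrable_norm[OF int] by simp
  then have "(\<lambda>x. exp x * norm (f (exp x))) absolutely_integrable_on UNIV"
    by (simp add: set_integrable_def integrable_completion)
  then have "(\<lambda>t. norm (f t)) absolutely_integrable_on {0<..}" by (rule abs)
  moreover have [measurable]: "(\<lambda>t. indicator {0<..} t *\<^sub>R f t) \<in> borel_measurable borel"
    using borel_measurable_continuous_on_indicator[OF _ cont] by simp
  ultimately have f: "set_integrable lborel {0<..} f"
  proof -
    assume a: "(\<lambda>t. norm (f t)) absolutely_integrable_on {0<..}"
    have eq: "(\<lambda>t. indicator {0<..} t *\<^sub>R norm (f t)) = (\<lambda>t. norm (indicator {0<..} t *\<^sub>R f t))"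
      by (auto simp: indicator_def)
    have "integrable (completion lborel) (\<lambda>t. norm (indicator {0<..} t *\<^sub>R f t))"
      using a unfolding set_integrable_def eq .
    then have "integrable lborel (\<lambda>t. norm (indicator {0<..} t *\<^sub>R f t))"
    proof (subst (asm) integrable_completion)
      show "(\<lambda>t. norm (indicator {0<..} t *\<^sub>R f t)) \<in> borel_measurable lborel" by measurable
    qed
    then show ?thesis unfolding set_integrable_def by (subst (asm) integrable_norm_iff) auto
  qed
  have E: "einterval 0 \<infinity> = {0<..}" "einterval (-\<infinity>) \<infinity> = UNIV"
    by (auto simp: einterval_def)
  have "(LBINT t=0..\<infinity>. f t) = (LBINT x=-\<infinity>..\<infinity>. exp x *\<^sub>R f (exp x))"
  proof (rule interval_integral_substitution_integrable)
    show "isCont f (exp x)" for x :: real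
      using cont by (simp add: continuous_on_eq_continuous_at)
    show "((ereal \<circ> exp \<circ> real_of_ereal) \<longlongrightarrow> 0) (at_right (- \<infinity>))"
      using exp_at_bot by (simp add: ereal_tendsto_simps zero_ereal_def)
    show "((ereal \<circ> exp \<circ> real_of_ereal) \<longlongrightarrow> \<infinity>) (at_left \<infinity>)"
      using exp_at_top by (simp add: ereal_tendsto_simps)
    show "set_integrable lborel (einterval (- \<infinity>) \<infinity>) (\<lambda>x. exp x *\<^sub>R f (exp x))"
      using int by (simp add: E set_integrable_def)
    show "set_integrable lborel (einterval 0 \<infinity>) f" using f by (simp add: E)
  qed (auto intro!: DERIV_exp)
  then show ?thesis
    by (simp add: interval_lebesgue_integral_def E set_lebesgue_integral_def)
qed

definition xi_int :: "complex \<Rightarrow> complex \<Rightarrow> complex" where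
  "xi_int w s = (LINT x:{0..}|lborel. eps w (Lam (of_real x)) * (exp ((w - s) * of_real x) + exp (s * of_real x)))"

definition xi :: "complex \<Rightarrow> complex \<Rightarrow> complex" where
  "xi w s = 1 / 2 + s * (s - w) / 2 * xi_int w s"

text \<open>\<open>Lam_decay\<close> enters twice: with rate 0 to bound the exponent in
  \<open>norm_eps_le\<close> uniformly for |w| <= R, and with rate \<open>k\<close> for the
  decay.\<close>

lemma eps_Lam_decay:
  assumes "0 \<le> \<phi>" "\<phi> < pi / 4" "0 \<le> R"
  shows "\<exists>C\<ge>0. \<forall>u w. 0 \<le> Re u \<and> \<bar>Im u\<bar> \<le> \<phi> \<and> norm w \<le> R \<longrightarrow> norm (eps w (Lam u)) \<le> C * exp (- k * Re u)"
proof -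
  obtain C0 where C0: "C0 \<ge> 0" "\<And>u. 0 \<le> Re u \<Longrightarrow> \<bar>Im u\<bar> \<le> \<phi> \<Longrightarrow> norm (Lam u) \<le> C0"
    using Lam_decay[OF assms(1,2), of 0] by auto
  obtain C where C: "C \<ge> 0" "\<And>u. 0 \<le> Re u \<Longrightarrow> \<bar>Im u\<bar> \<le> \<phi> \<Longrightarrow> norm (Lam u) \<le> C * exp (- k * Re u)"
    using Lam_decay[OF assms(1,2), of k] by auto
  have "norm (eps w (Lam u)) \<le> (C * exp (R * C0)) * exp (- k * Re u)"
    if u: "0 \<le> Re u" "\<bar>Im u\<bar> \<le> \<phi>" and w: "norm w \<le> R" for u w
  proof -
    have "norm (eps w (Lam u)) \<le> norm (Lam u) * exp (norm w * norm (Lam u))" by (rule norm_eps_le)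
    also have "\<dots> \<le> C * exp (- k * Re u) * exp (R * C0)"
      using C0 C u w assms(3) by (intro mult_mono) (auto intro!: mult_mono)
    finally show ?thesis by (simp add: mult_ac)
  qed
  moreover have "C * exp (R * C0) \<ge> 0" using C by simp
  ultimately show ?thesis by blast
qed

lemma set_integrable_eps_Lam_exp:
  "set_integrable lborel {0..} (\<lambda>x. eps w (Lam (of_real x)) * exp (c * of_real x))"
proof -
  obtain C where C0: "C \<ge> 0" "\<And>u w'. 0 \<le> Re u \<Longrightarrow> \<bar>Im u\<bar> \<le> 0 \<Longrightarrow> norm w' \<le> norm w \<Longrightarrow>
      norm (eps w' (Lam u)) \<le> C * exp (- (norm c + 1) * Re u)"
    using eps_Lam_decay[of 0 "norm w" "norm c + 1"] by auto
  have C: "C \<ge> 0" "\<And>x. 0 \<le> x \<Longrightarrow> norm (eps w (Lam (of_real x))) \<le> C * exp (- (norm c + 1) * x)"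
    using C0(1) C0(2)[of "of_real _" w] by auto
  show ?thesis
  proof (rule set_integral_bounded_by_exp(1))
    have "continuous_on {0..} (\<lambda>x::real. eps w (Lam (of_real x)))"
      by (rule continuous_on_compose2[OF holomorphic_on_imp_continuous_on[OF holomorphic_eps[of w UNIV]] continuous_on_Lam_line]) auto
    then show "continuous_on {0..} (\<lambda>x::real. eps w (Lam (of_real x)) * exp (c * of_real x))"
      by (intro continuous_intros)
    fix x :: real assume x: "0 \<le> x"
    have "norm (exp (c * of_real x)) \<le> exp (norm c * x)"
      using complex_Re_le_cmod[of c] x by (simp add: mult_right_mono)
    then have "norm (eps w (Lam (of_real x)) * exp (c * of_real x)) \<le> C * exp (- (norm c + 1) * x) * exp (norm c * x)"
      unfolding norm_mult using C x by (intro mult_mono) auto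
    also have "\<dots> = C * exp (- x)" by (simp add: mult.assoc exp_add[symmetric] algebra_simps)
    finally show "norm (eps w (Lam (of_real x)) * exp (c * of_real x)) \<le> C * exp (- x)" .
  qed
qed

section \<open>Comparison with the defining integral\<close>

lemma theta_pos: "t > 0 \<Longrightarrow> theta t > 0"
proof -
  assume t: "t > 0"
  obtain a where a: "Lam (of_real (ln t / 2)) = of_real a" using Lam_of_real by (meson Reals_cases)
  then have "theta t = exp a"
    using of_real_theta[of "ln t / 2"] t by (simp del: of_real_divide) (metis exp_of_real of_real_eq_iff)
  then show ?thesis by simp
qed

text \<open>On the real axis \<open>Lam\<close> is the real logarithm, so the \<open>powr\<close> in
  \<open>Z_Q\<close> turns into an exponential of \<open>Lam\<close>.\<close>

lemma Lam_of_real_eq: "Lam (of_real x) = of_real (ln (theta (exp (2 * x))))"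
proof -
  obtain a where a: "Lam (of_real x) = of_real a" using Lam_of_real by (meson Reals_cases)
  then have "theta (exp (2 * x)) = exp a"
    using of_real_theta[of x] by (metis exp_of_real of_real_eq_iff)
  then show ?thesis using a by simp
qed

lemma continuous_on_theta: "continuous_on {0<..} theta"
proof -
  have "continuous_on {0<..} (\<lambda>t. exp (Re (Lam (of_real (ln t / 2)))))"
    by (intro continuous_intros continuous_on_compose2[OF continuous_on_Lam_line[of UNIV]]) auto
  then show ?thesis
    by (rule continuous_on_eq) (simp add: Lam_of_real_eq theta_pos del: of_real_divide)
qed

text \<open>On each half line e^(w Lam) = 1 + w eps splits off a pure exponential. These two
  integrate to -1/(w-s) and -1/s, which the prefactor turns into 1/2; in the remaining part
  \<open>w\<close> cancels against the denominator 2w.\<close>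

lemma Z_Q_eq_xi:
  assumes "Re w < Re s" "Re s < 0"
  shows "s * (s - w) / (2 * w) * Z_Q w s = xi w s"
proof -
  define f where "f t = complex_of_real (theta (t\<^sup>2)) powr s * complex_of_real (theta (1 / t\<^sup>2)) powr (w - s) / complex_of_real t" for t
  define F where "F x = exp (w * Lam (of_real x) + (w - s) * of_real x)" for x :: real
  have tp: "theta (t\<^sup>2) \<ge> 0" "theta (t\<^sup>2) \<noteq> 0" "theta (1 / t\<^sup>2) \<ge> 0" "theta (1 / t\<^sup>2) \<noteq> 0" if "t > 0" for t
    using theta_pos[of "t\<^sup>2"] theta_pos[of "1 / t\<^sup>2"] that by auto
  have cont: "continuous_on {0<..} f"
    unfolding f_def
    by (intro continuous_intros continuous_on_compose2[OF continuous_on_theta])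
       (auto simp: tp intro!: continuous_intros)
  have fF: "exp x *\<^sub>R f (exp x) = F x" for x
  proof -
    have e: "(exp x)\<^sup>2 = exp (2 * x)" "1 / exp (2 * x) = exp (2 * - x)"
      by (simp_all add: exp_double exp_minus inverse_eq_divide)
    have p: "complex_of_real (theta (exp (2 * x))) powr c = exp (c * Lam (of_real x))" for x c
      using theta_pos[of "exp (2 * x)"] by (simp add: powr_def Lam_of_real_eq Ln_of_real)
    have "exp x *\<^sub>R f (exp x) = complex_of_real (theta (exp (2 * x))) powr s * complex_of_real (theta (exp (2 * - x))) powr (w - s)"
      unfolding f_def by (simp only: e) (simp add: scaleR_conv_of_real)
    also have "\<dots> = exp (s * Lam (of_real x) + (w - s) * (of_real x + Lam (of_real x)))"
      unfolding p using Lam_minus[of "of_real x"] by (simp add: exp_add)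
    finally show ?thesis by (simp add: F_def algebra_simps)
  qed
  have F1: "F x = w * (eps w (Lam (of_real x)) * exp ((w - s) * of_real x)) + exp ((w - s) * of_real x)" for x
    by (simp only: F_def exp_add mult.assoc[symmetric] mult_eps left_diff_distrib) simp
  \<comment> \<open>By the functional equation w (x + Lam x) - (w-s) x = w Lam x + s x, so only
    \<open>Lam\<close> at nonnegative points, where it decays, is left.\<close>
  have F2: "F (- x) = w * (eps w (Lam (of_real x)) * exp (s * of_real x)) + exp (s * of_real x)" for x
  proof -
    have "F (- x) = exp (w * Lam (of_real x) + s * of_real x)"
      using Lam_minus[of "of_real x"] by (simp add: F_def algebra_simps)
    then show ?thesis by (simp only: exp_add mult.assoc[symmetric] mult_eps left_diff_distrib) simp
  qed
  have r: "Re (w - s) < 0" using assms by simp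
  note i = set_integrable_eps_Lam_exp[of w "w - s"] set_integrable_eps_Lam_exp[of w s]
    set_integral_exp_half_line[OF r] set_integral_exp_half_line[OF assms(2)]
  have "set_integrable lborel {0..} (\<lambda>x. F x)"
    unfolding F1 by (intro set_integral_add set_integrable_mult_right i)
  moreover have "set_integrable lborel {0..} (\<lambda>x. F (- x))"
    unfolding F2 by (intro set_integral_add set_integrable_mult_right i)
  ultimately have i1: "set_integrable lborel {0..} F" "set_integrable lborel {0..} (\<lambda>x. F (- x))"
    by simp_all
  have e1: "(LINT x:{0..}|lborel. F x) = (LINT x:{0..}|lborel. w * (eps w (Lam (of_real x)) * exp ((w - s) * of_real x)) + exp ((w - s) * of_real x))"
    by (simp only: F1)
  have e2: "(LINT x:{0..}|lborel. F (- x)) = (LINT x:{0..}|lborel. w * (eps w (Lam (of_real x)) * exp (s * of_real x)) + exp (s * of_real x))"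
    by (simp only: F2)
  have "Z_Q w s = (LINT t:{0<..}|lborel. f t)" by (simp add: Z_Q_def f_def)
  also have "\<dots> = (LINT x|lborel. F x)"
    using set_integral_exp_substitution[OF cont] integral_eq_half_lines(1)[OF i1] by (simp add: fF)
  also have "\<dots> = (LINT x:{0..}|lborel. F x + F (- x))"
    by (rule integral_eq_half_lines(2)[OF i1])
  also have "\<dots> = (LINT x:{0..}|lborel. w * (eps w (Lam (of_real x)) * exp ((w - s) * of_real x)) + exp ((w - s) * of_real x)) +
      (LINT x:{0..}|lborel. w * (eps w (Lam (of_real x)) * exp (s * of_real x)) + exp (s * of_real x))"
    using set_integral_add(2)[OF i1] unfolding e1 e2 .
  also have "\<dots> = w * (LINT x:{0..}|lborel. eps w (Lam (of_real x)) * exp ((w - s) * of_real x)) - 1 / (w - s) +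
      (w * (LINT x:{0..}|lborel. eps w (Lam (of_real x)) * exp (s * of_real x)) - 1 / s)"
    using i by (subst (1 2) set_integral_add(2)) (auto intro: set_integrable_mult_right)
  also have "\<dots> = w * xi_int w s - 1 / (w - s) - 1 / s"
    unfolding xi_int_def distrib_left set_integral_add(2)[OF i(1,2)] by (simp add: algebra_simps)
  finally have Z: "Z_Q w s = w * xi_int w s - 1 / (w - s) - 1 / s" .
  have nz: "w \<noteq> 0" "s \<noteq> 0" "w - s \<noteq> 0" using assms by auto
  then show ?thesis
    unfolding Z xi_def by (simp add: divide_simps) (simp add: algebra_simps)
qed

section \<open>Joint holomorphy in both variables\<close>

lemma eps_eq_integral: "eps w a = (LINT \<tau>:{0..1}|lborel. a * exp (w * (a * of_real \<tau>)))"
proof -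
  have "(LINT \<tau>:{0..1}|lborel. a * exp (w * (a * of_real \<tau>))) = eps w (a * of_real 1) - eps w (a * of_real 0)"
    unfolding set_lebesgue_integral_def
  proof (rule integral_FTC_atLeastAtMost)
    fix x :: real
    have "((\<lambda>x. a * of_real x) has_vector_derivative a) (at x)"
      by (auto intro!: derivative_eq_intros)
    from field_vector_diff_chain_at[OF this has_field_derivative_eps[of w]]
    show "((\<lambda>\<tau>. eps w (a * of_real \<tau>)) has_vector_derivative a * exp (w * (a * of_real x))) (at x within {0..1})"
      by (auto simp: o_def intro: has_vector_derivative_at_within)
  qed (auto intro!: continuous_intros)
  then show ?thesis by simp
qed

text \<open>A real-valued form of \<open>Lam\<close>, since \<open>entire2_exp_integral\<close>
  takes real coefficient functions in the exponent.\<close>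

definition lam :: "real \<Rightarrow> real" where
  "lam x = Re (Lam (of_real x))"

lemma of_real_lam: "of_real (lam x) = Lam (of_real x)"
  unfolding lam_def by (rule of_real_Re[OF Lam_of_real])

lemma continuous_on_lam: "continuous_on A lam"
  unfolding lam_def[abs_def] by (intro continuous_intros continuous_on_Lam_line)

lemma borel_measurable_lam [measurable]: "lam \<in> borel_measurable borel"
  by (rule borel_measurable_continuous_onI[OF continuous_on_lam])

lemma integrable_exp_strip:
  "integrable lborel (\<lambda>p::real \<times> real. indicator ({0..} \<times> {0..1}) p * exp (- fst p))"
proof -
  have e: "set_integrable lborel {0..} (\<lambda>x::real. exp (- x))"
    using set_integrable_norm[OF set_integral_exp_half_line(1)[of "-1"]] by simp
  have "integrable (lborel \<Otimes>\<^sub>M lborel) (\<lambda>p::real \<times> real. indicator ({0..} \<times> {0..1}) p * exp (- fst p))"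
  proof (rule lborel_pair.Fubini_integrable)
    have "(\<lambda>x::real. LINT y::real|lborel. norm (indicator ({0..} \<times> {0..1}) (x, y) * exp (- fst (x, y)))) =
        (\<lambda>x::real. indicator {0..} x *\<^sub>R exp (- x))"
      by (auto simp: indicator_times fun_eq_iff abs_mult content_real)
    then show "integrable lborel (\<lambda>x::real. LINT y::real|lborel. norm (indicator ({0..} \<times> {0..1}) (x, y) * exp (- fst (x, y))))"
      using e by (simp add: set_integrable_def)
    show "AE x in (lborel :: real measure). integrable lborel (\<lambda>y::real. indicator ({0..} \<times> {0..1}) (x, y) * exp (- fst (x, y)))"
    proof (intro always_eventually allI)
      fix x :: real
      have "integrable lborel (\<lambda>y::real. (indicator {0..} x * exp (- x)) * indicator {0..1} y :: real)"
        by (intro integrable_mult_right integrable_real_indicator) auto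
      then show "integrable lborel (\<lambda>y::real. indicator ({0..} \<times> {0..1}) (x, y) * exp (- fst (x, y)))"
        by (simp add: indicator_times mult_ac)
    qed
  next
    have [measurable]: "{0..} \<times> {0..1::real} \<in> sets (borel :: (real \<times> real) measure)"
      by (intro borel_closed closed_Times) auto
    have [measurable]: "(fst :: real \<times> real \<Rightarrow> real) \<in> borel_measurable borel"
      by (intro borel_measurable_continuous_onI continuous_intros)
    have "(\<lambda>p::real \<times> real. indicator ({0..} \<times> {0..1}) p * exp (- fst p)) \<in> borel_measurable borel"
      by measurable
    then show "(\<lambda>p::real \<times> real. indicator ({0..} \<times> {0..1}) p * exp (- fst p)) \<in> borel_measurable (lborel \<Otimes>\<^sub>M lborel)"
      by (simp add: lborel_prod)
  qed
  then show ?thesis by (simp add: lborel_prod)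
qed

text \<open>
  Writing \<open>eps w a\<close> as an integral over \<open>\<tau> \<in> {0..1}\<close> turns \<open>xi_int\<close> into an integral of exponentials
  that are linear in \<open>(w, s)\<close>.
\<close>
lemma entire2_xi_int: "entire2 (\<lambda>(w, s). xi_int w s)"
proof -
  define g where "g p = complex_of_real (indicator ({0..} \<times> {0..1}) p * lam (fst p))" for p :: "real \<times> real"
  have strip_meas [measurable]: "{0..} \<times> {0..1::real} \<in> sets (borel :: (real \<times> real) measure)"
    by (intro borel_closed closed_Times) auto
  have [measurable]: "(fst :: real \<times> real \<Rightarrow> real) \<in> borel_measurable borel" "(snd :: real \<times> real \<Rightarrow> real) \<in> borel_measurable borel"
    by (intro borel_measurable_continuous_onI continuous_intros)+
  have gm: "g \<in> borel_measurable lborel"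
    unfolding g_def by measurable
  obtain C0 where C0: "C0 \<ge> 0" "\<And>x. 0 \<le> x \<Longrightarrow> \<bar>lam x\<bar> \<le> C0"
  proof -
    obtain C where C: "C \<ge> 0" "\<And>u. 0 \<le> Re u \<Longrightarrow> \<bar>Im u\<bar> \<le> 0 \<Longrightarrow> norm (Lam u) \<le> C"
      using Lam_decay[of 0 0] by auto
    then have "\<bar>lam x\<bar> \<le> C" if "0 \<le> x" for x
      using C(2)[of "of_real x"] that by (simp add: of_real_lam[symmetric])
    then show thesis using that C(1) by blast
  qed
  have int: "integrable lborel (\<lambda>p. norm (g p) * exp (R * (\<bar>\<alpha> p\<bar> + \<bar>\<beta> p\<bar>)))"
    if [measurable]: "\<alpha> \<in> borel_measurable borel" "\<beta> \<in> borel_measurable borel"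
      and ab: "\<And>x \<tau>. 0 \<le> x \<Longrightarrow> 0 \<le> \<tau> \<Longrightarrow> \<tau> \<le> 1 \<Longrightarrow> \<bar>\<alpha> (x, \<tau>)\<bar> + \<bar>\<beta> (x, \<tau>)\<bar> \<le> \<bar>lam x\<bar> + 2 * x"
    for R and \<alpha> \<beta> :: "real \<times> real \<Rightarrow> real"
  proof -
    \<comment> \<open>The factor exp(R (|\<alpha>| + |\<beta>|)) grows at most like e^(2|R|x), as
      \<open>lam\<close> is bounded by \<open>C0\<close>; decay at rate \<open>k\<close> leaves the
      majorant e^(-x).\<close>
    define k where "k = 2 * \<bar>R\<bar> + 1"
    obtain C where C: "C \<ge> 0" "\<And>u. 0 \<le> Re u \<Longrightarrow> \<bar>Im u\<bar> \<le> 0 \<Longrightarrow> norm (Lam u) \<le> C * exp (- k * Re u)"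
      using Lam_decay[of 0 k] by auto
    have Cl: "\<bar>lam x\<bar> \<le> C * exp (- k * x)" if "0 \<le> x" for x
      using C(2)[of "of_real x"] that by (simp add: of_real_lam[symmetric])
    show ?thesis
    proof (rule Bochner_Integration.integrable_bound[OF integrable_mult_right[OF integrable_exp_strip, of "C * exp (\<bar>R\<bar> * C0)"]])
      show "(\<lambda>p. norm (g p) * exp (R * (\<bar>\<alpha> p\<bar> + \<bar>\<beta> p\<bar>))) \<in> borel_measurable lborel"
        using gm by measurable
      show "AE p in lborel. norm (norm (g p) * exp (R * (\<bar>\<alpha> p\<bar> + \<bar>\<beta> p\<bar>)))
          \<le> norm (C * exp (\<bar>R\<bar> * C0) * (indicator ({0..} \<times> {0..1}) p * exp (- fst p)))"
      proof (intro always_eventually allI)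
        fix p :: "real \<times> real"
        obtain x \<tau> where p: "p = (x, \<tau>)" by fastforce
        show "norm (norm (g p) * exp (R * (\<bar>\<alpha> p\<bar> + \<bar>\<beta> p\<bar>)))
          \<le> norm (C * exp (\<bar>R\<bar> * C0) * (indicator ({0..} \<times> {0..1}) p * exp (- fst p)))"
        proof (cases "0 \<le> x \<and> 0 \<le> \<tau> \<and> \<tau> \<le> 1")
          case True
          define \<gamma> where "\<gamma> = \<bar>\<alpha> p\<bar> + \<bar>\<beta> p\<bar>"
          have \<gamma>: "0 \<le> \<gamma>" "\<gamma> \<le> C0 + 2 * x"
            using ab[of x \<tau>] C0(2)[of x] True by (auto simp: \<gamma>_def p)
          have "R * \<gamma> \<le> \<bar>R\<bar> * \<gamma>" using \<gamma> by (intro mult_right_mono) auto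
          also have "\<dots> \<le> \<bar>R\<bar> * (C0 + 2 * x)" using \<gamma> by (intro mult_left_mono) auto
          finally have R: "exp (R * \<gamma>) \<le> exp (\<bar>R\<bar> * C0 + 2 * \<bar>R\<bar> * x)" by (simp add: algebra_simps)
          have "norm (g p) * exp (R * \<gamma>) = \<bar>lam x\<bar> * exp (R * \<gamma>)" using True by (simp add: g_def p)
          also have "\<dots> \<le> (C * exp (- k * x)) * exp (\<bar>R\<bar> * C0 + 2 * \<bar>R\<bar> * x)"
            using True C by (intro mult_mono Cl R) auto
          also have "\<dots> = C * exp (\<bar>R\<bar> * C0) * exp (- x)"
            by (simp add: k_def exp_add[symmetric] mult.assoc algebra_simps)
          finally show ?thesis
            using True C(1) by (simp add: \<gamma>_def[symmetric] abs_mult) (simp add: p)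
        next
          case False
          then have "g p = 0" by (auto simp: g_def p)
          then show ?thesis by simp
        qed
      qed
    qed
  qed
  define h where "h \<alpha> \<beta> w s p = g p * exp (w * of_real (\<alpha> p) + s * of_real (\<beta> p))"
    for \<alpha> \<beta> :: "real \<times> real \<Rightarrow> real" and w s p
  \<comment> \<open>The two exponents are w (lam x \<tau> + x) - s x and w lam x \<tau> + s x,
    belonging to the summands exp((w-s)x) and exp(s x) of \<open>xi_int\<close>.\<close>
  define \<alpha>1 where "\<alpha>1 p = lam (fst p) * snd p + fst p" for p :: "real \<times> real"
  define \<beta>1 where "\<beta>1 p = - fst p" for p :: "real \<times> real"
  define \<alpha>2 where "\<alpha>2 p = lam (fst p) * snd p" for p :: "real \<times> real"
  define \<beta>2 where "\<beta>2 p = fst p" for p :: "real \<times> real"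
  have m [measurable]: "\<alpha>1 \<in> borel_measurable borel" "\<beta>1 \<in> borel_measurable borel"
    "\<alpha>2 \<in> borel_measurable borel" "\<beta>2 \<in> borel_measurable borel"
    unfolding \<alpha>1_def \<beta>1_def \<alpha>2_def \<beta>2_def by measurable
  have lt: "\<bar>lam x * \<tau>\<bar> \<le> \<bar>lam x\<bar>" if "0 \<le> \<tau>" "\<tau> \<le> 1" for x \<tau>
    using that by (simp add: abs_mult mult_left_le)
  have b1: "\<bar>\<alpha>1 (x, \<tau>)\<bar> + \<bar>\<beta>1 (x, \<tau>)\<bar> \<le> \<bar>lam x\<bar> + 2 * x" if "0 \<le> x" "0 \<le> \<tau>" "\<tau> \<le> 1" for x \<tau>
    using lt[OF that(2,3), of x] that by (simp add: \<alpha>1_def \<beta>1_def)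
  have b2: "\<bar>\<alpha>2 (x, \<tau>)\<bar> + \<bar>\<beta>2 (x, \<tau>)\<bar> \<le> \<bar>lam x\<bar> + 2 * x" if "0 \<le> x" "0 \<le> \<tau>" "\<tau> \<le> 1" for x \<tau>
    using lt[OF that(2,3), of x] that by (simp add: \<alpha>2_def \<beta>2_def)
  have hint: "integrable lborel (h \<alpha> \<beta> w s)"
    if m [measurable]: "\<alpha> \<in> borel_measurable borel" "\<beta> \<in> borel_measurable borel"
      and ab: "\<And>x \<tau>. 0 \<le> x \<Longrightarrow> 0 \<le> \<tau> \<Longrightarrow> \<tau> \<le> 1 \<Longrightarrow> \<bar>\<alpha> (x, \<tau>)\<bar> + \<bar>\<beta> (x, \<tau>)\<bar> \<le> \<bar>lam x\<bar> + 2 * x"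
    for \<alpha> \<beta> w s
  proof (rule Bochner_Integration.integrable_bound[OF int[OF m ab, of "norm w + norm s"]])
    show "h \<alpha> \<beta> w s \<in> borel_measurable lborel"
      unfolding h_def using gm by measurable
    show "AE p in lborel. norm (h \<alpha> \<beta> w s p) \<le> norm (norm (g p) * exp ((norm w + norm s) * (\<bar>\<alpha> p\<bar> + \<bar>\<beta> p\<bar>)))"
    proof (intro always_eventually allI)
      fix p
      have "norm (w * of_real (\<alpha> p) + s * of_real (\<beta> p)) \<le> norm w * \<bar>\<alpha> p\<bar> + norm s * \<bar>\<beta> p\<bar>"
        by (rule order.trans[OF norm_triangle_ineq]) (simp add: norm_mult)
      also have "\<dots> \<le> norm w * (\<bar>\<alpha> p\<bar> + \<bar>\<beta> p\<bar>) + norm s * (\<bar>\<alpha> p\<bar> + \<bar>\<beta> p\<bar>)"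
        by (intro add_mono mult_left_mono) auto
      finally have "norm (exp (w * of_real (\<alpha> p) + s * of_real (\<beta> p))) \<le> exp ((norm w + norm s) * (\<bar>\<alpha> p\<bar> + \<bar>\<beta> p\<bar>))"
        by (intro order.trans[OF norm_exp]) (simp add: algebra_simps)
      then have "norm (h \<alpha> \<beta> w s p) \<le> norm (g p) * exp ((norm w + norm s) * (\<bar>\<alpha> p\<bar> + \<bar>\<beta> p\<bar>))"
        unfolding h_def norm_mult by (rule mult_left_mono) simp
      also have "\<dots> \<le> norm (norm (g p) * exp ((norm w + norm s) * (\<bar>\<alpha> p\<bar> + \<bar>\<beta> p\<bar>)))" by simp
      finally show "norm (h \<alpha> \<beta> w s p) \<le> norm (norm (g p) * exp ((norm w + norm s) * (\<bar>\<alpha> p\<bar> + \<bar>\<beta> p\<bar>)))" .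
    qed
  qed
  \<comment> \<open>By Fubini the \<tau>-integral is done first and yields \<open>eps\<close> by
    \<open>eps_eq_integral\<close>; \<open>c\<close> is the coefficient of x that does not involve
    \<tau>.\<close>
  have slice: "(LINT p|lborel. h \<alpha> \<beta> w s p) = (LINT x:{0..}|lborel. eps w (Lam (of_real x)) * exp (c * of_real x))"
    if i: "integrable lborel (h \<alpha> \<beta> w s)"
      and e: "\<And>x \<tau>. w * of_real (\<alpha> (x, \<tau>)) + s * of_real (\<beta> (x, \<tau>)) = w * (Lam (of_real x) * of_real \<tau>) + c * of_real x"
    for \<alpha> \<beta> w s c
  proof -
    have fub: "(LINT p|lborel. h \<alpha> \<beta> w s p) = (LINT x|lborel. LINT \<tau>|lborel. h \<alpha> \<beta> w s (x, \<tau>))"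
      using i by (subst lborel_prod[symmetric], intro lborel_pair.integral_fst'[symmetric]) (simp add: lborel_prod)
    have inner: "(LINT \<tau>|lborel. h \<alpha> \<beta> w s (x, \<tau>)) = indicator {0..} x *\<^sub>R (eps w (Lam (of_real x)) * exp (c * of_real x))" for x
    proof -
      have hs: "h \<alpha> \<beta> w s (x, \<tau>) = (indicator {0..1} \<tau> *\<^sub>R (Lam (of_real x) * exp (w * (Lam (of_real x) * of_real \<tau>)))) *
          (indicator {0..} x *\<^sub>R exp (c * of_real x))" for \<tau>
        by (simp add: h_def g_def e indicator_times of_real_lam exp_add scaleR_conv_of_real)
      have "(LINT \<tau>|lborel. h \<alpha> \<beta> w s (x, \<tau>)) =
          (LINT \<tau>|lborel. indicator {0..1} \<tau> *\<^sub>R (Lam (of_real x) * exp (w * (Lam (of_real x) * of_real \<tau>)))) *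
          (indicator {0..} x *\<^sub>R exp (c * of_real x))"
        by (simp only: hs integral_mult_left_zero)
      also have "(LINT \<tau>|lborel. indicator {0..1} \<tau> *\<^sub>R (Lam (of_real x) * exp (w * (Lam (of_real x) * of_real \<tau>)))) = eps w (Lam (of_real x))"
        unfolding eps_eq_integral set_lebesgue_integral_def ..
      finally show ?thesis by simp
    qed
    show ?thesis unfolding set_lebesgue_integral_def fub inner ..
  qed
  have E: "xi_int w s = (LINT p|lborel. h \<alpha>1 \<beta>1 w s p) + (LINT p|lborel. h \<alpha>2 \<beta>2 w s p)" for w s
  proof -
    have "(LINT p|lborel. h \<alpha>1 \<beta>1 w s p) = (LINT x:{0..}|lborel. eps w (Lam (of_real x)) * exp ((w - s) * of_real x))"
      by (rule slice[OF hint[OF m(1,2) b1]]) (auto simp: \<alpha>1_def \<beta>1_def of_real_lam algebra_simps)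
    moreover have "(LINT p|lborel. h \<alpha>2 \<beta>2 w s p) = (LINT x:{0..}|lborel. eps w (Lam (of_real x)) * exp (s * of_real x))"
      by (rule slice[OF hint[OF m(3,4) b2]]) (auto simp: \<alpha>2_def \<beta>2_def of_real_lam algebra_simps)
    ultimately show ?thesis
      using set_integral_add(2)[OF set_integrable_eps_Lam_exp[of w "w - s"] set_integrable_eps_Lam_exp[of w s]]
      by (simp add: xi_int_def distrib_left)
  qed
  have "entire2 (\<lambda>(w, s). LINT p|lborel. h \<alpha>1 \<beta>1 w s p)"
    unfolding h_def by (rule entire2_exp_integral[OF gm _ _ int[OF m(1,2) b1]]) auto
  moreover have "entire2 (\<lambda>(w, s). LINT p|lborel. h \<alpha>2 \<beta>2 w s p)"
    unfolding h_def by (rule entire2_exp_integral[OF gm _ _ int[OF m(3,4) b2]]) auto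
  ultimately have "entire2 (\<lambda>q. (case q of (w, s) \<Rightarrow> LINT p|lborel. h \<alpha>1 \<beta>1 w s p) + (case q of (w, s) \<Rightarrow> LINT p|lborel. h \<alpha>2 \<beta>2 w s p))"
    by (rule entire2_add)
  then show ?thesis by (simp add: E case_prod_unfold)
qed

lemma entire2_xi: "entire2 (\<lambda>(w, s). xi w s)"
proof -
  have "entire2 (\<lambda>q. 1 / 2 + (snd q * (snd q + (- 1) * fst q) * (1 / 2)) * (case q of (w, s) \<Rightarrow> xi_int w s))"
    by (intro entire2_add entire2_mult entire2_const entire2_fst entire2_snd entire2_xi_int)
  then show ?thesis by (simp add: case_prod_unfold xi_def)
qed

text \<open>Existence of the function described by \<open>THE\<close> comes from the explicit
  formula, uniqueness from \<open>entire2_unique\<close>. From here on only the formula is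
  used.\<close>

theorem xi_Q_eq_xi: "xi_Q w s = xi w s"
proof -
  have "(THE F. entire2 F \<and> (\<forall>w s. Re w < Re s \<and> Re s < 0 \<longrightarrow> F (w, s) = s * (s - w) / (2 * w) * Z_Q w s)) = (\<lambda>(w, s). xi w s)"
  proof (rule the_equality)
    show "entire2 (\<lambda>(w, s). xi w s) \<and> (\<forall>w s. Re w < Re s \<and> Re s < 0 \<longrightarrow> (\<lambda>(w, s). xi w s) (w, s) = s * (s - w) / (2 * w) * Z_Q w s)"
      by (intro conjI entire2_xi allI impI) (simp only: prod.case, rule Z_Q_eq_xi[symmetric], auto)
    fix F assume F: "entire2 F \<and> (\<forall>w s. Re w < Re s \<and> Re s < 0 \<longrightarrow> F (w, s) = s * (s - w) / (2 * w) * Z_Q w s)"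
    show "F = (\<lambda>(w, s). xi w s)"
      by (rule entire2_unique[OF _ entire2_xi]) (use F Z_Q_eq_xi in auto)
  qed
  then show ?thesis by (simp add: xi_Q_def)
qed

text \<open>Only the absolutely convergent integrals are rotated, so the identity holds for all
  (w,s) directly. The explicit term is the rotated polar part: for nonzero w and s(s-w) nonzero,
  s(s-w)/(2w) times e^((w-s)u)/(s-w) - e^(-su)/s equals e^(-su) (1 + s eps w u)/2, and this form
  persists at w = 0.\<close>

lemma xi_rotate:
  assumes \<phi>: "\<bar>\<phi>\<bar> < pi / 4"
  shows "xi w s = exp (- (s * (\<i> * \<phi>))) * (1 + s * eps w (\<i> * \<phi>)) / 2 + s * (s - w) / 2 *
    ((LINT x:{0..}|lborel. eps w (Lam (of_real x + \<i> * \<phi>)) * exp ((w - s) * (of_real x + \<i> * \<phi>))) +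
     (LINT x:{0..}|lborel. eps w (Lam (of_real x + \<i> * (- \<phi>))) * exp (s * (of_real x + \<i> * (- \<phi>)))))"
proof -
  define f where "f c u = eps w (Lam u) * exp (c * u)" for c u
  have hol: "f c holomorphic_on strip" for c
  proof -
    have "(eps w \<circ> Lam) holomorphic_on strip"
      by (rule holomorphic_on_compose[OF holomorphic_Lam holomorphic_eps])
    then show ?thesis unfolding f_def o_def by (intro holomorphic_intros)
  qed
  have ex: "\<exists>H. \<forall>u\<in>strip. (H has_field_derivative f c u) (at u)" for c
    using holomorphic_convex_primitive'[OF convex_strip open_strip hol]
    by (metis at_within_open open_strip)
  obtain H1 where H1: "\<And>u. u \<in> strip \<Longrightarrow> (H1 has_field_derivative f (w - s) u) (at u)" using ex by blast
  obtain H2 where H2: "\<And>u. u \<in> strip \<Longrightarrow> (H2 has_field_derivative f s u) (at u)" using ex by blast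
  have bound: "\<exists>C. \<forall>u. 0 \<le> Re u \<and> \<bar>Im u\<bar> \<le> \<bar>\<phi>\<bar> \<longrightarrow> norm (f c u) \<le> C * exp (- Re u)" for c
  proof -
    obtain C where C: "C \<ge> 0" "\<And>u w'. 0 \<le> Re u \<Longrightarrow> \<bar>Im u\<bar> \<le> \<bar>\<phi>\<bar> \<Longrightarrow> norm w' \<le> norm w \<Longrightarrow>
        norm (eps w' (Lam u)) \<le> C * exp (- (norm c + 1) * Re u)"
      using eps_Lam_decay[of "\<bar>\<phi>\<bar>" "norm w" "norm c + 1"] \<phi> by auto
    have "norm (f c u) \<le> (C * exp (norm c * \<bar>\<phi>\<bar>)) * exp (- Re u)" if u: "0 \<le> Re u" "\<bar>Im u\<bar> \<le> \<bar>\<phi>\<bar>" for u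
    proof -
      have "norm (exp (c * u)) \<le> exp (norm c * norm u)" using norm_exp[of "c * u"] by (simp add: norm_mult)
      also have "norm u \<le> Re u + \<bar>\<phi>\<bar>" using cmod_le[of u] u by simp
      then have "exp (norm c * norm u) \<le> exp (norm c * (Re u + \<bar>\<phi>\<bar>))" by (simp add: mult_left_mono)
      finally have "norm (f c u) \<le> C * exp (- (norm c + 1) * Re u) * exp (norm c * (Re u + \<bar>\<phi>\<bar>))"
        unfolding f_def norm_mult using C u by (intro mult_mono) auto
      also have "\<dots> = (C * exp (norm c * \<bar>\<phi>\<bar>)) * exp (- Re u)"
        by (simp add: mult.assoc exp_add[symmetric] algebra_simps)
      finally show ?thesis .
    qed
    then show ?thesis by blast
  qed
  have rot1: "(LINT x:{0..}|lborel. f (w - s) (of_real x)) =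
      H1 (\<i> * \<phi>) - H1 0 + (LINT x:{0..}|lborel. f (w - s) (of_real x + \<i> * \<phi>))"
  proof -
    obtain C where "\<forall>u. 0 \<le> Re u \<and> \<bar>Im u\<bar> \<le> \<bar>\<phi>\<bar> \<longrightarrow> norm (f (w - s) u) \<le> C * exp (- Re u)" using bound by blast
    then show ?thesis by (intro rotate_half_line[OF H1 hol \<phi>]) auto
  qed
  have rot2: "(LINT x:{0..}|lborel. f s (of_real x)) =
      H2 (\<i> * (- \<phi>)) - H2 0 + (LINT x:{0..}|lborel. f s (of_real x + \<i> * (- \<phi>)))"
  proof -
    obtain C where "\<forall>u. 0 \<le> Re u \<and> \<bar>Im u\<bar> \<le> \<bar>\<phi>\<bar> \<longrightarrow> norm (f s u) \<le> C * exp (- Re u)" using bound by blast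
    then show ?thesis using rotate_half_line[OF H2 hol, of "- \<phi>" C] \<phi> by simp
  qed
  \<comment> \<open>The primitives and the polar terms combine to a function with zero derivative.\<close>
  define T where "T u = exp (- (s * u)) * (1 + s * eps w u) / 2 - s * (s - w) / 2 * (H1 u - H1 0 + (H2 (- u) - H2 0))" for u
  have "T (\<i> * \<phi>) = T 0"
  proof -
    have dT: "(T has_field_derivative 0) (at u within strip)" if u: "u \<in> strip" for u
    proof -
      have "((\<lambda>u. H2 (- u)) has_field_derivative (f s (- u) * (- 1))) (at u)"
        by (rule DERIV_chain2[OF H2]) (use u in \<open>auto intro!: derivative_eq_intros\<close>)
      then have "(T has_field_derivative
          (exp (- (s * u)) * (- s) * (1 + s * eps w u) + exp (- (s * u)) * (s * exp (w * u))) / 2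
            - s * (s - w) / 2 * (f (w - s) u + f s (- u) * (- 1))) (at u)"
        unfolding T_def using H1[OF u] has_field_derivative_eps[of w u]
        by (auto intro!: derivative_eq_intros simp: field_simps)
      \<comment> \<open>Expanding \<open>eps w (u + Lam u)\<close> by \<open>eps_add\<close>
        produces e^(wu) eps w (Lam u); it cancels the first integrand, and no \<open>Lam\<close> is
        left in the derivative of \<open>T\<close>.\<close>
      moreover have "f (w - s) u + f s (- u) * (- 1) = - exp (- (s * u)) * eps w u"
      proof -
        have "exp ((w - s) * u) = exp (w * u) * exp (- (s * u))"
          by (simp add: exp_add[symmetric] algebra_simps)
        then show ?thesis
          by (simp add: f_def Lam_minus[OF u] eps_add algebra_simps)
      qed
      moreover have "exp (- (s * u)) * (- s) * (1 + s * eps w u) + exp (- (s * u)) * (s * exp (w * u)) =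
          - s * (s - w) * (exp (- (s * u)) * eps w u)"
      proof -
        have "exp (w * u) = 1 + w * eps w u" by (simp add: mult_eps)
        then show ?thesis by (simp add: algebra_simps)
      qed
      ultimately show ?thesis
        by (auto intro: has_field_derivative_at_within)
    qed
    have "\<i> * \<phi> \<in> strip" using \<phi> by (simp add: strip_def)
    then show ?thesis
      using has_field_derivative_zero_constant[OF convex_strip dT] zero_in_strip by metis
  qed
  moreover have "T 0 = 1 / 2" by (simp add: T_def)
  ultimately have T: "1 / 2 = T (\<i> * \<phi>)" by simp
  have xi_int_eq: "xi_int w s = (LINT x:{0..}|lborel. f (w - s) (of_real x)) + (LINT x:{0..}|lborel. f s (of_real x))"
    unfolding xi_int_def f_def distrib_left
    by (rule set_integral_add(2)[OF set_integrable_eps_Lam_exp set_integrable_eps_Lam_exp])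
  define J1 where "J1 = (LINT x:{0..}|lborel. f (w - s) (of_real x + \<i> * \<phi>))"
  define J2 where "J2 = (LINT x:{0..}|lborel. f s (of_real x + \<i> * (- \<phi>)))"
  have "xi w s = T (\<i> * \<phi>) + s * (s - w) / 2 * ((H1 (\<i> * \<phi>) - H1 0 + J1) + (H2 (\<i> * (- \<phi>)) - H2 0 + J2))"
    by (simp only: xi_def xi_int_eq rot1 rot2 T J1_def J2_def)
  also have "\<dots> = exp (- (s * (\<i> * \<phi>))) * (1 + s * eps w (\<i> * \<phi>)) / 2 + s * (s - w) / 2 * (J1 + J2)"
    by (simp add: T_def field_simps)
  finally show ?thesis by (simp add: J1_def J2_def f_def)
qed

section \<open>Exponential decay and the Schwartz property\<close>

lemma norm_exp_cmult_rotated_le: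
  assumes "\<bar>Re c\<bar> \<le> B" "0 \<le> x"
  shows "norm (exp (c * (of_real x + \<i> * of_real \<phi>))) \<le> exp (B * x) * exp (- Im c * \<phi>)"
proof -
  have "Re c * x \<le> B * x" using assms by (intro mult_right_mono) auto
  then show ?thesis by (simp add: exp_add[symmetric] algebra_simps)
qed

text \<open>The opposite rotations give exp((w-s) i \<phi>) and exp(-s i \<phi>), both of size
  e^(\<phi> Im s) up to a factor depending on w. The quadratic factor comes from s(s-w).\<close>

lemma xi_bound_rotated:
  assumes R: "0 \<le> R" and \<phi>: "\<bar>\<phi>\<bar> < pi / 4"
  shows "\<exists>A\<ge>0. \<forall>w s. norm w \<le> R \<and> \<bar>Re s\<bar> \<le> R \<longrightarrow> norm (xi w s) \<le> A * (1 + \<bar>Im s\<bar>)\<^sup>2 * exp (Im s * \<phi>)"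
proof -
  \<comment> \<open>Re(w-s) and Re s are at most 2R in absolute value, so this rate leaves e^(-x) in
    both integrals.\<close>
  define k where "k = 2 * R + 1"
  obtain C where C: "C \<ge> 0" "\<And>u w. 0 \<le> Re u \<Longrightarrow> \<bar>Im u\<bar> \<le> \<bar>\<phi>\<bar> \<Longrightarrow> norm w \<le> R \<Longrightarrow>
      norm (eps w (Lam u)) \<le> C * exp (- k * Re u)"
    using eps_Lam_decay[of "\<bar>\<phi>\<bar>" R k] \<phi> R by auto
  \<comment> \<open>Absorbs the dependence on w: it bounds both e^(-\<phi> Im w) and the exponential
    in \<open>norm_eps_le\<close> at i \<phi>.\<close>
  define E where "E = exp (R * \<bar>\<phi>\<bar>)"
  have E1: "E \<ge> 1" using R by (simp add: E_def)
  define A where "A = (1 + (1 + R) * (\<bar>\<phi>\<bar> * E)) + (2 * R + 1)\<^sup>2 * (2 * C * E)"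
  have int: "norm (LINT x:{0..}|lborel. eps w (Lam (of_real x + \<i> * of_real \<psi>)) * exp (c * (of_real x + \<i> * of_real \<psi>))) \<le> C * exp (- Im c * \<psi>)"
    if w: "norm w \<le> R" and \<psi>: "\<bar>\<psi>\<bar> = \<bar>\<phi>\<bar>" and c: "\<bar>Re c\<bar> \<le> 2 * R" for w c \<psi>
  proof (rule set_integral_bounded_by_exp(2))
    have "continuous_on strip (\<lambda>u. eps w (Lam u) * exp (c * u))"
      by (intro continuous_intros holomorphic_on_imp_continuous_on
          holomorphic_on_compose[OF holomorphic_Lam holomorphic_eps, unfolded o_def])
    then show "continuous_on {0..} (\<lambda>x. eps w (Lam (of_real x + \<i> * of_real \<psi>)) * exp (c * (of_real x + \<i> * of_real \<psi>)))"
      by (rule continuous_on_compose2) (use \<phi> \<psi> in \<open>auto intro!: continuous_intros simp: strip_def\<close>)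
    fix x :: real assume x: "0 \<le> x"
    have "norm (eps w (Lam (of_real x + \<i> * of_real \<psi>)) * exp (c * (of_real x + \<i> * of_real \<psi>)))
        \<le> (C * exp (- k * x)) * (exp (2 * R * x) * exp (- Im c * \<psi>))"
      unfolding norm_mult
      using C(2)[of "of_real x + \<i> * of_real \<psi>" w] norm_exp_cmult_rotated_le[OF c x, of \<psi>] w x \<psi> C(1)
      by (intro mult_mono) auto
    also have "\<dots> = C * exp (- Im c * \<psi>) * exp (- x)"
      by (simp add: k_def exp_add[symmetric] mult.assoc algebra_simps)
    finally show "norm (eps w (Lam (of_real x + \<i> * of_real \<psi>)) * exp (c * (of_real x + \<i> * of_real \<psi>))) \<le> C * exp (- Im c * \<psi>) * exp (- x)" .
  qed
  have "norm (xi w s) \<le> A * (1 + \<bar>Im s\<bar>)\<^sup>2 * exp (Im s * \<phi>)" if w: "norm w \<le> R" and s: "\<bar>Re s\<bar> \<le> R" for w s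
  proof -
    define t where "t = \<bar>Im s\<bar>"
    define e where "e = exp (Im s * \<phi>)"
    have t: "t \<ge> 0" by (simp add: t_def)
    have Rw: "\<bar>Re w\<bar> \<le> R" "\<bar>Im w\<bar> \<le> R" using abs_Re_le_cmod[of w] abs_Im_le_cmod[of w] w by linarith+
    have ns: "norm s \<le> R + t" using cmod_le[of s] s by (simp add: t_def)
    have Rt: "R * t \<ge> 0" using R t by simp
    have ns1: "norm s \<le> (1 + R) * (1 + t)"
      using ns R t Rt unfolding distrib_left distrib_right by linarith
    have ns2: "norm s \<le> (2 * R + 1) * (1 + t)"
      using ns R t Rt unfolding distrib_left distrib_right by linarith
    have nsw: "norm (s - w) \<le> (2 * R + 1) * (1 + t)"
    proof -
      have "norm (s - w) \<le> norm s + norm w" by (rule norm_triangle_ineq4)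
      also have "\<dots> \<le> 2 * R + t" using ns w by simp
      also have "\<dots> \<le> (2 * R + 1) * (1 + t)" using R t by (simp add: algebra_simps)
      finally show ?thesis .
    qed
    define I1 where "I1 = (LINT x:{0..}|lborel. eps w (Lam (of_real x + \<i> * \<phi>)) * exp ((w - s) * (of_real x + \<i> * \<phi>)))"
    define I2 where "I2 = (LINT x:{0..}|lborel. eps w (Lam (of_real x + \<i> * (- \<phi>))) * exp (s * (of_real x + \<i> * (- \<phi>))))"
    have I1: "norm I1 \<le> C * E * e"
    proof -
      have "\<bar>Re (w - s)\<bar> \<le> 2 * R" using Rw s by simp
      then have "norm I1 \<le> C * exp (- Im (w - s) * \<phi>)"
        unfolding I1_def by (intro int[OF w]) auto
      also have "- Im (w - s) * \<phi> \<le> R * \<bar>\<phi>\<bar> + Im s * \<phi>"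
      proof -
        have "- (Im w * \<phi>) \<le> \<bar>Im w\<bar> * \<bar>\<phi>\<bar>" by (metis abs_ge_minus_self abs_mult)
        also have "\<dots> \<le> R * \<bar>\<phi>\<bar>" using Rw by (intro mult_right_mono) auto
        finally show ?thesis by (simp add: algebra_simps)
      qed
      then have "C * exp (- Im (w - s) * \<phi>) \<le> C * exp (R * \<bar>\<phi>\<bar> + Im s * \<phi>)"
        using C(1) by (simp add: mult_left_mono)
      finally show ?thesis by (simp add: E_def e_def exp_add mult.assoc)
    qed
    have I2: "norm I2 \<le> C * E * e"
    proof -
      have "norm I2 \<le> C * exp (- Im s * (- \<phi>))"
        using int[OF w, of "- \<phi>" s] s R by (simp add: I2_def)
      also have "\<dots> \<le> C * (E * e)"
        using E1 C(1) by (intro mult_left_mono) (auto simp: e_def mult_le_cancel_right1)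
      finally show ?thesis by (simp add: mult.assoc)
    qed
    have first: "norm (exp (- (s * (\<i> * \<phi>))) * (1 + s * eps w (\<i> * \<phi>)) / 2) \<le> (1 + (1 + R) * (\<bar>\<phi>\<bar> * E)) * (1 + t)\<^sup>2 * e"
    proof -
      have "norm (eps w (\<i> * \<phi>)) \<le> \<bar>\<phi>\<bar> * exp (norm w * \<bar>\<phi>\<bar>)"
        using norm_eps_le[of w "\<i> * \<phi>"] by (simp add: norm_mult)
      also have "\<dots> \<le> \<bar>\<phi>\<bar> * E"
        unfolding E_def using w by (intro mult_left_mono) (auto intro!: mult_right_mono)
      finally have ne: "norm (eps w (\<i> * \<phi>)) \<le> \<bar>\<phi>\<bar> * E" .
      have "norm (1 + s * eps w (\<i> * \<phi>)) \<le> 1 + norm s * norm (eps w (\<i> * \<phi>))"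
        by (rule order.trans[OF norm_triangle_ineq]) (simp add: norm_mult)
      also have "\<dots> \<le> 1 + (1 + R) * (1 + t) * (\<bar>\<phi>\<bar> * E)"
        using ns1 ne R t by (intro add_left_mono mult_mono) auto
      also have "\<dots> \<le> (1 + (1 + R) * (\<bar>\<phi>\<bar> * E)) * (1 + t)"
        using t by (simp add: algebra_simps)
      also have "\<dots> \<le> (1 + (1 + R) * (\<bar>\<phi>\<bar> * E)) * (1 + t)\<^sup>2"
        using t R E1 by (intro mult_left_mono) (auto simp: power2_eq_square intro!: add_nonneg_nonneg mult_nonneg_nonneg)
      finally have n: "norm (1 + s * eps w (\<i> * \<phi>)) \<le> (1 + (1 + R) * (\<bar>\<phi>\<bar> * E)) * (1 + t)\<^sup>2" .
      have "norm (exp (- (s * (\<i> * \<phi>))) * (1 + s * eps w (\<i> * \<phi>)) / 2) = e * norm (1 + s * eps w (\<i> * \<phi>)) / 2"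
        by (simp add: norm_mult norm_divide e_def)
      also have "\<dots> \<le> e * norm (1 + s * eps w (\<i> * \<phi>))" by (simp add: e_def)
      also have "\<dots> \<le> e * ((1 + (1 + R) * (\<bar>\<phi>\<bar> * E)) * (1 + t)\<^sup>2)"
        using n by (intro mult_left_mono) (auto simp: e_def)
      finally show ?thesis by (simp add: mult.commute)
    qed
    have second: "norm (s * (s - w) / 2 * (I1 + I2)) \<le> (2 * R + 1)\<^sup>2 * (2 * C * E) * (1 + t)\<^sup>2 * e"
    proof -
      have "norm (s * (s - w) / 2 * (I1 + I2)) \<le> norm s * norm (s - w) * norm (I1 + I2)"
        by (simp add: norm_mult norm_divide)
      also have "\<dots> \<le> ((2 * R + 1) * (1 + t)) * ((2 * R + 1) * (1 + t)) * (2 * (C * E * e))"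
        using ns2 nsw R t order.trans[OF norm_triangle_ineq add_mono[OF I1 I2]] by (intro mult_mono) auto
      finally show ?thesis by (simp add: power2_eq_square mult_ac)
    qed
    have "xi w s = exp (- (s * (\<i> * \<phi>))) * (1 + s * eps w (\<i> * \<phi>)) / 2 + s * (s - w) / 2 * (I1 + I2)"
      unfolding I1_def I2_def by (rule xi_rotate[OF \<phi>])
    also have "norm \<dots> \<le> (1 + (1 + R) * (\<bar>\<phi>\<bar> * E)) * (1 + t)\<^sup>2 * e + (2 * R + 1)\<^sup>2 * (2 * C * E) * (1 + t)\<^sup>2 * e"
      by (rule order.trans[OF norm_triangle_ineq add_mono[OF first second]])
    also have "\<dots> = A * (1 + t)\<^sup>2 * e" by (simp add: A_def algebra_simps)
    finally show ?thesis by (simp add: t_def e_def)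
  qed
  moreover have "A \<ge> 0" using R C(1) E1 by (auto simp: A_def intro!: add_nonneg_nonneg mult_nonneg_nonneg)
  ultimately show ?thesis by blast
qed

text \<open>(d x)^n / n! is a single term of the nonnegative series for exp(d x).\<close>

lemma power_exp_bound:
  fixes d :: real
  assumes "d > 0"
  shows "\<exists>K\<ge>0. \<forall>x\<ge>0. x ^ n * exp (- d * x) \<le> K"
proof -
  have "x ^ n * exp (- d * x) \<le> fact n / d ^ n" if "x \<ge> 0" for x
  proof -
    have "(d * x) ^ n / fact n \<le> exp (d * x)"
    proof -
      have s: "(\<lambda>k. (d * x) ^ k / fact k) sums exp (d * x)"
        using exp_converges[of "d * x"] by (simp add: divide_inverse mult.commute)
      have "(\<Sum>k\<in>{n}. (d * x) ^ k / fact k) \<le> (\<Sum>k. (d * x) ^ k / fact k)"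
        using s that assms by (intro sum_le_suminf) (auto simp: sums_iff)
      then show ?thesis using s by (simp add: sums_iff)
    qed
    then show ?thesis
      using assms by (simp add: exp_minus field_simps power_mult_distrib)
  qed
  moreover have "fact n / d ^ n \<ge> 0" using assms by simp
  ultimately show ?thesis by blast
qed

text \<open>For Im s >= 0 the rotation by -\<phi> decays, for Im s < 0 the rotation by \<phi>. The
  gap \<phi> - y > 0 absorbs the quadratic factor.\<close>

lemma xi_exp_decay:
  assumes R: "0 \<le> R" and y: "y < pi / 4"
  shows "\<exists>A\<ge>0. \<forall>w s. norm w \<le> R \<and> \<bar>Re s\<bar> \<le> R \<longrightarrow> norm (xi w s) \<le> A * exp (- y * \<bar>Im s\<bar>)"
proof -
  \<comment> \<open>The midpoint between max(y,0) and pi/4; the maximum keeps |\<phi>| < pi/4 for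
    very negative y.\<close>
  define \<phi> where "\<phi> = (max y 0 + pi / 4) / 2"
  have \<phi>: "\<bar>\<phi>\<bar> < pi / 4" "y < \<phi>"
    using y pi_gt_zero by (auto simp: \<phi>_def max_def simp del: pi_gt_zero)
  obtain A where A: "A \<ge> 0" "\<And>w s. norm w \<le> R \<Longrightarrow> \<bar>Re s\<bar> \<le> R \<Longrightarrow> norm (xi w s) \<le> A * (1 + \<bar>Im s\<bar>)\<^sup>2 * exp (Im s * \<phi>)"
    using xi_bound_rotated[OF R \<phi>(1)] by blast
  obtain B where B: "B \<ge> 0" "\<And>w s. norm w \<le> R \<Longrightarrow> \<bar>Re s\<bar> \<le> R \<Longrightarrow> norm (xi w s) \<le> B * (1 + \<bar>Im s\<bar>)\<^sup>2 * exp (Im s * - \<phi>)"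
    using xi_bound_rotated[OF R, of "- \<phi>"] \<phi>(1) by auto
  obtain K where K: "K \<ge> 0" "\<And>x. x \<ge> 0 \<Longrightarrow> x ^ 2 * exp (- (\<phi> - y) * x) \<le> K"
    using power_exp_bound[of "\<phi> - y" 2] \<phi> by auto
  have "norm (xi w s) \<le> (A + B) * (K * exp (\<phi> - y)) * exp (- y * \<bar>Im s\<bar>)" if w: "norm w \<le> R" and s: "\<bar>Re s\<bar> \<le> R" for w s
  proof -
    define t where "t = \<bar>Im s\<bar>"
    have t: "t \<ge> 0" by (simp add: t_def)
    have "norm (xi w s) \<le> (A + B) * (1 + t)\<^sup>2 * exp (- \<phi> * t)"
    proof (cases "Im s \<ge> 0")
      case True
      then have "norm (xi w s) \<le> B * (1 + t)\<^sup>2 * exp (- \<phi> * t)"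
        using B(2)[OF w s] by (simp add: t_def mult.commute)
      also have "\<dots> \<le> (A + B) * (1 + t)\<^sup>2 * exp (- \<phi> * t)"
        using A(1) by (intro mult_right_mono) auto
      finally show ?thesis .
    next
      case False
      then have "norm (xi w s) \<le> A * (1 + t)\<^sup>2 * exp (- \<phi> * t)"
        using A(2)[OF w s] by (simp add: t_def mult.commute)
      also have "\<dots> \<le> (A + B) * (1 + t)\<^sup>2 * exp (- \<phi> * t)"
        using B(1) by (intro mult_right_mono) auto
      finally show ?thesis .
    qed
    also have "\<dots> = (A + B) * ((1 + t)\<^sup>2 * exp (- (\<phi> - y) * (1 + t)) * exp (\<phi> - y)) * exp (- y * t)"
    proof -
      have "- \<phi> * t = - (\<phi> - y) * (1 + t) + (\<phi> - y) + - y * t" by (simp add: algebra_simps)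
      then have "exp (- \<phi> * t) = exp (- (\<phi> - y) * (1 + t)) * exp (\<phi> - y) * exp (- y * t)"
        by (simp only: exp_add)
      then show ?thesis by simp
    qed
    also have "\<dots> \<le> (A + B) * (K * exp (\<phi> - y)) * exp (- y * t)"
      using A(1) B(1) K(2)[of "1 + t"] t by (intro mult_right_mono mult_left_mono) auto
    finally show ?thesis by (simp add: t_def)
  qed
  moreover have "(A + B) * (K * exp (\<phi> - y)) \<ge> 0" using A B K by simp
  ultimately show ?thesis by blast
qed

section \<open>Schwartz bounds for the twisted function\<close>

text \<open>Iterated real derivatives along the axis are restrictions of complex ones, which makes
  them accessible to Cauchy's estimates.\<close>

lemma iter_deriv_of_real:
  assumes "g holomorphic_on UNIV"
  shows "iter_deriv m (\<lambda>t. g (of_real t)) = (\<lambda>t. (deriv ^^ m) g (of_real t))"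
proof (induction m)
  case 0
  then show ?case by (simp add: iter_deriv_def)
next
  case (Suc m)
  have "vector_derivative (\<lambda>t. (deriv ^^ m) g (of_real t)) (at t) = (deriv ^^ Suc m) g (of_real t)" for t :: real
  proof (rule vector_derivative_at)
    have "((deriv ^^ m) g has_field_derivative (deriv ^^ Suc m) g (of_real t)) (at (of_real t))"
      using holomorphic_derivI[OF holomorphic_higher_deriv[OF assms open_UNIV] open_UNIV, of "of_real t" m] by simp
    from has_vector_derivative_real_field[OF this]
    show "((\<lambda>t. (deriv ^^ m) g (of_real t)) has_vector_derivative (deriv ^^ Suc m) g (of_real t)) (at t)" .
  qed
  then show ?case using Suc by (simp add: iter_deriv_def)
qed

lemma smooth_of_real:
  assumes "g holomorphic_on UNIV"
  shows "smooth (\<lambda>t. g (of_real t))"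
  unfolding smooth_def iter_deriv_of_real[OF assms]
proof (intro allI)
  fix m and t :: real
  have "((deriv ^^ m) g has_field_derivative (deriv ^^ Suc m) g (of_real t)) (at (of_real t))"
    using holomorphic_derivI[OF holomorphic_higher_deriv[OF assms open_UNIV] open_UNIV, of "of_real t" m] by simp
  from has_vector_derivative_real_field[OF this]
  show "(\<lambda>t. (deriv ^^ m) g (of_real t)) differentiable at t"
    by (rule differentiableI_vector)
qed

definition twisted_ext :: "complex \<Rightarrow> real \<Rightarrow> real \<Rightarrow> complex \<Rightarrow> complex" where
  "twisted_ext w \<sigma> y z = exp (of_real y * z) * xi w (of_real \<sigma> + \<i> * z)"

lemma twisted_xi_eq: "twisted_xi w \<sigma> y = (\<lambda>t. twisted_ext w \<sigma> y (of_real t))"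
proof
  fix t
  have "Complex \<sigma> t = of_real \<sigma> + \<i> * of_real t" by (simp add: complex_eq_iff)
  then show "twisted_xi w \<sigma> y t = twisted_ext w \<sigma> y (of_real t)"
    by (simp add: twisted_xi_def twisted_ext_def xi_Q_eq_xi flip: exp_of_real of_real_mult)
qed

lemma holomorphic_twisted_ext: "twisted_ext w \<sigma> y holomorphic_on A"
proof -
  have "(\<lambda>s. xi w s) holomorphic_on UNIV"
    using entire2_holomorphic(1)[OF entire2_xi, of w] by simp
  then have "((\<lambda>s. xi w s) \<circ> (\<lambda>z. of_real \<sigma> + \<i> * z)) holomorphic_on A"
    by (intro holomorphic_on_compose_gen[where t = UNIV]) (auto intro!: holomorphic_intros)
  then show ?thesis
    unfolding twisted_ext_def[abs_def] o_def by (intro holomorphic_intros)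
qed

text \<open>Cauchy's estimate on the unit circle around t bounds the m-th derivative by the entire
  extension. There Re(\<sigma> + i z) = \<sigma> - Im z moves by at most 1, hence
  \<open>R + 1\<close>. The rate \<open>y1\<close> halfway between \<open>y0\<close> and pi/4 leaves
  a surplus \<open>d\<close> = \<open>y1 - y0\<close> after the twist, enough for any power of
  t.\<close>

lemma twisted_xi_schwartz_bound:
  assumes R: "0 \<le> R" and y0: "0 \<le> y0" "y0 < pi / 4"
  shows "\<exists>C. \<forall>w \<sigma> y t. norm w \<le> R \<and> \<bar>\<sigma>\<bar> \<le> R \<and> \<bar>y\<bar> \<le> y0 \<longrightarrow>
    norm (of_real (t ^ n) * iter_deriv m (twisted_xi w \<sigma> y) t) \<le> C"
proof -
  define y1 where "y1 = (y0 + pi / 4) / 2"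
  have y1: "y0 < y1" "y1 < pi / 4" using y0 by (auto simp: y1_def)
  obtain A where A: "A \<ge> 0" "\<And>w s. norm w \<le> R + 1 \<Longrightarrow> \<bar>Re s\<bar> \<le> R + 1 \<Longrightarrow> norm (xi w s) \<le> A * exp (- y1 * \<bar>Im s\<bar>)"
    using xi_exp_decay[of "R + 1" y1] R y1 by auto
  define d where "d = y1 - y0"
  have d: "d > 0" using y1 by (simp add: d_def)
  obtain K where K: "K \<ge> 0" "\<And>x. x \<ge> 0 \<Longrightarrow> x ^ n * exp (- d * x) \<le> K"
    using power_exp_bound[OF d, of n] by blast
  have "norm (of_real (t ^ n) * iter_deriv m (twisted_xi w \<sigma> y) t) \<le> fact m * (A * exp d) * K"
    if w: "norm w \<le> R" and \<sigma>: "\<bar>\<sigma>\<bar> \<le> R" and y: "\<bar>y\<bar> \<le> y0" for w \<sigma> y t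
  proof -
    have "norm ((deriv ^^ m) (twisted_ext w \<sigma> y) (of_real t)) \<le> fact m * (A * exp d * exp (- d * \<bar>t\<bar>)) / 1 ^ m"
    proof (rule Cauchy_inequality)
      show "twisted_ext w \<sigma> y holomorphic_on ball (of_real t) 1" by (rule holomorphic_twisted_ext)
      show "continuous_on (cball (of_real t) 1) (twisted_ext w \<sigma> y)"
        by (intro holomorphic_on_imp_continuous_on holomorphic_twisted_ext)
      fix z :: complex assume z: "norm (of_real t - z) = 1"
      have re: "\<bar>t - Re z\<bar> \<le> 1" and im: "\<bar>Im z\<bar> \<le> 1"
        using abs_Re_le_cmod[of "of_real t - z"] abs_Im_le_cmod[of "of_real t - z"] z by auto
      have "norm (xi w (of_real \<sigma> + \<i> * z)) \<le> A * exp (- y1 * \<bar>Re z\<bar>)"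
        using A(2)[of w "of_real \<sigma> + \<i> * z"] w \<sigma> im by simp
      moreover have "norm (exp (of_real y * z)) \<le> exp (y0 * \<bar>Re z\<bar>)"
      proof -
        have "y * Re z \<le> \<bar>y\<bar> * \<bar>Re z\<bar>" by (metis abs_ge_self abs_mult)
        also have "\<dots> \<le> y0 * \<bar>Re z\<bar>" using y by (intro mult_right_mono) auto
        finally show ?thesis by simp
      qed
      ultimately have "norm (twisted_ext w \<sigma> y z) \<le> exp (y0 * \<bar>Re z\<bar>) * (A * exp (- y1 * \<bar>Re z\<bar>))"
        unfolding twisted_ext_def norm_mult by (intro mult_mono) auto
      also have "\<dots> = A * exp (- d * \<bar>Re z\<bar>)"
        by (simp add: d_def exp_add[symmetric] algebra_simps)
      \<comment> \<open>Passing from the circle to its centre changes |Re z| by at most 1 and so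
        costs a factor e^d.\<close>
      also have "\<dots> \<le> A * exp (d - d * \<bar>t\<bar>)"
      proof -
        have "\<bar>t\<bar> \<le> 1 + \<bar>Re z\<bar>" using re by linarith
        then have "d * \<bar>t\<bar> \<le> d * (1 + \<bar>Re z\<bar>)" using d by simp
        then have "- d * \<bar>Re z\<bar> \<le> d - d * \<bar>t\<bar>" by (simp add: algebra_simps)
        then show ?thesis using A(1) by (simp add: mult_left_mono)
      qed
      also have "\<dots> = A * exp d * exp (- d * \<bar>t\<bar>)" by (simp add: exp_diff exp_minus field_simps)
      finally show "norm (twisted_ext w \<sigma> y z) \<le> A * exp d * exp (- d * \<bar>t\<bar>)" .
    qed simp
    then have "norm (iter_deriv m (twisted_xi w \<sigma> y) t) \<le> fact m * (A * exp d) * exp (- d * \<bar>t\<bar>)"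
      by (simp add: twisted_xi_eq iter_deriv_of_real[OF holomorphic_twisted_ext] mult.assoc)
    then have "norm (of_real (t ^ n) * iter_deriv m (twisted_xi w \<sigma> y) t) \<le> \<bar>t\<bar> ^ n * (fact m * (A * exp d) * exp (- d * \<bar>t\<bar>))"
      by (simp add: norm_mult norm_power mult_left_mono)
    also have "\<dots> = fact m * (A * exp d) * (\<bar>t\<bar> ^ n * exp (- d * \<bar>t\<bar>))" by simp
    also have "\<dots> \<le> fact m * (A * exp d) * K"
      using A(1) by (intro mult_left_mono K) auto
    finally show ?thesis .
  qed
  then show ?thesis by blast
qed

text \<open>Compactness makes the open condition |y| < pi/4 uniform: |y| attains its maximum on
  \<Omega>, and the maximum is still below pi/4. The empty set has no maximum and is treated
  apart.\<close>

lemma param_bounds: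
  assumes "compact \<Omega>" "\<Omega> \<subseteq> param_domain"
  obtains R y0 where "0 \<le> R" "0 \<le> y0" "y0 < pi / 4"
    "\<And>w \<sigma> y. (w, \<sigma>, y) \<in> \<Omega> \<Longrightarrow> norm w \<le> R \<and> \<bar>\<sigma>\<bar> \<le> R \<and> \<bar>y\<bar> \<le> y0"
proof (cases "\<Omega> = {}")
  case True
  show ?thesis by (rule that[of 0 0]) (use True in auto)
next
  case False
  obtain R where R: "R > 0" "\<And>p. p \<in> \<Omega> \<Longrightarrow> norm p \<le> R"
    using compact_imp_bounded[OF assms(1)] by (auto simp: bounded_pos)
  have "\<exists>p\<in>\<Omega>. \<forall>q\<in>\<Omega>. \<bar>snd (snd q)\<bar> \<le> \<bar>snd (snd p)\<bar>"
    by (rule continuous_attains_sup[OF assms(1) False]) (intro continuous_intros)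
  then obtain p where p: "p \<in> \<Omega>" "\<And>q. q \<in> \<Omega> \<Longrightarrow> \<bar>snd (snd q)\<bar> \<le> \<bar>snd (snd p)\<bar>" by blast
  show ?thesis
  proof (rule that[of R "\<bar>snd (snd p)\<bar>"])
    show "\<bar>snd (snd p)\<bar> < pi / 4"
      using assms(2) p(1) by (auto simp: param_domain_def)
    fix w \<sigma> y assume q: "(w, \<sigma>, y) \<in> \<Omega>"
    have "norm w \<le> norm (w, \<sigma>, y)" "norm (\<sigma>, y) \<le> norm (w, \<sigma>, y)" "norm \<sigma> \<le> norm (\<sigma>, y)"
      using norm_fst_le[of w "(\<sigma>, y)"] norm_snd_le[of "(\<sigma>, y)" w] norm_fst_le[of \<sigma> y] by auto
    then show "norm w \<le> R \<and> \<bar>\<sigma>\<bar> \<le> R \<and> \<bar>y\<bar> \<le> \<bar>snd (snd p)\<bar>"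
      using R(2)[OF q] p(2)[OF q] by auto
  qed (use R in auto)
qed

theorem theorem4p3:
  shows "(\<forall>(w::complex) (\<sigma>::real) (y::real). - pi / 4 < y \<and> y < pi / 4 \<longrightarrow>
            twisted_xi w \<sigma> y \<in> schwartz_space)
       \<and> (\<forall>\<Omega>. compact \<Omega> \<and> \<Omega> \<subseteq> param_domain \<longrightarrow>
            (\<forall>m n. \<exists>C::real. \<forall>(w, \<sigma>, y)\<in>\<Omega>. schwartz_const n m (twisted_xi w \<sigma> y) \<le> ereal C)
          \<and> (\<exists>A\<^sub>1::real. \<forall>(w, \<sigma>, y)\<in>\<Omega>. \<forall>t::real.
               norm (complex_of_real (exp (y * t)) * xi_Q w (Complex \<sigma> t)) \<le> A\<^sub>1))"
proof (intro conjI allI impI)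
  \<comment> \<open>Every claim is an instance of this bound: a one-point \<Omega> gives Schwartz
    membership, and m = n = 0 gives the final constant.\<close>
  have uniform: "\<exists>C. \<forall>(w, \<sigma>, y)\<in>\<Omega>. \<forall>t. norm (of_real (t ^ n) * iter_deriv m (twisted_xi w \<sigma> y) t) \<le> C"
    if \<Omega>: "compact \<Omega>" "\<Omega> \<subseteq> param_domain" for \<Omega> n m
  proof -
    obtain R y0 where b: "0 \<le> R" "0 \<le> y0" "y0 < pi / 4"
      "\<And>w \<sigma> y. (w, \<sigma>, y) \<in> \<Omega> \<Longrightarrow> norm w \<le> R \<and> \<bar>\<sigma>\<bar> \<le> R \<and> \<bar>y\<bar> \<le> y0"
      by (rule param_bounds[OF \<Omega>]) blast
    show ?thesis
      using twisted_xi_schwartz_bound[OF b(1,2,3), of n m] b(4) by (fastforce simp: case_prod_unfold)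
  qed
  have const: "\<exists>C. \<forall>(w, \<sigma>, y)\<in>\<Omega>. schwartz_const n m (twisted_xi w \<sigma> y) \<le> ereal C"
    if \<Omega>: "compact \<Omega>" "\<Omega> \<subseteq> param_domain" for \<Omega> n m
  proof -
    obtain C where "\<forall>(w, \<sigma>, y)\<in>\<Omega>. \<forall>t. norm (of_real (t ^ n) * iter_deriv m (twisted_xi w \<sigma> y) t) \<le> C"
      using uniform[OF \<Omega>] by blast
    then have "\<forall>(w, \<sigma>, y)\<in>\<Omega>. schwartz_const n m (twisted_xi w \<sigma> y) \<le> ereal C"
      unfolding schwartz_const_def by (auto intro!: SUP_least)
    then show ?thesis by blast
  qed
  {
    fix w :: complex and \<sigma> y :: real assume y: "- pi / 4 < y \<and> y < pi / 4"
    have "smooth (twisted_xi w \<sigma> y)"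
      unfolding twisted_xi_eq by (rule smooth_of_real[OF holomorphic_twisted_ext])
    moreover have "schwartz_const n m (twisted_xi w \<sigma> y) < \<infinity>" for m n
      using const[of "{(w, \<sigma>, y)}" n m] y by (auto simp: param_domain_def intro: order.strict_trans1)
    ultimately show "twisted_xi w \<sigma> y \<in> schwartz_space"
      by (simp add: schwartz_space_def)
  next
    fix \<Omega> and m n :: nat assume \<Omega>: "compact \<Omega> \<and> \<Omega> \<subseteq> param_domain"
    then show "\<exists>C. \<forall>(w, \<sigma>, y)\<in>\<Omega>. schwartz_const n m (twisted_xi w \<sigma> y) \<le> ereal C"
      using const by blast
  next
    fix \<Omega> assume \<Omega>: "compact \<Omega> \<and> \<Omega> \<subseteq> param_domain"
    then obtain C where "\<forall>(w, \<sigma>, y)\<in>\<Omega>. \<forall>t. norm (of_real (t ^ 0) * iter_deriv 0 (twisted_xi w \<sigma> y) t) \<le> C"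
      using uniform[of \<Omega> 0 0] by blast
    then show "\<exists>A\<^sub>1. \<forall>(w, \<sigma>, y)\<in>\<Omega>. \<forall>t. norm (complex_of_real (exp (y * t)) * xi_Q w (Complex \<sigma> t)) \<le> A\<^sub>1"
      by (auto simp: iter_deriv_def twisted_xi_def)
  }
qed

end
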